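(* The polynomial $$\lambda(\beta_1,\dots,\beta_n)=\mathrm{vol}_n\Bigl(\Lambda(\beta_1+\dots+\beta_n,\ \beta_2+\dots+\beta_n,\ \dots,\ \beta_n)\Bigr)$$ is Lorentzian.
   Context: For real numbers $\alpha_1\ge\dots\ge\alpha_n\ge0$ the SIM-body is $$\Lambda(\alpha_1,\dots,\alpha_n)=\Bigl\{x\in\mathbb{R}^n_{\ge0}\ \Big|\ \sum_{i\in I}x_i\le\alpha_1+\dots+\alpha_k\text{ for all }I\subseteq\{1,\dots,n\}\text{ with }\#I=k,\ k\ge1\Bigr\}.$$ Its $n$-dimensional volume $\mathrm{vol}_n$ is given by a homogeneous polynomial of degree $n$ in the parameters $\alpha_1,\dots,\alpha_n$; the polynomial $\lambda$ arises from it by the linear substitution $\alpha_k=\beta_k+\dots+\beta_n$, where $\alpha_1\ge\dots\ge\alpha_n\ge0$ if and only if $\beta_1,\dots,\beta_n\ge0$. Following Brändén and Huh, a homogeneous real polynomial with positive coefficients is called Lorentzian if all its iterated partial derivatives all the way down to degree two yield quadratic forms of Lorentzian signature $({-}{+}{+}\cdots{+})$.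
   Formalization: "Lorentzian signature" is read with the opposite sign convention (exactly one plus sign, the rest minus) and a radical is allowed, as in Brändén and Huh; the nondegenerate signature fails for n = 3, where the Hessian of ∂λ/∂β₃ has rank 2. *)

theory Defs
  imports "HOL-Analysis.Analysis" "HOL-Library.Poly_Mapping" "Jordan_Normal_Form.Matrix"
begin

section \<open>SIM-bodies\<close>

text \<open>Vectors in \<open>\<real>\<^sup>n\<close> are functions extensional on \<open>{1..n}\<close>, so that the Lebesgue measure of
  \<open>\<real>\<^sup>n\<close> is the product measure of \<open>n\<close> copies of \<^const>\<open>lborel\<close>.\<close>

definition vol :: "nat \<Rightarrow> (nat \<Rightarrow> real) set \<Rightarrow> real" where
  "vol n S = measure (\<Pi>\<^sub>M i\<in>{1..n}. lborel) S"

definition sim_body :: "nat \<Rightarrow> (nat \<Rightarrow> real) \<Rightarrow> (nat \<Rightarrow> real) set" where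
  "sim_body n \<alpha> = {x \<in> {1..n} \<rightarrow>\<^sub>E {0..}.
     \<forall>I k. I \<subseteq> {1..n} \<and> card I = k \<and> k \<ge> 1 \<longrightarrow> (\<Sum>i\<in>I. x i) \<le> (\<Sum>j=1..k. \<alpha> j)}"

section \<open>Real polynomials in the variables with indices in \<open>{1..n}\<close>\<close>

text \<open>A polynomial maps each monomial, given by its finitely supported exponent vector, to its
  coefficient.\<close>

type_synonym monomial = "nat \<Rightarrow>\<^sub>0 nat"
type_synonym rpoly = "monomial \<Rightarrow>\<^sub>0 real"

definition monomial_degree :: "monomial \<Rightarrow> nat" where
  "monomial_degree m = (\<Sum>i\<in>Poly_Mapping.keys m. Poly_Mapping.lookup m i)"

definition rpoly_eval :: "(nat \<Rightarrow> real) \<Rightarrow> rpoly \<Rightarrow> real" where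
  "rpoly_eval \<beta> p = (\<Sum>m\<in>Poly_Mapping.keys p.
     Poly_Mapping.lookup p m * (\<Prod>i\<in>Poly_Mapping.keys m. \<beta> i ^ Poly_Mapping.lookup m i))"

text \<open>The subtraction of exponents is truncated only where the new coefficient is zero.\<close>

definition partial_deriv :: "nat \<Rightarrow> rpoly \<Rightarrow> rpoly" where
  "partial_deriv i p =
     (\<Sum>m\<in>Poly_Mapping.keys p. Poly_Mapping.single (m - Poly_Mapping.single i 1)
        (real (Poly_Mapping.lookup m i) * Poly_Mapping.lookup p m))"

lemma lookup_partial_deriv:
  "Poly_Mapping.lookup (partial_deriv i p) m =
     real (Poly_Mapping.lookup m i + 1) * Poly_Mapping.lookup p (m + Poly_Mapping.single i 1)"
proof -
  let ?s = "Poly_Mapping.single i (1::nat)"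
  have "Poly_Mapping.lookup (partial_deriv i p) m =
      (\<Sum>m'\<in>Poly_Mapping.keys p.
        if m' = m + ?s then real (Poly_Mapping.lookup m' i) * Poly_Mapping.lookup p m' else 0)"
    unfolding partial_deriv_def lookup_sum
  proof (rule sum.cong[OF refl])
    fix m' assume "m' \<in> Poly_Mapping.keys p"
    show "Poly_Mapping.lookup (Poly_Mapping.single (m' - ?s) (real (Poly_Mapping.lookup m' i) *
          Poly_Mapping.lookup p m')) m =
        (if m' = m + ?s then real (Poly_Mapping.lookup m' i) * Poly_Mapping.lookup p m' else 0)"
    proof (cases "Poly_Mapping.lookup m' i = 0")
      case True
      then show ?thesis by auto
    next
      case False
      then have "m' - ?s + ?s = m'"
        by (intro poly_mapping_eqI) (auto simp: lookup_add lookup_minus lookup_single when_def)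
      then have "m' - ?s = m \<longleftrightarrow> m' = m + ?s"
        by (metis add_diff_cancel_right')
      then show ?thesis by (simp add: lookup_single when_def)
    qed
  qed
  then show ?thesis
    by (simp add: sum.delta in_keys_iff lookup_add)
qed

section \<open>Lorentzian polynomials\<close>

text \<open>The Gram matrix \<open>A\<close> of a quadratic form \<open>q\<close>, so that \<open>q(\<beta>) = \<beta>\<^sup>T A \<beta>\<close>: half the
  (constant) Hessian. Row and column \<open>i\<close> belong to the variable with index \<open>i + 1\<close>.\<close>

definition gram_mat :: "nat \<Rightarrow> rpoly \<Rightarrow> real mat" where
  "gram_mat n q =
     mat n n (\<lambda>(i, j). Poly_Mapping.lookup (partial_deriv (Suc i) (partial_deriv (Suc j) q)) 0 / 2)"

text \<open>Signature in the sense of Sylvester's law of inertia: \<open>p\<close> plus signs, \<open>r\<close> minus signs and a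
  radical of dimension \<open>n - p - r\<close>.\<close>

definition has_signature :: "nat \<Rightarrow> real mat \<Rightarrow> nat \<Rightarrow> nat \<Rightarrow> bool" where
  "has_signature n A p r \<longleftrightarrow> p + r \<le> n \<and>
     (\<exists>P \<in> carrier_mat n n. invertible_mat P \<and>
        transpose_mat P * A * P =
          mat n n (\<lambda>(i, j). if i \<noteq> j then 0 else if i < p then 1 else if i < p + r then - 1 else 0))"

text \<open>In the sign convention of Braenden and Huh, where the positive direction comes first, the
  form has exactly one plus sign and no more than \<open>n - 1\<close> minus signs. A radical has to be
  allowed: limits of forms of signature \<open>(1, n - 1)\<close> count as Lorentzian, and already for
  \<open>n = 3\<close> the derivative of the volume polynomial of the SIM-body with respect to \<open>\<beta>\<^sub>3\<close> has
  Gram matrix with rows \<open>(3/2, 3, 3)\<close>, \<open>(3, 3, 3)\<close>, \<open>(3, 3, 3)\<close>, of signature \<open>(1, 1)\<close>.\<close>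

definition lorentzian_signature :: "nat \<Rightarrow> real mat \<Rightarrow> bool" where
  "lorentzian_signature n A \<longleftrightarrow> (\<exists>r. has_signature n A 1 r)"

text \<open>Positivity is required of the coefficients of all monomials of degree \<open>d\<close> in the \<open>n\<close>
  variables. For such polynomials the support is M-convex, and the condition below is the
  characterization of (not necessarily strictly) Lorentzian polynomials by Braenden and Huh.\<close>

definition lorentzian :: "nat \<Rightarrow> nat \<Rightarrow> rpoly \<Rightarrow> bool" where
  "lorentzian n d p \<longleftrightarrow>
     (\<forall>m\<in>Poly_Mapping.keys p. Poly_Mapping.keys m \<subseteq> {1..n} \<and> monomial_degree m = d) \<and>
     (\<forall>m. Poly_Mapping.keys m \<subseteq> {1..n} \<and> monomial_degree m = d \<longrightarrow>
        Poly_Mapping.lookup p m > 0) \<and>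
     (\<forall>is. set is \<subseteq> {1..n} \<and> length is + 2 = d \<longrightarrow>
        lorentzian_signature n (gram_mat n (foldr partial_deriv is p)))"

end

theory Submission
  imports Defs
begin

text \<open>The coefficients of a polynomial in divided powers \<open>\<Prod> \<beta>\<^sub>i ^ m\<^sub>i / m\<^sub>i!\<close> are regarded as a
functional \<open>F\<close> on multisets of sites: the multiset \<open>M\<close> stands for the monomial, \<open>F M\<close> is the
derivative of the polynomial along \<open>M\<close> at \<open>0\<close>, and differentiating with respect to \<open>\<beta>\<^sub>i\<close> is
adding the site \<open>i\<close> to the argument.

The volume is computed by Cavalieri's principle. The slice of the SIM-body of dimension \<open>n + 1\<close>
at \<open>x\<^sub>n\<^sub>+\<^sub>1 = c\<close>, where \<open>\<alpha>\<^sub>j\<^sub>+\<^sub>1 \<le> c \<le> \<alpha>\<^sub>j\<close>, is the SIM-body of dimension \<open>n\<close> in which the two entries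
\<open>\<alpha>\<^sub>j\<close> and \<open>\<alpha>\<^sub>j\<^sub>+\<^sub>1\<close> are replaced by \<open>\<alpha>\<^sub>j + \<alpha>\<^sub>j\<^sub>+\<^sub>1 - c\<close> (\<open>sim_body_slice\<close>). In the \<open>\<beta>\<close> this means that
\<open>\<beta>\<^sub>j\<close> is cut in two pieces, which are given to its neighbours. Integrating over \<open>c\<close> turns this
into a recursion for the coefficients, \<open>sim_coeff\<close>: choose an occupied site, remove one of its
particles, and send some of the others to the left and the rest to the right. The coefficients
are visibly positive.

Write \<open>D\<^sub>k = 2\<partial>\<^sub>k - \<partial>\<^sub>k\<^sub>-\<^sub>1 - \<partial>\<^sub>k\<^sub>+\<^sub>1\<close>, with \<open>\<partial>\<^sub>0 = 0\<close> and \<open>\<partial>\<^sub>n\<^sub>+\<^sub>1 = \<partial>\<^sub>n\<close>. This is the derivative with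
respect to the right hand side \<open>\<alpha>\<^sub>1 + \<dots> + \<alpha>\<^sub>k\<close> of the inequalities for sets of size \<open>k\<close>, so \<open>D\<^sub>k \<lambda>\<close>
measures the facets that these inequalities define; the facets do not depend on \<open>\<beta>\<^sub>k\<close>, whence \<open>\<partial>\<^sub>k
D\<^sub>k \<lambda> = 0\<close>. In other words \<open>\<lambda>\<close> satisfies relations of the kind that Klyachko found for the
invariant part of the cohomology of permutohedral varieties. They are derived here from the
recursion alone (\<open>second_diff_sim_coeff\<close>), by commuting \<open>D\<^sub>k\<close> with the operators that the
recursion sums.

The Lorentzian property is a consequence of these relations (\<open>polar_hyperbolic\<close>). The matrix \<open>C\<close>
of the operators \<open>D\<^sub>k\<close> is a Stieltjes matrix: symmetric, positive definite and with non-positive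
entries off the diagonal. If \<open>\<partial>\<^sub>t D\<^sub>t G = 0\<close> for all \<open>t\<close> in a finite set \<open>T\<close>, then \<open>D\<^sub>t G\<close> no
longer involves the variable \<open>t\<close> and satisfies the same relations for \<open>T - {t}\<close>, and so one can
argue by induction, as with the facets of a polytope. For a positive vector \<open>v\<close> the derivative
along \<open>v\<close> is \<open>\<Sum> c\<^sub>t D\<^sub>t\<close> with \<open>c\<^sub>t > 0\<close>, because the inverse of \<open>C\<close> has no negative entries. The
reversed Cauchy-Schwarz inequalities for the forms that come from the \<open>D\<^sub>t G\<close> add up to the
inequality \<open>S\<^sup>2 \<ge> S\<close> for a self-adjoint operator \<open>S\<close> that represents the form coming from \<open>G\<close>: no
eigenvalue lies strictly between \<open>0\<close> and \<open>1\<close>. The coordinate vector of \<open>v\<close> is a positive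
eigenvector to the eigenvalue \<open>1\<close> and the entries of \<open>S\<close> off the diagonal are positive, so \<open>1\<close>
is the largest eigenvalue and it is simple, as in the theorem of Perron and Frobenius. Hence \<open>S\<close>
has exactly one positive eigenvalue (\<open>bochner_criterion\<close>). This is the argument of Bochner type
known from proofs of the Alexandrov-Fenchel inequality. Directions with some zero entries are
reached by a limit.\<close>

section \<open>Forms with one positive direction\<close>

text \<open>A quadratic polynomial with non-negative leading coefficient that takes a non-positive value has
a non-negative discriminant.\<close>

lemma reversed_cauchy_schwarz:
  fixes a b d r :: real
  assumes "a * r\<^sup>2 - 2 * b * r + d \<le> 0" "a \<ge> 0"
  shows "a * d \<le> b\<^sup>2"
proof -
  have "(a * r - b)\<^sup>2 + a * d - b\<^sup>2 = a * (a * r\<^sup>2 - 2 * b * r + d)"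
    by (simp add: power2_eq_square algebra_simps)
  also have "\<dots> \<le> 0" using assms by (simp add: mult_nonneg_nonpos)
  finally show ?thesis by (smt (verit) zero_le_power2)
qed

text \<open>If \<open>Q\<close> is not positive on the orthogonal complement of one vector \<open>v\<close>, the Cauchy-Schwarz
inequality is reversed for every \<open>y\<close> with \<open>Q(y, y) \<ge> 0\<close> that is not orthogonal to \<open>v\<close>: some \<open>x -
r y\<close> is orthogonal to \<open>v\<close>, and \<open>Q\<close> is not positive there.\<close>

lemma hyperbolic_transfer:
  fixes Q :: "('i \<Rightarrow> real) \<Rightarrow> ('i \<Rightarrow> real) \<Rightarrow> real"
  assumes symm: "\<And>x y. Q x y = Q y x"
    and lin: "\<And>u x y r. Q u (\<lambda>i. x i - r * y i) = Q u x - r * Q u y"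
    and neg: "\<And>x. Q v x = 0 \<Longrightarrow> Q x x \<le> 0"
    and y: "Q v y \<noteq> 0" "Q y y \<ge> 0"
  shows "Q x x * Q y y \<le> (Q x y)\<^sup>2"
proof -
  define r where "r = Q v x / Q v y"
  define z where "z i = x i - r * y i" for i
  have Qz: "Q u z = Q u x - r * Q u y" for u
    unfolding z_def by (rule lin)
  have "Q v z = 0" unfolding Qz using y by (simp add: r_def)
  then have "Q z z \<le> 0" by (rule neg)
  also have "Q z z = Q y y * r\<^sup>2 - 2 * Q x y * r + Q x x"
  proof -
    have "Q z z = Q z x - r * Q z y" by (rule Qz)
    also have "Q z x = Q x x - r * Q x y" by (simp only: symm[of z] Qz)
    also have "Q z y = Q x y - r * Q y y" by (simp only: symm[of z] Qz symm[of y x])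
    finally show ?thesis by (simp add: power2_eq_square algebra_simps)
  qed
  finally have "Q y y * Q x x \<le> (Q x y)\<^sup>2"
    using y by (intro reversed_cauchy_schwarz) auto
  then show ?thesis by (simp add: mult.commute)
qed

section \<open>Maximising a Rayleigh quotient\<close>

lemma compact_coordinate_box:
  "compact {x :: 'i \<Rightarrow> real. \<forall>i. x i \<in> (if i \<in> T then {-b i..b i} else {0})}"
proof -
  have "compactin (product_topology (\<lambda>i. euclidean :: real topology) UNIV)
      (PiE UNIV (\<lambda>i. if i \<in> T then {-b i..b i} else {0}))"
    by (subst compactin_PiE) auto
  moreover have "PiE UNIV (\<lambda>i. if i \<in> T then {-b i..b i} else {0}) =
      {x :: 'i \<Rightarrow> real. \<forall>i. x i \<in> (if i \<in> T then {-b i..b i} else {0})}"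
    by (auto simp: PiE_iff split del: if_split)
  ultimately show ?thesis
    by (simp add: euclidean_product_topology)
qed

text \<open>The quadratic polynomial is a positive semidefinite form along a line through \<open>x\<close>; if the form
vanishes at \<open>x\<close>, then \<open>x\<close> lies in its radical.\<close>

lemma psd_form_kernel:
  fixes a b d :: real
  assumes "\<And>r. 0 \<le> a + 2 * r * b + r\<^sup>2 * d" and "a = 0"
  shows "b = 0"
proof (rule ccontr)
  assume "b \<noteq> 0"
  \<comment> \<open>Small enough for the linear term to dominate, with the opposite sign.\<close>
  define r where "r = - b / (1 + \<bar>d\<bar>)"
  have "0 \<le> 2 * r * b + r\<^sup>2 * d" using assms(1)[of r] \<open>a = 0\<close> by simp
  also have "\<dots> \<le> 2 * r * b + r\<^sup>2 * (1 + \<bar>d\<bar>)" by (intro add_left_mono mult_left_mono) auto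
  also have "\<dots> = - b\<^sup>2 / (1 + \<bar>d\<bar>)"
    by (simp add: r_def power2_eq_square divide_simps)
  also have "\<dots> < 0" using \<open>b \<noteq> 0\<close> by (simp add: divide_neg_pos add_pos_nonneg)
  finally show False by simp
qed

lemma continuous_on_eval [continuous_intros]: "continuous_on S (\<lambda>x :: 'i \<Rightarrow> real. x i)"
  by (rule continuous_on_subset[OF continuous_on_product_coordinates]) simp

text \<open>If the form \<open>q\<close> takes a positive value on the hyperplane \<open>p\<^sup>\<bottom>\<close>, the maximum of its Rayleigh
quotient there, with respect to the weights \<open>w\<close>, is attained by compactness. The maximiser is a
critical point on the hyperplane only; the last hypothesis says that the vector \<open>p / w\<close>, which
is normal to the hyperplane, is fixed by the operator \<open>w\<^sup>-\<^sup>1 q\<close>, so that the hyperplane is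
invariant and the critical point is a true eigenvector.\<close>

lemma rayleigh_maximum:
  fixes q :: "'i \<Rightarrow> 'i \<Rightarrow> real" and w p :: "'i \<Rightarrow> real"
  assumes "finite T" and sym: "\<And>s t. s \<in> T \<Longrightarrow> t \<in> T \<Longrightarrow> q s t = q t s"
    and w: "\<And>t. t \<in> T \<Longrightarrow> w t > 0"
    and x0: "(\<Sum>t\<in>T. p t * x0 t) = 0" "(\<Sum>s\<in>T. \<Sum>t\<in>T. x0 s * q s t * x0 t) > 0"
    and inv: "\<And>t. t \<in> T \<Longrightarrow> (\<Sum>s\<in>T. q t s * (p s / w s)) = p t"
  shows "\<exists>x \<mu>. \<mu> > 0 \<and> (\<Sum>t\<in>T. w t * (x t)\<^sup>2) = 1 \<and> (\<Sum>t\<in>T. p t * x t) = 0 \<and>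
           (\<forall>t\<in>T. (\<Sum>s\<in>T. q t s * x s) = \<mu> * w t * x t)"
proof -
  define Q where "Q x y = (\<Sum>s\<in>T. \<Sum>t\<in>T. x s * q s t * y t)" for x y
  define N where "N x y = (\<Sum>t\<in>T. w t * x t * y t)" for x y
  define P where "P x = (\<Sum>t\<in>T. p t * x t)" for x
  have Q_add: "Q (\<lambda>t. x t + r * y t) (\<lambda>t. x t + r * y t) = Q x x + 2 * r * Q x y + r\<^sup>2 * Q y y" for x y r
  proof -
    have "Q y x = Q x y" for x y
      unfolding Q_def by (subst sum.swap) (auto intro!: sum.cong simp: sym)
    then have "2 * r * Q x y = r * Q x y + r * Q y x" by simp
    then show ?thesis
      unfolding Q_def by (simp add: algebra_simps power2_eq_square sum.distrib sum_distrib_left)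
  qed
  have N_add: "N (\<lambda>t. x t + r * y t) (\<lambda>t. x t + r * y t) = N x x + 2 * r * N x y + r\<^sup>2 * N y y" for x y r
    unfolding N_def by (simp add: algebra_simps power2_eq_square sum.distrib sum_distrib_left)
  have P_add: "P (\<lambda>t. x t + r * y t) = P x + r * P y" for x y r
    unfolding P_def by (simp add: algebra_simps sum.distrib sum_distrib_left)
  have N_pos: "N x x > 0" if "t \<in> T" "x t \<noteq> 0" for x t
    unfolding N_def using that w \<open>finite T\<close>
    by (intro sum_pos2[where i = t]) (auto simp: mult.assoc less_imp_le zero_less_mult_iff linorder_neq_iff)
  \<comment> \<open>The unit sphere of the hyperplane; the box makes its compactness evident.\<close>
  define K where "K = {x. \<forall>i. x i \<in> (if i \<in> T then {- sqrt (1 / w i)..sqrt (1 / w i)} else {0})}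
      \<inter> {x. N x x = 1 \<and> P x = 0}"
  have K_I: "\<exists>y\<in>K. Q y y * N x x = Q x x" if "P x = 0" "t \<in> T" "x t \<noteq> 0" for x t
  proof -
    define m where "m = N x x"
    have "m > 0" using N_pos that by (simp add: m_def)
    define y where "y i = (if i \<in> T then x i / sqrt m else 0)" for i
    have Ny: "N y y = 1"
    proof -
      have "N y y = N x x / m"
        unfolding N_def sum_divide_distrib
        by (intro sum.cong) (use \<open>m > 0\<close> in \<open>auto simp: y_def\<close>)
      then show ?thesis using \<open>m > 0\<close> by (simp add: m_def)
    qed
    have "P y = P x / sqrt m"
      unfolding P_def sum_divide_distrib by (intro sum.cong) (auto simp: y_def)
    then have "P y = 0" using that by simp
    moreover have "y i \<in> {- sqrt (1 / w i)..sqrt (1 / w i)}" if "i \<in> T" for i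
    proof -
      have "w i * y i * y i \<le> N y y"
        unfolding N_def using \<open>finite T\<close> that w
        by (intro member_le_sum) (auto simp: mult.assoc less_imp_le)
      then have "(y i)\<^sup>2 \<le> 1 / w i" using Ny w[OF that] by (simp add: field_simps power2_eq_square)
      then have "\<bar>y i\<bar> \<le> sqrt (1 / w i)" by (metis real_sqrt_abs real_sqrt_le_mono)
      then show ?thesis by auto
    qed
    ultimately have "y \<in> K" using Ny by (auto simp: K_def y_def)
    moreover have "Q y y * m = Q x x"
      unfolding Q_def sum_distrib_right
      by (intro sum.cong) (use \<open>m > 0\<close> in \<open>auto simp: y_def\<close>)
    ultimately show ?thesis unfolding m_def by blast
  qed
  have "\<exists>t\<in>T. x0 t \<noteq> 0" 
  proof (rule ccontr)
    assume "\<not> (\<exists>t\<in>T. x0 t \<noteq> 0)"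
    then have "(\<Sum>s\<in>T. \<Sum>t\<in>T. x0 s * q s t * x0 t) = 0" by simp
    then show False using x0(2) by simp
  qed
  then obtain t0 where t0: "t0 \<in> T" "x0 t0 \<noteq> 0" by blast
  obtain y0 where y0: "y0 \<in> K" "Q y0 y0 * N x0 x0 = Q x0 x0"
    using K_I[of x0 t0] t0 x0 by (auto simp: P_def)
  have "compact K" unfolding K_def N_def P_def
    by (intro compact_Int_closed compact_coordinate_box closed_Collect_conj closed_Collect_eq
        continuous_intros)
  moreover have "continuous_on K (\<lambda>x. Q x x)" unfolding Q_def by (intro continuous_intros)
  ultimately obtain x where x: "x \<in> K" "\<And>y. y \<in> K \<Longrightarrow> Q y y \<le> Q x x"
    using continuous_attains_sup[of K "\<lambda>x. Q x x"] y0(1) by blast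
  define \<mu> where "\<mu> = Q x x"
  have "0 < Q x0 x0" using x0(2) by (simp add: Q_def)
  then have "\<mu> > 0"
    using x(2)[OF y0(1)] y0(2) N_pos[of t0 x0] t0 unfolding \<mu>_def
    by (metis less_le_trans zero_less_mult_pos2)
  have max: "Q y y \<le> \<mu> * N y y" if Py: "P y = 0" for y
  proof (cases "\<exists>t\<in>T. y t \<noteq> 0")
    case True
    then obtain t where t: "t \<in> T" "y t \<noteq> 0" by blast
    obtain z where "z \<in> K" "Q z z * N y y = Q y y" using K_I[OF Py t] by blast
    then show ?thesis using x(2)[of z] N_pos[of t y] t
      by (metis \<mu>_def less_imp_le mult_right_mono)
  qed (simp add: Q_def N_def)
  have xP: "P x = 0" and xN: "N x x = 1" using x(1) by (auto simp: K_def)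
  have crit: "\<mu> * N x y - Q x y = 0" if "P y = 0" for y
  proof (rule psd_form_kernel)
    fix r
    show "0 \<le> (\<mu> * N x x - Q x x) + 2 * r * (\<mu> * N x y - Q x y) + r\<^sup>2 * (\<mu> * N y y - Q y y)"
      using max[of "\<lambda>t. x t + r * y t"] that xP unfolding P_add Q_add N_add
      by (simp add: algebra_simps)
  qed (simp add: xN \<mu>_def)
  \<comment> \<open>Up to a factor the gradient of \<open>\<mu> N - Q\<close> at \<open>x\<close> for the weights \<open>w\<close>. It is orthogonal to the
    hyperplane because \<open>x\<close> is critical, and it lies in the hyperplane because \<open>x\<close> does.\<close>
  define d where "d t = \<mu> * x t - (\<Sum>s\<in>T. q t s * x s) / w t" for t
  have wd: "w t * d t = \<mu> * w t * x t - (\<Sum>s\<in>T. q t s * x s)" if "t \<in> T" for t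
    using w[OF that] by (simp add: d_def field_simps)
  have Nd: "N d y = \<mu> * N x y - Q x y" for y
  proof -
    have "N d y = (\<Sum>t\<in>T. \<mu> * (w t * x t * y t) - (\<Sum>s\<in>T. q t s * x s) * y t)"
      unfolding N_def
    proof (intro sum.cong refl)
      fix t assume "t \<in> T"
      then show "w t * d t * y t = \<mu> * (w t * x t * y t) - (\<Sum>s\<in>T. q t s * x s) * y t"
        by (subst wd) (simp_all add: left_diff_distrib mult.assoc)
    qed
    also have "\<dots> = \<mu> * N x y - (\<Sum>t\<in>T. \<Sum>s\<in>T. q t s * x s * y t)"
      by (simp add: N_def sum_subtractf sum_distrib_left sum_distrib_right)
    also have "(\<Sum>t\<in>T. \<Sum>s\<in>T. q t s * x s * y t) = Q x y"
      unfolding Q_def by (subst sum.swap) (auto intro!: sum.cong simp: sym)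
    finally show ?thesis .
  qed
  have "P d = N d (\<lambda>t. p t / w t)"
    unfolding P_def N_def using w by (intro sum.cong refl) (force simp: field_simps)
  also have "\<dots> = \<mu> * N x (\<lambda>t. p t / w t) - Q x (\<lambda>t. p t / w t)" by (rule Nd)
  also have "N x (\<lambda>t. p t / w t) = P x"
    unfolding P_def N_def using w by (intro sum.cong refl) (force simp: field_simps)
  also have "Q x (\<lambda>t. p t / w t) = P x"
  proof -
    have "Q x (\<lambda>t. p t / w t) = (\<Sum>s\<in>T. x s * (\<Sum>t\<in>T. q s t * (p t / w t)))"
      unfolding Q_def by (simp add: sum_distrib_left mult.assoc)
    also have "\<dots> = P x"
      unfolding P_def by (intro sum.cong refl) (simp only: inv mult.commute[of "x _"])
    finally show ?thesis .
  qed
  finally have "P d = 0" using xP by simp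
  then have "N d d = 0" using Nd crit by simp
  then have "d t = 0" if "t \<in> T" for t using N_pos[OF that] by fastforce
  then have "(\<Sum>s\<in>T. q t s * x s) = \<mu> * w t * x t" if "t \<in> T" for t using wd[OF that] that by simp
  then show ?thesis
    using \<open>\<mu> > 0\<close> xN xP unfolding N_def P_def
    by (intro exI[of _ x] exI[of _ \<mu>]) (simp add: power2_eq_square mult.assoc)
qed

text \<open>Let \<open>S = (c / p) q\<close>, an operator that is self-adjoint for the weights \<open>p / c\<close>. The hypothesis
\<open>bochner\<close> is \<open>S\<^sup>2 \<ge> S\<close>, and \<open>S c = c\<close> by the definition of \<open>p\<close>. An eigenvector orthogonal to \<open>c\<close>
with a positive eigenvalue \<open>\<mu>\<close> would have \<open>\<mu> \<ge> 1\<close> by the former, while \<open>\<mu> \<le> 1\<close>, with equality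
only for multiples of \<open>c\<close>, follows from writing \<open>1 - S\<close> as a Dirichlet form with the positive
conductances \<open>q\<^sub>s\<^sub>t c\<^sub>s c\<^sub>t\<close>.\<close>

theorem bochner_criterion:
  fixes q :: "'i \<Rightarrow> 'i \<Rightarrow> real" and c p :: "'i \<Rightarrow> real"
  assumes "finite T" and sym: "\<And>s t. s \<in> T \<Longrightarrow> t \<in> T \<Longrightarrow> q s t = q t s"
    and off: "\<And>s t. s \<in> T \<Longrightarrow> t \<in> T \<Longrightarrow> s \<noteq> t \<Longrightarrow> q s t > 0"
    and c: "\<And>t. t \<in> T \<Longrightarrow> c t > 0"
    and p: "\<And>t. t \<in> T \<Longrightarrow> (\<Sum>s\<in>T. q t s * c s) = p t" "\<And>t. t \<in> T \<Longrightarrow> p t > 0"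
    and bochner: "\<And>x. (\<Sum>s\<in>T. \<Sum>t\<in>T. x s * q s t * x t) \<le>
                    (\<Sum>t\<in>T. c t / p t * (\<Sum>s\<in>T. q t s * x s)\<^sup>2)"
    and orth: "(\<Sum>t\<in>T. p t * x0 t) = 0"
  shows "(\<Sum>s\<in>T. \<Sum>t\<in>T. x0 s * q s t * x0 t) \<le> 0"
proof (rule ccontr)
  assume pos: "\<not> ?thesis"
  have "(\<Sum>s\<in>T. q t s * (p s / (p s / c s))) = p t" if "t \<in> T" for t
  proof -
    have "p s / (p s / c s) = c s" if "s \<in> T" for s using p(2)[OF that] by simp
    then show ?thesis using p(1)[OF that] by simp
  qed
  then have "\<exists>x \<mu>. \<mu> > 0 \<and> (\<Sum>t\<in>T. p t / c t * (x t)\<^sup>2) = 1 \<and> (\<Sum>t\<in>T. p t * x t) = 0 \<and>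
           (\<forall>t\<in>T. (\<Sum>s\<in>T. q t s * x s) = \<mu> * (p t / c t) * x t)"
    using pos p(2) c
    by (intro rayleigh_maximum[where ?x0.0 = x0]) (auto simp: sym orth \<open>finite T\<close>)
  then obtain x \<mu> where \<mu>: "\<mu> > 0" and xN: "(\<Sum>t\<in>T. p t / c t * (x t)\<^sup>2) = 1"
    and xP: "(\<Sum>t\<in>T. p t * x t) = 0"
    and ev: "\<And>t. t \<in> T \<Longrightarrow> (\<Sum>s\<in>T. q t s * x s) = \<mu> * (p t / c t) * x t"
    by blast
  let ?Q = "\<Sum>s\<in>T. \<Sum>t\<in>T. x s * q s t * x t"
  have "?Q = (\<Sum>s\<in>T. x s * (\<Sum>t\<in>T. q s t * x t))"
    by (simp add: sum_distrib_left mult.assoc)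
  also have "\<dots> = (\<Sum>s\<in>T. \<mu> * (p s / c s * (x s)\<^sup>2))"
    by (intro sum.cong refl) (simp add: ev power2_eq_square)
  also have "\<dots> = \<mu>" unfolding sum_distrib_left[symmetric] xN by simp
  finally have Q: "?Q = \<mu>" .
  have "?Q \<le> (\<Sum>t\<in>T. c t / p t * (\<mu> * (p t / c t) * x t)\<^sup>2)"
    using bochner[of x] by (simp add: ev)
  also have "\<dots> = (\<Sum>t\<in>T. \<mu>\<^sup>2 * (p t / c t * (x t)\<^sup>2))"
    by (intro sum.cong refl) (use p(2) c in \<open>force simp: field_simps power2_eq_square\<close>)
  also have "\<dots> = \<mu>\<^sup>2" unfolding sum_distrib_left[symmetric] xN by simp
  finally have "\<mu> \<ge> 1" using Q \<mu> by (simp add: power2_eq_square)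
  \<comment> \<open>The Dirichlet form of \<open>x / c\<close>: as \<open>p\<close> consists of the sums of the conductances, it is twice
    the defect \<open>1 - \<mu>\<close>, and it vanishes only if \<open>x\<close> is a multiple of \<open>c\<close>.\<close>
  define y where "y t = x t / c t" for t
  have xy: "x t = c t * y t" if "t \<in> T" for t using c[OF that] by (simp add: y_def)
  have "(\<Sum>s\<in>T. \<Sum>t\<in>T. q s t * c s * c t * (y s - y t)\<^sup>2) =
      2 * (\<Sum>s\<in>T. \<Sum>t\<in>T. q s t * c s * c t * (y s)\<^sup>2) - 2 * (\<Sum>s\<in>T. \<Sum>t\<in>T. x s * q s t * x t)"
  proof -
    have "(\<Sum>s\<in>T. \<Sum>t\<in>T. q s t * c s * c t * (y t)\<^sup>2) = (\<Sum>s\<in>T. \<Sum>t\<in>T. q s t * c s * c t * (y s)\<^sup>2)"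
      by (subst sum.swap) (auto intro!: sum.cong simp: sym)
    moreover have "(\<Sum>s\<in>T. \<Sum>t\<in>T. x s * q s t * x t) = (\<Sum>s\<in>T. \<Sum>t\<in>T. q s t * c s * c t * y s * y t)"
      by (intro sum.cong refl) (simp add: xy)
    moreover have "(\<Sum>s\<in>T. \<Sum>t\<in>T. q s t * c s * c t * (y s - y t)\<^sup>2) =
       (\<Sum>s\<in>T. \<Sum>t\<in>T. q s t * c s * c t * (y s)\<^sup>2) + (\<Sum>s\<in>T. \<Sum>t\<in>T. q s t * c s * c t * (y t)\<^sup>2)
       - 2 * (\<Sum>s\<in>T. \<Sum>t\<in>T. q s t * c s * c t * y s * y t)"
      by (simp add: power2_diff algebra_simps sum.distrib sum_subtractf sum_distrib_left)
    ultimately show ?thesis by simp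
  qed
  also have "(\<Sum>s\<in>T. \<Sum>t\<in>T. q s t * c s * c t * (y s)\<^sup>2) = (\<Sum>s\<in>T. c s * (y s)\<^sup>2 * (\<Sum>t\<in>T. q s t * c t))"
    by (simp add: sum_distrib_left algebra_simps)
  also have "\<dots> = (\<Sum>s\<in>T. p s / c s * (x s)\<^sup>2)"
    by (intro sum.cong refl) (use c in \<open>force simp: p(1) xy power2_eq_square\<close>)
  finally have dirichlet: "(\<Sum>s\<in>T. \<Sum>t\<in>T. q s t * c s * c t * (y s - y t)\<^sup>2) \<le> 0"
    using xN Q \<open>\<mu> \<ge> 1\<close> by simp
  have nonneg: "q s t * c s * c t * (y s - y t)\<^sup>2 \<ge> 0" if "s \<in> T" "t \<in> T" for s t
    using off[OF that] c[OF that(1)] c[OF that(2)] by (cases "s = t") auto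
  have const: "y s = y t" if "s \<in> T" "t \<in> T" for s t
  proof (rule ccontr)
    assume "y s \<noteq> y t"
    then have "0 < q s t * c s * c t * (y s - y t)\<^sup>2"
      using off[OF that] c[OF that(1)] c[OF that(2)] by (cases "s = t") auto
    also have "\<dots> \<le> (\<Sum>t\<in>T. q s t * c s * c t * (y s - y t)\<^sup>2)"
      using that \<open>finite T\<close> nonneg by (intro member_le_sum) auto
    also have "\<dots> \<le> (\<Sum>s\<in>T. \<Sum>t\<in>T. q s t * c s * c t * (y s - y t)\<^sup>2)"
      using that \<open>finite T\<close> nonneg
      by (intro member_le_sum[where f = "\<lambda>s. \<Sum>t\<in>T. q s t * c s * c t * (y s - y t)\<^sup>2"]) (auto intro: sum_nonneg)
    finally show False using dirichlet by simp
  qed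
  have "T \<noteq> {}" using xN by auto
  then obtain t0 where t0: "t0 \<in> T" by blast
  have "0 = (\<Sum>t\<in>T. p t * c t * y t0)"
    unfolding xP[symmetric] by (intro sum.cong refl) (simp add: xy const[OF _ t0])
  also have "\<dots> = y t0 * (\<Sum>t\<in>T. p t * c t)" by (simp add: sum_distrib_left mult.commute)
  finally have "y t0 = 0"
    using sum_pos[of T "\<lambda>t. p t * c t"] \<open>finite T\<close> t0 p(2) c by fastforce
  then have "x t = 0" if "t \<in> T" for t using const[OF that t0] xy that by simp
  then show False using xN by simp
qed

section \<open>Functionals on multisets\<close>

text \<open>The derivative in direction \<open>x\<close> of the polynomial with exponential coefficients \<open>G\<close> in the
variables \<open>A\<close>.\<close>

definition ddir :: "'i set \<Rightarrow> ('i \<Rightarrow> real) \<Rightarrow> ('i multiset \<Rightarrow> real) \<Rightarrow> 'i multiset \<Rightarrow> real" where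
  "ddir A x G M = (\<Sum>i\<in>A. x i * G (add_mset i M))"

lemma ddir_commute: "ddir A x (ddir A y G) = ddir A y (ddir A x G)"
proof
  fix M
  have "ddir A x (ddir A y G) M = (\<Sum>i\<in>A. \<Sum>j\<in>A. x i * (y j * G (add_mset j (add_mset i M))))"
    by (simp add: ddir_def sum_distrib_left)
  also have "\<dots> = (\<Sum>j\<in>A. \<Sum>i\<in>A. x i * (y j * G (add_mset j (add_mset i M))))"
    by (rule sum.swap)
  also have "\<dots> = (\<Sum>j\<in>A. \<Sum>i\<in>A. y j * (x i * G (add_mset i (add_mset j M))))"
    by (intro sum.cong refl) (metis add_mset_commute mult.left_commute)
  also have "\<dots> = ddir A y (ddir A x G) M"
    by (simp add: ddir_def sum_distrib_left)
  finally show "ddir A x (ddir A y G) M = ddir A y (ddir A x G) M" .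
qed

lemma ddir_sum: "ddir A x (\<lambda>M. \<Sum>t\<in>T. a t * F t M) = (\<lambda>M. \<Sum>t\<in>T. a t * ddir A x (F t) M)"
proof
  fix M
  have "ddir A x (\<lambda>M. \<Sum>t\<in>T. a t * F t M) M = (\<Sum>i\<in>A. \<Sum>t\<in>T. x i * (a t * F t (add_mset i M)))"
    by (simp add: ddir_def sum_distrib_left)
  also have "\<dots> = (\<Sum>t\<in>T. \<Sum>i\<in>A. x i * (a t * F t (add_mset i M)))"
    by (rule sum.swap)
  also have "\<dots> = (\<Sum>t\<in>T. a t * ddir A x (F t) M)"
    unfolding ddir_def sum_distrib_left by (intro sum.cong refl) (rule mult.left_commute)
  finally show "ddir A x (\<lambda>M. \<Sum>t\<in>T. a t * F t M) M = (\<Sum>t\<in>T. a t * ddir A x (F t) M)" .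
qed

text \<open>At \<open>M = {#}\<close> this is the value at \<open>x\<close> of the homogeneous polynomial of degree \<open>n\<close> with
exponential coefficients \<open>F\<close>, by Taylor's formula.\<close>

definition divided_power :: "'i set \<Rightarrow> nat \<Rightarrow> ('i \<Rightarrow> real) \<Rightarrow> ('i multiset \<Rightarrow> real) \<Rightarrow> 'i multiset \<Rightarrow> real" where
  "divided_power A n x F M = (ddir A x ^^ n) F M / fact n"

lemma divided_power_0 [simp]: "divided_power A 0 x F M = F M"
  by (simp add: divided_power_def)

lemma divided_power_Suc:
  "divided_power A n x (ddir A x F) M = real (Suc n) * divided_power A (Suc n) x F M"
  unfolding divided_power_def funpow_Suc_right by (simp del: of_nat_Suc)

lemma ddir_power_linear:
  "(ddir A x ^^ n) (\<lambda>M. a * F M + b * G M) M = a * (ddir A x ^^ n) F M + b * (ddir A x ^^ n) G M"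
  by (induction n arbitrary: M) (simp_all add: ddir_def algebra_simps sum.distrib sum_distrib_left)

lemma divided_power_linear:
  "divided_power A n x (\<lambda>M. a * F M + b * G M) M = a * divided_power A n x F M + b * divided_power A n x G M"
  by (simp add: divided_power_def ddir_power_linear add_divide_distrib)

lemma divided_power_shift:
  "divided_power A n x (\<lambda>N. F (add_mset j N)) M = divided_power A n x F (add_mset j M)"
proof -
  have "(ddir A x ^^ n) (\<lambda>N. F (add_mset j N)) M = (ddir A x ^^ n) F (add_mset j M)"
    by (induction n arbitrary: M) (simp_all add: ddir_def add_mset_commute)
  then show ?thesis by (simp add: divided_power_def)
qed

lemma divided_power_cong:
  assumes "\<And>M. set_mset M \<subseteq> A \<Longrightarrow> F M = G M" "set_mset M \<subseteq> A"
  shows "divided_power A n x F M = divided_power A n x G M"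
proof -
  have "(ddir A x ^^ n) F M = (ddir A x ^^ n) G M"
    using assms(2) by (induction n arbitrary: M) (auto simp: ddir_def assms(1))
  then show ?thesis by (simp add: divided_power_def)
qed

lemma divided_power_sum:
  "divided_power A n x (\<lambda>N. \<Sum>i\<in>I. F i N) M = (\<Sum>i\<in>I. divided_power A n x (F i) M)"
proof -
  have "(ddir A x ^^ n) (\<lambda>N. \<Sum>i\<in>I. F i N) M = (\<Sum>i\<in>I. (ddir A x ^^ n) (F i) M)" for M
  proof (induction n arbitrary: M)
    case (Suc n)
    have step: "(ddir A x ^^ Suc n) G M = (\<Sum>k\<in>A. x k * (ddir A x ^^ n) G (add_mset k M))" for G
      by (simp add: ddir_def[of A x "(ddir A x ^^ n) G" M])
    have "(ddir A x ^^ Suc n) (\<lambda>N. \<Sum>i\<in>I. F i N) M = (\<Sum>k\<in>A. \<Sum>i\<in>I. x k * (ddir A x ^^ n) (F i) (add_mset k M))"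
      unfolding step Suc sum_distrib_left ..
    also have "\<dots> = (\<Sum>i\<in>I. \<Sum>k\<in>A. x k * (ddir A x ^^ n) (F i) (add_mset k M))" by (rule sum.swap)
    finally show ?case unfolding step .
  qed simp
  then show ?thesis by (simp add: divided_power_def sum_divide_distrib)
qed

lemma divided_power_nonneg:
  assumes "\<And>i. i \<in> A \<Longrightarrow> x i \<ge> 0" "\<And>M. F M \<ge> 0"
  shows "divided_power A n x F M \<ge> 0"
proof -
  have "(ddir A x ^^ n) F M \<ge> 0"
    using assms by (induction n arbitrary: M) (auto simp: ddir_def intro!: sum_nonneg)
  then show ?thesis by (simp add: divided_power_def)
qed

text \<open>The binomial theorem for the commuting operators \<open>ddir A x\<close> and \<open>z \<partial>\<^sub>j\<close>. It splits off one
variable of a polynomial.\<close>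

theorem divided_power_binomial:
  assumes A: "finite A" "j \<in> A"
  shows "divided_power A n (\<lambda>i. x i + (if i = j then z else 0)) F M =
    (\<Sum>q\<le>n. z ^ q / fact q * divided_power A (n - q) x F (M + replicate_mset q j))"
proof (induction n arbitrary: F M)
  case (Suc n)
  let ?x = "\<lambda>i. x i + (if i = j then z else 0)"
  define D where "D q = divided_power A (Suc n - q) x F (M + replicate_mset q j)" for q
  have dd: "ddir A ?x F = (\<lambda>N. 1 * ddir A x F N + z * F (add_mset j N))"
  proof
    fix N
    have "ddir A ?x F N = (\<Sum>i\<in>A. x i * F (add_mset i N)) + (\<Sum>i\<in>A. if i = j then z * F (add_mset j N) else 0)"
      unfolding ddir_def sum.distrib[symmetric] by (intro sum.cong) (auto simp: algebra_simps)
    then show "ddir A ?x F N = 1 * ddir A x F N + z * F (add_mset j N)"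
      using A by (simp add: ddir_def)
  qed
  have "real (Suc n) * divided_power A (Suc n) ?x F M =
      divided_power A n ?x (ddir A x F) M + z * divided_power A n ?x F (add_mset j M)"
    unfolding divided_power_Suc[symmetric] dd divided_power_linear divided_power_shift by simp
  also have "divided_power A n ?x (ddir A x F) M = (\<Sum>q\<le>n. z ^ q / fact q * (real (Suc n - q) * D q))"
    unfolding Suc.IH
  proof (intro sum.cong refl)
    fix q assume "q \<in> {..n}"
    then have "Suc (n - q) = Suc n - q" by auto
    then show "z ^ q / fact q * divided_power A (n - q) x (ddir A x F) (M + replicate_mset q j) =
        z ^ q / fact q * (real (Suc n - q) * D q)"
      by (simp only: divided_power_Suc D_def)
  qed
  also have "\<dots> = (\<Sum>q\<le>Suc n. z ^ q / fact q * (real (Suc n - q) * D q))" by simp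
  also have "z * divided_power A n ?x F (add_mset j M) =
      (\<Sum>q\<le>n. real (Suc q) * (z ^ Suc q / fact (Suc q)) * D (Suc q))"
    unfolding Suc.IH sum_distrib_left D_def
  proof (intro sum.cong refl)
    fix q
    have e: "z * (z ^ q / fact q) = real (Suc q) * (z ^ Suc q / fact (Suc q))"
      by (simp add: field_simps del: of_nat_Suc)
    show "z * (z ^ q / fact q * divided_power A (n - q) x F (add_mset j M + replicate_mset q j)) =
      real (Suc q) * (z ^ Suc q / fact (Suc q)) * divided_power A (Suc n - Suc q) x F (M + replicate_mset (Suc q) j)"
      unfolding mult.assoc[symmetric] e by simp
  qed
  also have "\<dots> = (\<Sum>q\<le>Suc n. real q * (z ^ q / fact q) * D q)"
    by (subst sum.atMost_Suc_shift) simp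
  also have "(\<Sum>q\<le>Suc n. z ^ q / fact q * (real (Suc n - q) * D q)) + (\<Sum>q\<le>Suc n. real q * (z ^ q / fact q) * D q) =
      (\<Sum>q\<le>Suc n. real (Suc n) * (z ^ q / fact q * D q))"
    unfolding sum.distrib[symmetric]
  proof (intro sum.cong refl)
    fix q assume "q \<in> {..Suc n}"
    then have "real (Suc n) = real (Suc n - q) + real q" by (simp flip: of_nat_add)
    then show "z ^ q / fact q * (real (Suc n - q) * D q) + real q * (z ^ q / fact q) * D q =
        real (Suc n) * (z ^ q / fact q * D q)"
      by (simp only: algebra_simps)
  qed
  finally show ?case
    unfolding sum_distrib_left[symmetric] mult_left_cancel[OF of_nat_neq_0] D_def .
qed simp

section \<open>Functionals annihilated by a Stieltjes matrix\<close>

text \<open>A positive definite matrix without positive entries off the diagonal. The same holds for each of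
its principal submatrices, and their inverses have no negative entries by \<open>solution_nonneg\<close>.\<close>

locale stieltjes_matrix =
  fixes A :: "'i set" and C :: "'i \<Rightarrow> 'i \<Rightarrow> real"
  assumes finite_A: "finite A"
    and symm: "i \<in> A \<Longrightarrow> j \<in> A \<Longrightarrow> C i j = C j i"
    and off_diag: "i \<in> A \<Longrightarrow> j \<in> A \<Longrightarrow> i \<noteq> j \<Longrightarrow> C i j \<le> 0"
    and pos_def: "i \<in> A \<Longrightarrow> x i \<noteq> 0 \<Longrightarrow> 0 < (\<Sum>i\<in>A. \<Sum>j\<in>A. x i * C i j * x j)"
begin

lemma pos_def_subset:
  assumes "T \<subseteq> A" "i \<in> T" "x i \<noteq> 0"
  shows "0 < (\<Sum>i\<in>T. \<Sum>j\<in>T. x i * C i j * x j)"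
proof -
  define y where "y i = (if i \<in> T then x i else 0)" for i
  have "0 < (\<Sum>i\<in>A. \<Sum>j\<in>A. y i * C i j * y j)"
    using assms by (intro pos_def[of i]) (auto simp: y_def)
  also have "\<dots> = (\<Sum>i\<in>T. \<Sum>j\<in>A. y i * C i j * y j)"
    using assms finite_A by (intro sum.mono_neutral_right) (auto simp: y_def)
  also have "\<dots> = (\<Sum>i\<in>T. \<Sum>j\<in>T. x i * C i j * x j)"
    using assms finite_A by (intro sum.cong refl sum.mono_neutral_cong_right) (auto simp: y_def)
  finally show ?thesis .
qed

lemma diag_pos: "i \<in> A \<Longrightarrow> C i i > 0"
  using pos_def_subset[of "{i}" i "\<lambda>_. 1"] by simp

text \<open>If \<open>C x \<ge> 0\<close>, then testing with the negative part \<open>y\<close> of \<open>x\<close> gives \<open>y C y \<le> - y C x \<le> 0\<close>,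
because the positive part of \<open>x\<close> has disjoint support and meets only entries of \<open>C\<close> off the
diagonal.\<close>

lemma solution_nonneg:
  assumes "T \<subseteq> A" and x: "\<And>i. i \<in> T \<Longrightarrow> 0 \<le> (\<Sum>j\<in>T. C i j * x j)" and "i \<in> T"
  shows "0 \<le> x i"
proof (rule ccontr)
  assume neg: "\<not> 0 \<le> x i"
  define y where "y i = max 0 (- x i)" for i
  have "y i \<noteq> 0" using neg by (simp add: y_def)
  then have "0 < (\<Sum>i\<in>T. \<Sum>j\<in>T. y i * C i j * y j)"
    using assms by (intro pos_def_subset)
  also have "\<dots> \<le> (\<Sum>i\<in>T. \<Sum>j\<in>T. - (y i * (C i j * x j)))"
  proof (intro sum_mono)
    fix i j assume ij: "i \<in> T" "j \<in> T"
    have "y i * C i j * (y j + x j) \<le> 0"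
    proof (cases "i = j")
      case True
      then have "y i = 0 \<or> y j + x j = 0" by (auto simp: y_def max_def)
      then show ?thesis by auto
    next
      case False
      then have "y i * C i j \<le> 0"
        using off_diag[of i j] ij assms(1) by (intro mult_nonneg_nonpos) (auto simp: y_def)
      then show ?thesis by (rule mult_nonpos_nonneg) (simp add: y_def)
    qed
    then show "y i * C i j * y j \<le> - (y i * (C i j * x j))" by (simp add: algebra_simps)
  qed
  also have "\<dots> = - (\<Sum>i\<in>T. y i * (\<Sum>j\<in>T. C i j * x j))"
    by (simp add: sum_negf sum_distrib_left)
  also have "\<dots> \<le> 0"
  proof -
    have "0 \<le> y i * (\<Sum>j\<in>T. C i j * x j)" if "i \<in> T" for i
      using x[OF that] by (intro mult_nonneg_nonneg) (simp_all add: y_def)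
    then show ?thesis by (simp add: sum_nonneg)
  qed
  finally show False by simp
qed

lemma solution_pos:
  assumes "T \<subseteq> A" and x: "\<And>i. i \<in> T \<Longrightarrow> 0 < (\<Sum>j\<in>T. C i j * x j)" and "i \<in> T"
  shows "0 < x i"
proof (rule ccontr)
  have nonneg: "0 \<le> x j" if "j \<in> T" for j
    using solution_nonneg[OF assms(1) _ that, of x] x by (auto intro: less_imp_le)
  assume "\<not> 0 < x i"
  then have "x i = 0" using nonneg[OF \<open>i \<in> T\<close>] by simp
  have "(\<Sum>j\<in>T. C i j * x j) \<le> 0"
  proof (intro sum_nonpos)
    fix j assume "j \<in> T"
    then show "C i j * x j \<le> 0"
    proof (cases "i = j")
      case False
      then have "C i j \<le> 0" using off_diag[of i j] assms(1) \<open>i \<in> T\<close> \<open>j \<in> T\<close> by blast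
      then show ?thesis using nonneg[OF \<open>j \<in> T\<close>] by (rule mult_nonpos_nonneg)
    qed (use \<open>x i = 0\<close> in auto)
  qed
  then show False using x[OF \<open>i \<in> T\<close>] by simp
qed

text \<open>Elimination, one index at a time. The pivot \<open>g\<close> of the new index cannot vanish, since the vector
\<open>u\<close> would then be a non-trivial solution of the homogeneous system, against \<open>solution_nonneg\<close>
for \<open>- u\<close>.\<close>

lemma solution_exists:
  assumes "T \<subseteq> A"
  shows "\<exists>x. \<forall>i\<in>T. (\<Sum>j\<in>T. C i j * x j) = v i"
proof -
  have "finite T" using assms finite_A by (rule finite_subset)
  then show ?thesis using assms
  proof (induction T arbitrary: v)
    case (insert t T)
    have TA: "T \<subseteq> A" using insert.prems by simp
    obtain x where x: "\<And>i. i \<in> T \<Longrightarrow> (\<Sum>j\<in>T. C i j * x j) = v i"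
      using insert.IH[OF TA, of v] by blast
    obtain u0 where u0: "\<And>i. i \<in> T \<Longrightarrow> (\<Sum>j\<in>T. C i j * u0 j) = - C i t"
      using insert.IH[OF TA, of "\<lambda>i. - C i t"] by blast
    define u where "u j = (if j = t then 1 else u0 j)" for j
    have split: "(\<Sum>j\<in>insert t T. C i j * z j) = C i t * z t + (\<Sum>j\<in>T. C i j * z j)" for i z
      using insert.hyps by simp
    have T_u: "(\<Sum>j\<in>T. C i j * u j) = (\<Sum>j\<in>T. C i j * u0 j)" for i
      using insert.hyps by (intro sum.cong) (auto simp: u_def)
    have u: "(\<Sum>j\<in>insert t T. C i j * u j) = 0" if "i \<in> T" for i
      unfolding split T_u using u0[OF that] by (simp add: u_def)
    define g where "g = (\<Sum>j\<in>insert t T. C t j * u j)"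
    have "g \<noteq> 0"
    proof
      assume "g = 0"
      have neg: "0 \<le> (\<Sum>j\<in>insert t T. C i j * - u j)" if "i \<in> insert t T" for i
      proof -
        have "(\<Sum>j\<in>insert t T. C i j * u j) = 0"
          using u[of i] \<open>g = 0\<close> that unfolding g_def by (cases "i = t") simp_all
        then show ?thesis by (simp only: mult_minus_right sum_negf)
      qed
      have "0 \<le> - u t"
        by (rule solution_nonneg[of "insert t T" "\<lambda>j. - u j", OF insert.prems neg]) simp_all
      then show False by (simp add: u_def)
    qed
    define a where "a = (v t - (\<Sum>j\<in>T. C t j * x j)) / g"
    define y where "y j = (if j = t then 0 else x j) + a * u j" for j
    have T_x: "(\<Sum>j\<in>T. C i j * (if j = t then 0 else x j)) = (\<Sum>j\<in>T. C i j * x j)" for i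
      using insert.hyps by (intro sum.cong) auto
    have y: "(\<Sum>j\<in>insert t T. C i j * y j) =
        (\<Sum>j\<in>T. C i j * x j) + a * (\<Sum>j\<in>insert t T. C i j * u j)" for i
    proof -
      have "(\<Sum>j\<in>insert t T. C i j * y j) =
        (\<Sum>j\<in>insert t T. C i j * (if j = t then 0 else x j)) + a * (\<Sum>j\<in>insert t T. C i j * u j)"
        unfolding sum_distrib_left sum.distrib[symmetric] by (intro sum.cong refl) (simp add: y_def algebra_simps)
      then show ?thesis unfolding split[of i "\<lambda>j. if j = t then 0 else x j"] T_x by simp
    qed
    have "(\<Sum>j\<in>insert t T. C i j * y j) = v i" if "i \<in> insert t T" for i
    proof (cases "i = t")
      case True
      then show ?thesis unfolding y True g_def[symmetric] using \<open>g \<noteq> 0\<close> by (simp add: a_def)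
    next
      case False
      then have "i \<in> T" using that by simp
      then show ?thesis unfolding y u[OF \<open>i \<in> T\<close>] by (simp add: x)
    qed
    then show ?case by blast
  qed simp
qed

text \<open>The mixed derivative along all vectors of the list: the polarisation of the polynomial.\<close>

primrec polar :: "('i \<Rightarrow> real) list \<Rightarrow> ('i multiset \<Rightarrow> real) \<Rightarrow> real" where
  "polar [] G = G {#}"
| "polar (v # vs) G = polar vs (ddir A v G)"

lemma polar_sum: "polar vs (\<lambda>M. \<Sum>t\<in>T. a t * F t M) = (\<Sum>t\<in>T. a t * polar vs (F t))"
  by (induction vs arbitrary: F) (simp_all add: ddir_sum)

lemma polar_swap: "polar (x # y # vs) G = polar (y # x # vs) G"
  by (simp add: ddir_commute)

text \<open>What remains of the volume polynomial of a face: the polynomial involves the variables in \<open>T\<close>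
only, it satisfies the relations \<open>\<partial>\<^sub>t D\<^sub>t G = 0\<close>, where \<open>D\<^sub>t\<close> is the derivative along the row \<open>C
t\<close>, and it is normalised by one positive coefficient.\<close>

definition face_functional :: "'i set \<Rightarrow> ('i multiset \<Rightarrow> real) \<Rightarrow> bool" where
  "face_functional T G \<longleftrightarrow> T \<subseteq> A \<and> (\<forall>s\<in>A - T. \<forall>M. G (add_mset s M) = 0) \<and>
     (\<forall>t\<in>T. \<forall>M. ddir A (C t) G (add_mset t M) = 0) \<and> G (mset_set T) > 0"

lemma face_functional_finite: "face_functional T G \<Longrightarrow> finite T"
  using finite_A by (auto simp: face_functional_def intro: finite_subset)

lemma ddir_restrict:
  assumes "face_functional T G"
  shows "ddir A x G M = (\<Sum>i\<in>T. x i * G (add_mset i M))"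
  unfolding ddir_def using assms finite_A
  by (intro sum.mono_neutral_right) (auto simp: face_functional_def)

text \<open>On a face the derivative along \<open>v\<close> is a combination of facet derivatives, whose coefficients
solve a linear system with the principal submatrix of \<open>C\<close> on \<open>T\<close>.\<close>

lemma ddir_expand:
  assumes "face_functional T G" "\<forall>i\<in>T. (\<Sum>t\<in>T. C i t * c t) = v i"
  shows "ddir A v G = (\<lambda>M. \<Sum>t\<in>T. c t * ddir A (C t) G M)"
proof
  fix M
  have TA: "T \<subseteq> A" using assms(1) by (simp add: face_functional_def)
  have "ddir A v G M = (\<Sum>i\<in>T. \<Sum>t\<in>T. C i t * c t * G (add_mset i M))"
    unfolding ddir_restrict[OF assms(1)] sum_distrib_right[symmetric] by (simp add: assms(2))
  also have "\<dots> = (\<Sum>t\<in>T. \<Sum>i\<in>T. C i t * c t * G (add_mset i M))" by (rule sum.swap)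
  also have "\<dots> = (\<Sum>t\<in>T. c t * ddir A (C t) G M)"
    unfolding ddir_restrict[OF assms(1)] sum_distrib_left
    using TA symm by (intro sum.cong refl) (simp add: subset_iff)
  finally show "ddir A v G M = (\<Sum>t\<in>T. c t * ddir A (C t) G M)" .
qed

text \<open>The relations pass to a facet as all derivatives commute. For the normalisation, expand \<open>\<partial>\<^sub>t\<close> in
the squarefree coefficient of \<open>G\<close> as \<open>\<Sum> c\<^sub>s D\<^sub>s\<close>: every term with \<open>s \<noteq> t\<close> is killed by \<open>\<partial>\<^sub>s\<close>, and
\<open>c\<^sub>t \<ge> 0\<close>.\<close>

lemma face_functional_facet:
  assumes G: "face_functional T G" and t: "t \<in> T"
  shows "face_functional (T - {t}) (ddir A (C t) G)"
proof -
  have TA: "T \<subseteq> A" using G by (simp add: face_functional_def)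
  have fin: "finite T" using G by (rule face_functional_finite)
  have D: "ddir A (C s) G (add_mset s M) = 0" if "s \<in> T" for s M
    using G that by (auto simp: face_functional_def)
  have add: "ddir A x G (add_mset s M) = ddir A x (\<lambda>N. G (add_mset s N)) M" for x s M
    by (simp add: ddir_def add_mset_commute)
  have 1: "ddir A (C t) G (add_mset s M) = 0" if "s \<in> A - (T - {t})" for s M
  proof (cases "s = t")
    case False
    then have "\<And>N. G (add_mset s N) = 0" using that G by (auto simp: face_functional_def)
    then show ?thesis unfolding add by (simp add: ddir_def)
  qed (simp add: D t)
  have 2: "ddir A (C s) (ddir A (C t) G) (add_mset s M) = 0" if "s \<in> T" for s M
  proof -
    have "ddir A (C s) (ddir A (C t) G) (add_mset s M) = ddir A (C t) (ddir A (C s) G) (add_mset s M)"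
      by (simp add: ddir_commute)
    also have "\<dots> = (\<Sum>i\<in>A. C t i * ddir A (C s) G (add_mset s (add_mset i M)))"
      by (simp add: ddir_def[of A "C t"] add_mset_commute)
    finally show ?thesis using D[OF that] by simp
  qed
  have 3: "ddir A (C t) G (mset_set (T - {t})) > 0"
  proof -
    obtain c where c: "\<forall>i\<in>T. (\<Sum>j\<in>T. C i j * c j) = (if i = t then 1 else 0)"
      using solution_exists[OF TA, of "\<lambda>i. if i = t then 1 else 0"] by blast
    have "c t \<ge> 0" by (rule solution_nonneg[OF TA _ t]) (simp add: c)
    have "0 < G (mset_set T)" using G by (simp add: face_functional_def)
    also have "\<dots> = ddir A (\<lambda>i. if i = t then 1 else 0) G (mset_set (T - {t}))"
    proof -
      have "(\<Sum>i\<in>T. (if i = t then 1 else 0) * G (add_mset i (mset_set (T - {t})))) =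
          (\<Sum>i\<in>T. if i = t then G (add_mset i (mset_set (T - {t}))) else 0)"
        by (intro sum.cong) auto
      then show ?thesis
        unfolding ddir_restrict[OF G] using t fin mset_set.remove[OF fin t] by simp
    qed
    also have "\<dots> = (\<Sum>s\<in>T. c s * ddir A (C s) G (mset_set (T - {t})))"
      unfolding ddir_expand[OF G c] ..
    also have "\<dots> = (\<Sum>s\<in>{t}. c s * ddir A (C s) G (mset_set (T - {t})))"
    proof (intro sum.mono_neutral_right ballI)
      fix s assume s: "s \<in> T - {t}"
      then have "mset_set (T - {t}) = add_mset s (mset_set (T - {t} - {s}))"
        using fin mset_set.remove[of "T - {t}" s] by simp
      then show "c s * ddir A (C s) G (mset_set (T - {t})) = 0" using D s by simp
    qed (use fin t in auto)
    finally show ?thesis using \<open>c t \<ge> 0\<close> by (simp add: zero_less_mult_iff)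
  qed
  show ?thesis using TA 1 2 3 by (auto simp: face_functional_def)
qed

text \<open>Expanding a positive direction in facet derivatives has positive coefficients, so positivity is
inherited from the facets.\<close>

theorem polar_pos:
  assumes "face_functional T G" "length vs = card T" "\<And>v i. v \<in> set vs \<Longrightarrow> i \<in> T \<Longrightarrow> v i > 0"
  shows "polar vs G > 0"
  using assms
proof (induction vs arbitrary: T G)
  case Nil
  then have "T = {}" using face_functional_finite[OF Nil(1)] by simp
  then show ?case using Nil by (simp add: face_functional_def)
next
  case (Cons v vs)
  have TA: "T \<subseteq> A" and fin: "finite T"
    using Cons.prems(1) face_functional_finite by (auto simp: face_functional_def)
  obtain c where c: "\<forall>i\<in>T. (\<Sum>j\<in>T. C i j * c j) = v i"
    using solution_exists[OF TA] by blast
  have c_pos: "c t > 0" if "t \<in> T" for t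
    by (rule solution_pos[OF TA _ that]) (simp add: c Cons.prems(3))
  have "polar (v # vs) G = (\<Sum>t\<in>T. c t * polar vs (ddir A (C t) G))"
    unfolding polar.simps(2) ddir_expand[OF Cons.prems(1) c] by (rule polar_sum)
  also have "\<dots> > 0"
  proof (rule sum_pos)
    show "T \<noteq> {}" using Cons.prems(2) by auto
    fix t assume t: "t \<in> T"
    have "polar vs (ddir A (C t) G) > 0"
      using Cons.prems(2,3) t fin
      by (intro Cons.IH[OF face_functional_facet[OF Cons.prems(1) t]]) auto
    then show "0 < c t * polar vs (ddir A (C t) G)" using c_pos[OF t] by simp
  qed (rule fin)
  finally show ?case .
qed

text \<open>With two variables the relations determine the form up to a factor: \<open>q\<^sub>a\<^sub>a = - (C\<^sub>a\<^sub>b / C\<^sub>a\<^sub>a) q\<^sub>a\<^sub>b\<close>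
and likewise for \<open>b\<close>. Its determinant is non-positive because \<open>C\<^sub>a\<^sub>b\<^sup>2 < C\<^sub>a\<^sub>a C\<^sub>b\<^sub>b\<close>.\<close>

lemma hyperbolic_base:
  assumes G: "face_functional T G" and T: "card T = 2"
  shows "polar [x, x] G * polar [y, y] G \<le> (polar [x, y] G)\<^sup>2"
proof -
  obtain a b where ab: "T = {a, b}" "a \<noteq> b" using T by (auto simp: card_2_iff)
  define q where "q i j = G {#i, j#}" for i j
  have "a \<in> A" "b \<in> A" using G ab by (auto simp: face_functional_def)
  have qc: "q b a = q a b" by (simp add: q_def add_mset_commute)
  have "q a b > 0" using G ab by (simp add: face_functional_def q_def)
  have "C a a * q a a + C a b * q a b = 0"
    using G ab by (auto simp: face_functional_def q_def ddir_restrict[OF G] add_mset_commute)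
  then have qa: "q a a = - C a b / C a a * q a b" using diag_pos[OF \<open>a \<in> A\<close>] by (simp add: field_simps)
  have "C b b * q b b + C a b * q a b = 0"
  proof -
    have "ddir A (C b) G {#b#} = 0" using G ab by (simp add: face_functional_def)
    then show ?thesis
      using ab symm[OF \<open>a \<in> A\<close> \<open>b \<in> A\<close>] by (simp add: ddir_restrict[OF G] q_def)
  qed
  then have qb: "q b b = - C a b / C b b * q a b" using diag_pos[OF \<open>b \<in> A\<close>] by (simp add: field_simps)
  have "(C a b)\<^sup>2 < C a a * C b b"
  proof -
    \<comment> \<open>On this vector the form is \<open>C a a\<close> times the determinant.\<close>
    let ?x = "\<lambda>i. if i = a then C a b else - C a a"
    have "0 < (\<Sum>i\<in>T. \<Sum>j\<in>T. ?x i * C i j * ?x j)"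
      using G ab diag_pos[OF \<open>a \<in> A\<close>] by (intro pos_def_subset[of _ b]) (auto simp: face_functional_def)
    also have "\<dots> = C a a * (C a a * C b b - (C a b)\<^sup>2)"
      using ab symm[OF \<open>a \<in> A\<close> \<open>b \<in> A\<close>] by (simp add: algebra_simps power2_eq_square)
    finally show ?thesis using diag_pos[OF \<open>a \<in> A\<close>] by (simp add: zero_less_mult_iff)
  qed
  then have "(C a b)\<^sup>2 / (C a a * C b b) \<le> 1"
    using diag_pos \<open>a \<in> A\<close> \<open>b \<in> A\<close> by (simp add: divide_le_eq_1)
  then have "(C a b)\<^sup>2 / (C a a * C b b) * (q a b)\<^sup>2 \<le> 1 * (q a b)\<^sup>2"
    by (intro mult_right_mono) auto
  moreover have "q a a * q b b = (C a b)\<^sup>2 / (C a a * C b b) * (q a b)\<^sup>2"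
    unfolding qa qb by (simp add: power2_eq_square)
  ultimately have det: "q a a * q b b \<le> (q a b)\<^sup>2" by simp
  have polar: "polar [u, v] G = u a * v a * q a a + (u a * v b + u b * v a) * q a b + u b * v b * q b b" for u v
  proof -
    have "polar [u, v] G = (\<Sum>i\<in>A. v i * (\<Sum>j\<in>T. u j * q j i))"
      by (simp add: ddir_def[of A v] ddir_restrict[OF G] q_def)
    also have "\<dots> = (\<Sum>j\<in>T. u j * (\<Sum>i\<in>A. v i * q i j))"
      unfolding sum_distrib_left by (subst sum.swap) (simp add: q_def add_mset_commute mult.left_commute)
    also have "\<dots> = (\<Sum>j\<in>T. u j * (\<Sum>i\<in>T. v i * q i j))"
      using ddir_restrict[OF G, of v] by (simp add: ddir_def q_def)
    finally show ?thesis using ab by (simp add: qc algebra_simps)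
  qed
  have "(polar [x, y] G)\<^sup>2 - polar [x, x] G * polar [y, y] G
      = ((q a b)\<^sup>2 - q a a * q b b) * (x a * y b - x b * y a)\<^sup>2"
    unfolding polar by (simp add: power2_eq_square algebra_simps)
  also have "\<dots> \<ge> 0" using det by simp
  finally show ?thesis by simp
qed

lemma polar_diff:
  "polar (u # (\<lambda>i. x i - r * y i) # vs) G = polar (u # x # vs) G - r * polar (u # y # vs) G"
proof -
  have "ddir A (\<lambda>i. x i - r * y i) H =
      (\<lambda>M. \<Sum>b\<in>UNIV. (if b then 1 else - r) * ddir A (if b then x else y) H M)" for H
    by (rule ext) (simp add: UNIV_bool ddir_def algebra_simps sum_subtractf sum_distrib_left sum_negf)
  then have "polar (u # (\<lambda>i. x i - r * y i) # vs) G =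
      polar vs (\<lambda>M. \<Sum>b\<in>UNIV. (if b then 1 else - r) * ddir A (if b then x else y) (ddir A u G) M)"
    by (simp only: polar.simps)
  also have "\<dots> = (\<Sum>b\<in>UNIV. (if b then 1 else - r) * polar vs (ddir A (if b then x else y) (ddir A u G)))"
    by (rule polar_sum)
  finally show ?thesis by (simp add: UNIV_bool)
qed

text \<open>The Alexandrov-Fenchel inequality for face functionals. In the induction step \<open>q s t\<close> is the
form in the coordinates \<open>\<xi>\<close> with \<open>x = \<Sum> \<xi>\<^sub>t C\<^sub>t\<close>, and \<open>v\<close>, the first of the fixed directions, has
the positive coordinates \<open>c\<close>. Contracting \<open>Q(x, x)\<close> with \<open>v = \<Sum> c\<^sub>t C\<^sub>t\<close> gives a sum over facets
(\<open>Q_self\<close>), to each term of which the induction hypothesis applies with \<open>y = v\<close>. That is the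
hypothesis of \<open>bochner_criterion\<close>.\<close>

theorem polar_hyperbolic:
  assumes "face_functional T G" "card T = length vs + 2"
    and "\<And>v i. v \<in> set vs \<Longrightarrow> i \<in> T \<Longrightarrow> v i > 0" and "\<And>i. i \<in> T \<Longrightarrow> y i > 0"
  shows "polar (x # x # vs) G * polar (y # y # vs) G \<le> (polar (x # y # vs) G)\<^sup>2"
  using assms
proof (induction vs arbitrary: T G x y)
  case Nil
  then show ?case using hyperbolic_base by simp
next
  case (Cons v vs)
  note G = Cons.prems(1)
  have TA: "T \<subseteq> A" and fin: "finite T"
    using G face_functional_finite by (auto simp: face_functional_def)
  define Q where "Q x y = polar (x # y # v # vs) G" for x y
  define F where "F t = ddir A (C t) G" for t
  have F: "face_functional (T - {t}) (F t)" if "t \<in> T" for t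
    unfolding F_def using G that by (rule face_functional_facet)
  have v: "v i > 0" if "i \<in> T" for i using Cons.prems(3) that by simp
  obtain c where c: "\<forall>i\<in>T. (\<Sum>j\<in>T. C i j * c j) = v i"
    using solution_exists[OF TA] by blast
  have c_pos: "c t > 0" if "t \<in> T" for t
    by (rule solution_pos[OF TA _ that]) (simp add: c v)
  have Qcomm: "Q x y = Q y x" for x y by (simp add: Q_def ddir_commute)
  have Q_facet: "Q (C t) x = polar (v # x # vs) (F t)" for t x
    by (simp add: Q_def F_def ddir_commute)
  have Q_expand: "Q x y = (\<Sum>t\<in>T. \<xi> t * Q (C t) y)"
    if "\<forall>i\<in>T. (\<Sum>t\<in>T. C i t * \<xi> t) = x i" for x y \<xi>
    unfolding Q_def polar.simps ddir_expand[OF G that] ddir_sum polar_sum ..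
  have Q_self: "Q x x = (\<Sum>t\<in>T. c t * polar (x # x # vs) (F t))" for x
  proof -
    have "Q x x = polar (x # x # vs) (ddir A v G)" by (simp add: Q_def ddir_commute)
    also have "\<dots> = (\<Sum>t\<in>T. c t * polar (x # x # vs) (F t))"
      unfolding ddir_expand[OF G c] F_def by (rule polar_sum)
    finally show ?thesis .
  qed
  define q where "q s t = Q (C s) (C t)" for s t
  define p where "p t = Q (C t) v" for t
  have p_pos: "p t > 0" if "t \<in> T" for t
    unfolding p_def Q_facet using that Cons.prems fin
    by (intro polar_pos[OF F[OF that]]) auto
  have q_sum: "(\<Sum>s\<in>T. q t s * \<xi> s) = Q (C t) x"
    if "\<forall>i\<in>T. (\<Sum>t\<in>T. C i t * \<xi> t) = x i" for t x \<xi>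
  proof -
    have "(\<Sum>s\<in>T. q t s * \<xi> s) = (\<Sum>s\<in>T. \<xi> s * Q (C s) (C t))"
      unfolding q_def by (intro sum.cong refl) (metis mult.commute Qcomm)
    also have "\<dots> = Q x (C t)" by (rule Q_expand[OF that, symmetric])
    finally show ?thesis by (simp only: Qcomm[of x])
  qed
  have qform: "(\<Sum>s\<in>T. \<Sum>t\<in>T. \<xi> s * q s t * \<xi> t) = Q x x"
    if "\<forall>i\<in>T. (\<Sum>t\<in>T. C i t * \<xi> t) = x i" for x \<xi>
  proof -
    have "(\<Sum>s\<in>T. \<Sum>t\<in>T. \<xi> s * q s t * \<xi> t) = (\<Sum>s\<in>T. \<xi> s * Q (C s) x)"
      by (simp add: q_sum[OF that, symmetric] sum_distrib_left mult.assoc)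
    then show ?thesis using Q_expand[OF that, where y = x] by simp
  qed
  have neg: "Q x x \<le> 0" if "Q v x = 0" for x
  proof -
    obtain \<xi> where \<xi>: "\<forall>i\<in>T. (\<Sum>t\<in>T. C i t * \<xi> t) = x i"
      using solution_exists[OF TA] by blast
    have "(\<Sum>s\<in>T. \<Sum>t\<in>T. \<xi> s * q s t * \<xi> t) \<le> 0"
    proof (rule bochner_criterion[where c = c and p = p])
      fix s t assume st: "s \<in> T" "t \<in> T" "s \<noteq> t"
      have "q s t = polar (v # vs) (ddir A (C t) (F s))"
        unfolding q_def Q_facet by (simp add: ddir_commute)
      also have "\<dots> > 0"
        using st fin Cons.prems
        by (intro polar_pos[OF face_functional_facet[OF F[OF st(1)], of t]]) auto
      finally show "q s t > 0" .
    next
      fix z :: "'i \<Rightarrow> real"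
      define x where "x i = (\<Sum>t\<in>T. C i t * z t)" for i
      have z: "\<forall>i\<in>T. (\<Sum>t\<in>T. C i t * z t) = x i" by (simp add: x_def)
      have "c t * polar (x # x # vs) (F t) \<le> c t / p t * (Q (C t) x)\<^sup>2" if t: "t \<in> T" for t
      proof -
        have "polar (x # x # vs) (F t) * polar (v # v # vs) (F t) \<le> (polar (x # v # vs) (F t))\<^sup>2"
          using t fin Cons.prems v by (intro Cons.IH[OF F[OF t]]) auto
        then have "polar (x # x # vs) (F t) * p t \<le> (Q (C t) x)\<^sup>2"
          unfolding p_def Q_facet by (simp add: ddir_commute)
        then have "polar (x # x # vs) (F t) \<le> (Q (C t) x)\<^sup>2 / p t"
          using p_pos[OF t] by (simp add: pos_le_divide_eq)
        then have "c t * polar (x # x # vs) (F t) \<le> c t * ((Q (C t) x)\<^sup>2 / p t)"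
          using c_pos[OF t] by (intro mult_left_mono) auto
        then show ?thesis by simp
      qed
      then show "(\<Sum>s\<in>T. \<Sum>t\<in>T. z s * q s t * z t) \<le> (\<Sum>t\<in>T. c t / p t * (\<Sum>s\<in>T. q t s * z s)\<^sup>2)"
        unfolding qform[OF z] q_sum[OF z] Q_self by (rule sum_mono)
    next
      show "(\<Sum>t\<in>T. p t * \<xi> t) = 0"
        using Q_expand[OF \<xi>, of v] that by (simp add: p_def mult.commute Qcomm)
    qed (use fin c_pos p_pos q_sum[OF c] in \<open>auto simp: q_def p_def Qcomm\<close>)
    then show ?thesis unfolding qform[OF \<xi>] .
  qed
  have Qyy: "Q y y > 0" and Qvy: "Q v y > 0"
    unfolding Q_def using Cons.prems by (auto intro!: polar_pos[OF G] simp del: polar.simps)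
  have "Q x x * Q y y \<le> (Q x y)\<^sup>2"
  proof (rule hyperbolic_transfer[of Q, OF Qcomm _ neg])
    show "Q u (\<lambda>i. x i - r * y i) = Q u x - r * Q u y" for u x y r
      unfolding Q_def by (rule polar_diff)
  qed (use Qyy Qvy in auto)
  then show ?case by (simp add: Q_def)
qed

lemma polar_tendsto:
  assumes "\<And>M. ((\<lambda>e. H e M) \<longlongrightarrow> G M) F" and "\<And>v i. v \<in> set vs \<Longrightarrow> ((\<lambda>e. f e v i) \<longlongrightarrow> v i) F"
  shows "((\<lambda>e. polar (map (f e) vs) (H e)) \<longlongrightarrow> polar vs G) F"
  using assms
proof (induction vs arbitrary: H G)
  case (Cons v vs)
  have "((\<lambda>e. ddir A (f e v) (H e) M) \<longlongrightarrow> ddir A v G M) F" for M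
    unfolding ddir_def using Cons.prems by (intro tendsto_sum tendsto_mult) auto
  then show ?case using Cons by simp
qed simp

text \<open>The limit \<open>e \<rightarrow> 0\<close> of the strictly positive case for the directions \<open>v + e\<close>.\<close>

theorem polar_hyperbolic_nonneg:
  assumes G: "face_functional T G" "card T = length vs + 2"
    and vs: "\<And>v i. v \<in> set vs \<Longrightarrow> i \<in> T \<Longrightarrow> v i \<ge> 0" and y: "\<And>i. i \<in> T \<Longrightarrow> y i \<ge> 0"
  shows "polar (x # x # vs) G * polar (y # y # vs) G \<le> (polar (x # y # vs) G)\<^sup>2"
proof -
  define f where "f e v i = v i + e" for e :: real and v :: "'i \<Rightarrow> real" and i
  let ?F = "at_right (0 :: real)"
  have f: "((\<lambda>e. f e v i) \<longlongrightarrow> v i) ?F" for v i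
  proof -
    have "((\<lambda>e. v i + e) \<longlongrightarrow> v i + 0) ?F" by (intro tendsto_intros)
    then show ?thesis by (simp add: f_def)
  qed
  have lim: "((\<lambda>e. polar (map (f e) ws) (\<lambda>M. ddir A x (H e) M)) \<longlongrightarrow> polar ws (ddir A x H')) ?F"
    if "\<And>M. ((\<lambda>e. H e M) \<longlongrightarrow> H' M) ?F" for ws H H'
    unfolding ddir_def using that by (intro polar_tendsto f tendsto_intros)
  have lim_xx: "((\<lambda>e. polar (x # x # map (f e) vs) G) \<longlongrightarrow> polar (x # x # vs) G) ?F"
    using lim[of "\<lambda>e. ddir A x G" "ddir A x G" vs] by simp
  have lim_yy: "((\<lambda>e. polar (map (f e) (y # y # vs)) G) \<longlongrightarrow> polar (y # y # vs) G) ?F"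
    by (intro polar_tendsto f tendsto_const)
  have lim_xy: "((\<lambda>e. polar (x # map (f e) (y # vs)) G) \<longlongrightarrow> polar (x # y # vs) G) ?F"
    using lim[of "\<lambda>e. G" G "y # vs"] by simp
  have ineq: "polar (x # x # map (f e) vs) G * polar (map (f e) (y # y # vs)) G
      \<le> (polar (x # map (f e) (y # vs)) G)\<^sup>2" if "e > 0" for e
    unfolding list.map using that assms
    by (intro polar_hyperbolic[OF G(1)]) (auto simp: f_def add_nonneg_pos)
  show ?thesis
    by (rule tendsto_le[OF _ tendsto_power[OF lim_xy] tendsto_mult[OF lim_xx lim_yy]])
       (simp, rule eventually_mono[OF eventually_at_right_less[of 0]], rule ineq)
qed

lemma polar_pos_coeffs:
  assumes "\<And>M. size M = n \<Longrightarrow> set_mset M \<subseteq> A \<Longrightarrow> G M > 0" "A \<noteq> {}"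
    and "length vs = n" "\<And>v i. v \<in> set vs \<Longrightarrow> i \<in> A \<Longrightarrow> v i \<ge> 0"
    and "\<And>v. v \<in> set vs \<Longrightarrow> \<exists>i\<in>A. v i > 0"
  shows "polar vs G > 0"
  using assms
proof (induction vs arbitrary: n G)
  case (Cons v vs)
  obtain i where i: "i \<in> A" "v i > 0" using Cons.prems(5)[of v] by auto
  have "ddir A v G M > 0" if "size M = length vs" "set_mset M \<subseteq> A" for M
    unfolding ddir_def
  proof (rule sum_pos2[OF finite_A i(1)])
    show "0 < v i * G (add_mset i M)" using i that Cons.prems(1,3) by simp
    show "0 \<le> v k * G (add_mset k M)" if "k \<in> A" for k
      using that \<open>size M = length vs\<close> \<open>set_mset M \<subseteq> A\<close> Cons.prems(1)[of "add_mset k M"] Cons.prems(3,4)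
      by (auto intro!: mult_nonneg_nonneg less_imp_le)
  qed
  then show ?case using Cons.prems(2,4,5) by (auto intro!: Cons.IH)
qed auto

text \<open>One non-negative vector \<open>e\<close> of positive norm is enough to remove the sign condition on \<open>y\<close>.\<close>

corollary polar_hyperbolic_all:
  assumes G: "face_functional T G" "card T = length vs + 2"
    and vs: "\<And>v i. v \<in> set vs \<Longrightarrow> i \<in> T \<Longrightarrow> v i \<ge> 0"
    and e: "\<And>i. i \<in> T \<Longrightarrow> e i \<ge> 0" "polar (e # e # vs) G > 0"
    and y: "polar (y # y # vs) G > 0"
  shows "polar (x # x # vs) G * polar (y # y # vs) G \<le> (polar (x # y # vs) G)\<^sup>2"
proof -
  define Q where "Q x y = polar (x # y # vs) G" for x y
  have Qcomm: "Q x y = Q y x" for x y unfolding Q_def by (rule polar_swap)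
  have hyp: "Q x x * Q e e \<le> (Q x e)\<^sup>2" for x
    unfolding Q_def using G vs e(1) by (rule polar_hyperbolic_nonneg)
  have neg: "Q x x \<le> 0" if "Q e x = 0" for x
    using hyp[of x] e(2) that Qcomm[of x e] by (simp add: Q_def[symmetric] mult_le_0_iff del: polar.simps)
  have "Q e y \<noteq> 0"
    using hyp[of y] e(2) y Qcomm[of y e] by (auto simp: Q_def[symmetric] mult_le_0_iff simp del: polar.simps)
  moreover have "Q u (\<lambda>i. x i - r * y i) = Q u x - r * Q u y" for u x y r
    unfolding Q_def by (rule polar_diff)
  moreover have "Q y y \<ge> 0" using y by (simp only: Q_def less_imp_le)
  ultimately have "Q x x * Q y y \<le> (Q x y)\<^sup>2"
    using hyperbolic_transfer[of Q e, OF Qcomm _ neg] by blast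
  then show ?thesis by (simp only: Q_def)
qed

text \<open>Coordinate directions recover the exponential coefficients.\<close>

lemma polar_indicator:
  assumes "set is \<subseteq> A"
  shows "polar (map (\<lambda>i k. if k = i then 1 else 0) is) G = G (mset is)"
  using assms
proof (induction "is" arbitrary: G)
  case (Cons i "is")
  have "ddir A (\<lambda>k. if k = i then 1 else 0) G M = G (add_mset i M)" for M
  proof -
    have "ddir A (\<lambda>k. if k = i then 1 else 0) G M = (\<Sum>k\<in>A. if k = i then G (add_mset i M) else 0)"
      unfolding ddir_def by (intro sum.cong) auto
    then show ?thesis using Cons.prems finite_A by simp
  qed
  then show ?case using Cons by simp
qed simp

end

section \<open>The coefficients of the volume polynomial\<close>

text \<open>Renumbers the sites after site \<open>j\<close> has been removed; a particle at \<open>j\<close> itself goes to \<open>j - 1\<close>.\<close>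

definition close_gap :: "nat \<Rightarrow> nat \<Rightarrow> nat" where
  "close_gap j i = (if i < j then i else i - 1)"

text \<open>The sites other than \<open>j\<close> keep their particles, those to the right of \<open>j\<close> being renumbered. One
of the particles at \<open>j\<close> disappears; of the remaining ones \<open>s\<close> go to the left neighbour \<open>j - 1\<close>,
and the others to the right neighbour \<open>j + 1\<close>, whose new number is \<open>j\<close>. All \<open>s\<close> are summed over.
The value is \<open>0\<close> if \<open>j\<close> is empty.\<close>

definition split_site :: "nat \<Rightarrow> (nat multiset \<Rightarrow> real) \<Rightarrow> nat multiset \<Rightarrow> real" where
  "split_site j F M = (\<Sum>s<count M j. F (image_mset (close_gap j) (filter_mset (\<lambda>i. i \<noteq> j) M)
     + replicate_mset s (j - 1) + replicate_mset (count M j - 1 - s) j))"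

lemma split_site_add_less:
  assumes "i < j"
  shows "split_site j F (add_mset i M) = split_site j (\<lambda>N. F (add_mset i N)) M"
  using assms by (simp add: split_site_def close_gap_def)

lemma split_site_add_greater:
  assumes "j < i"
  shows "split_site j F (add_mset i M) = split_site j (\<lambda>N. F (add_mset (i - 1) N)) M"
  using assms by (simp add: split_site_def close_gap_def)

lemma close_gap_image:
  "image_mset (close_gap j) M =
    image_mset (close_gap j) (filter_mset (\<lambda>i. i \<noteq> j) M) + replicate_mset (count M j) (j - 1)"
  by (induction M) (auto simp: close_gap_def)

lemma close_gap_Suc_image:
  "image_mset (close_gap (Suc j)) M =
    image_mset (close_gap j) (filter_mset (\<lambda>i. i \<noteq> j) M) + replicate_mset (count M j) j"
  by (induction M) (auto simp: close_gap_def)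

text \<open>An additional particle at \<open>j\<close> creates one new summand, in which all the others go to the left.
In all other summands it can be regarded as one more particle that goes to the right.\<close>

lemma split_site_add_same:
  "split_site j F (add_mset j M) =
    F (image_mset (close_gap j) M) + split_site j (\<lambda>N. F (add_mset j N)) M"
proof -
  define B where "B = image_mset (close_gap j) (filter_mset (\<lambda>i. i \<noteq> j) M)"
  have "split_site j F (add_mset j M) =
      (\<Sum>s<Suc (count M j). F (B + replicate_mset s (j - 1) + replicate_mset (count M j - s) j))"
    by (simp add: split_site_def B_def)
  also have "\<dots> = F (B + replicate_mset (count M j) (j - 1)) +
      (\<Sum>s<count M j. F (B + replicate_mset s (j - 1) + replicate_mset (count M j - s) j))"
    by simp
  also have "(\<Sum>s<count M j. F (B + replicate_mset s (j - 1) + replicate_mset (count M j - s) j)) =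
      (\<Sum>s<count M j. F (add_mset j (B + replicate_mset s (j - 1) + replicate_mset (count M j - 1 - s) j)))"
  proof (intro sum.cong refl)
    fix s assume "s \<in> {..<count M j}"
    then have "count M j - s = Suc (count M j - 1 - s)" by auto
    then show "F (B + replicate_mset s (j - 1) + replicate_mset (count M j - s) j) =
      F (add_mset j (B + replicate_mset s (j - 1) + replicate_mset (count M j - 1 - s) j))"
      by simp
  qed
  finally show ?thesis
    unfolding close_gap_image[of j M] by (simp add: split_site_def B_def)
qed

text \<open>Moving one particle from the left to the right neighbour relates consecutive summands.\<close>

lemma split_site_telescope:
  "split_site j (\<lambda>N. F (add_mset j N) - F (add_mset (j - 1) N)) M =
    F (image_mset (close_gap (Suc j)) M) - F (image_mset (close_gap j) M)"
proof -
  define B where "B = image_mset (close_gap j) (filter_mset (\<lambda>i. i \<noteq> j) M)"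
  define f where "f s = F (B + replicate_mset s (j - 1) + replicate_mset (count M j - s) j)" for s
  have "split_site j (\<lambda>N. F (add_mset j N) - F (add_mset (j - 1) N)) M = (\<Sum>s<count M j. f s - f (Suc s))"
    unfolding split_site_def
  proof (intro sum.cong refl)
    fix s assume "s \<in> {..<count M j}"
    then have "count M j - s = Suc (count M j - 1 - s)" by auto
    then show "F (add_mset j (image_mset (close_gap j) (filter_mset (\<lambda>i. i \<noteq> j) M) +
         replicate_mset s (j - 1) + replicate_mset (count M j - 1 - s) j)) -
       F (add_mset (j - 1) (image_mset (close_gap j) (filter_mset (\<lambda>i. i \<noteq> j) M) +
         replicate_mset s (j - 1) + replicate_mset (count M j - 1 - s) j)) = f s - f (Suc s)"
      by (simp add: f_def B_def)
  qed
  also have "\<dots> = f 0 - f (count M j)" by (rule sum_lessThan_telescope')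
  also have "\<dots> = F (image_mset (close_gap (Suc j)) M) - F (image_mset (close_gap j) M)"
    unfolding close_gap_image[of j M] close_gap_Suc_image[of j M] by (simp add: f_def B_def)
  finally show ?thesis .
qed

lemma split_site_diff:
  "split_site j (\<lambda>N. F N - G N) M = split_site j F M - split_site j G M"
  by (simp add: split_site_def sum_subtractf)

lemma split_site_mult: "split_site j (\<lambda>N. a * F N) M = a * split_site j F M"
  by (simp add: split_site_def sum_distrib_left)

lemma split_site_sum:
  "split_site j (\<lambda>N. \<Sum>i\<in>I. F i N) M = (\<Sum>i\<in>I. split_site j (F i) M)"
  unfolding split_site_def by (rule sum.swap)

lemma split_site_zero [simp]: "split_site j (\<lambda>N. 0) M = 0"
  by (simp add: split_site_def)

lemma split_site_notin: "j \<notin># M \<Longrightarrow> split_site j F M = 0"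
  by (simp add: split_site_def not_in_iff)

text \<open>Site \<open>0\<close> is a cemetery: it is never split, a particle that arrives there stays, and \<open>sim_coeff
0\<close> then gives \<open>0\<close>. The sites are not bounded from above, but in dimension \<open>n\<close> all sites from \<open>n\<close>
on are equivalent, see \<open>sim_coeff_saturated\<close>.\<close>

fun sim_coeff :: "nat \<Rightarrow> nat multiset \<Rightarrow> real" where
  "sim_coeff 0 M = (if M = {#} then 1 else 0)"
| "sim_coeff (Suc n) M = (\<Sum>j\<in>set_mset M - {0}. split_site j (sim_coeff n) M)"

lemma sim_coeff_Suc_eq:
  assumes "set_mset M \<subseteq> {..K}"
  shows "sim_coeff (Suc n) M = (\<Sum>j=1..K. split_site j (sim_coeff n) M)"
  unfolding sim_coeff.simps
  by (intro sum.mono_neutral_left) (use assms in \<open>auto intro: split_site_notin\<close>)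

lemma sim_coeff_nonneg: "sim_coeff n M \<ge> 0"
  by (induction n arbitrary: M) (auto simp: split_site_def intro!: sum_nonneg)

text \<open>Sending all particles of a site to the right never hits the cemetery.\<close>

lemma sim_coeff_pos:
  assumes "size M = n" "0 \<notin># M"
  shows "sim_coeff n M > 0"
  using assms
proof (induction n arbitrary: M)
  case (Suc n)
  then obtain j where j: "j \<in># M"
    by (metis Suc_neq_Zero multiset_nonemptyE size_empty)
  with Suc.prems have "j \<noteq> 0" by metis
  define B where "B = image_mset (close_gap j) (filter_mset (\<lambda>i. i \<noteq> j) M)"
  have cnt: "count M j > 0" using j by simp
  have "size (filter_mset (\<lambda>i. i \<noteq> j) M) + count M j = Suc n"
  proof -
    have "size M = size (filter_mset (\<lambda>i. i \<noteq> j) M) + count M j"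
      by (induction M) auto
    then show ?thesis using Suc by simp
  qed
  then have "sim_coeff n (B + replicate_mset (count M j - 1) j) > 0"
    using Suc.prems \<open>j \<noteq> 0\<close> cnt
    by (intro Suc.IH) (auto simp: B_def close_gap_def split: if_splits)
  then have "0 < split_site j (sim_coeff n) M"
    unfolding split_site_def B_def[symmetric] using cnt
    by (intro sum_pos2[where i = 0]) (auto intro: sim_coeff_nonneg)
  then show ?case
    unfolding sim_coeff.simps using j \<open>j \<noteq> 0\<close>
    by (intro sum_pos2[where i = j])
       (auto simp: split_site_def intro!: sum_nonneg sim_coeff_nonneg)
qed simp

lemma sim_coeff_site_0: "sim_coeff n (add_mset 0 M) = 0"
proof (induction n arbitrary: M)
  case (Suc n)
  have "split_site j (sim_coeff n) (add_mset 0 M) = 0" if "j \<noteq> 0" for j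
    using that by (subst split_site_add_less) (auto simp: Suc.IH)
  then show ?case by (simp del: set_mset_add_mset_insert)
qed simp

text \<open>The facet derivative \<open>D\<^sub>k\<close>.\<close>

definition second_diff :: "nat \<Rightarrow> (nat multiset \<Rightarrow> real) \<Rightarrow> nat multiset \<Rightarrow> real" where
  "second_diff k F M = 2 * F (add_mset k M) - F (add_mset (k - 1) M) - F (add_mset (Suc k) M)"

text \<open>\<open>D\<^sub>k\<close> passes through the splitting of site \<open>j\<close>, being renumbered if \<open>j\<close> lies to its left, up to
terms in which \<open>k\<close> or \<open>k + 1\<close> is merged with its left neighbour. These occur only for \<open>j\<close> at
distance at most \<open>1\<close> from \<open>k\<close>, and for \<open>k \<ge> 2\<close> they cancel in the sum over \<open>j \<ge> 1\<close>.\<close>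

lemma second_diff_split_site:
  assumes "j \<ge> 1" "k \<ge> 1"
  shows "second_diff k (split_site j F) M =
    (if k < j then split_site j (second_diff k F) M
     else if j < k then split_site j (second_diff (k - 1) F) M else 0)
    + (if j = k then F (image_mset (close_gap k) M) + F (image_mset (close_gap (Suc k)) M) else 0)
    - (if j = Suc k then F (image_mset (close_gap (Suc k)) M) else 0)
    - (if Suc j = k then F (image_mset (close_gap k) M) else 0)"
proof -
  let ?\<Phi> = "\<lambda>i. split_site j (\<lambda>N. F (add_mset i N)) M"
  let ?m = "\<lambda>i. F (image_mset (close_gap i) M)"
  have lin: "split_site j (second_diff i F) M = 2 * ?\<Phi> i - ?\<Phi> (i - 1) - ?\<Phi> (Suc i)" for i
    unfolding second_diff_def[abs_def] split_site_diff split_site_mult ..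
  have tele: "?\<Phi> j - ?\<Phi> (j - 1) = ?m (Suc j) - ?m j"
    using split_site_telescope[of j F M] by (simp add: split_site_diff)
  consider "j > Suc k" | "j = Suc k" | "j = k" | "Suc j = k" | "Suc j < k" by linarith
  then show ?thesis
  proof cases
    case 1
    then show ?thesis unfolding lin
      by (simp add: second_diff_def split_site_add_less)
  next
    case 2
    then show ?thesis unfolding lin
      by (simp add: second_diff_def split_site_add_less split_site_add_same)
  next
    case 3
    then show ?thesis using tele assms
      by (simp add: second_diff_def split_site_add_less split_site_add_same split_site_add_greater)
  next
    case 4
    then have "k - 1 = j" by simp
    then show ?thesis using tele assms 4 unfolding lin
      by (auto simp: second_diff_def split_site_add_same split_site_add_greater)
  next
    case 5
    then show ?thesis using assms unfolding lin
      by (auto simp: second_diff_def split_site_add_greater)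
  qed
qed

text \<open>The relation \<open>\<partial>\<^sub>k D\<^sub>k = 0\<close>. On a multiset that contains \<open>k\<close>, all summands with a splitting of \<open>D\<^sub>k\<close>
or \<open>D\<^sub>k\<^sub>-\<^sub>1\<close> vanish by induction, and the merging terms cancel if \<open>k \<ge> 2\<close>. For \<open>k = 1\<close> the site \<open>j
= k - 1 = 0\<close> is not split; the one term left over moves the particle at \<open>1\<close> to the cemetery.\<close>

theorem second_diff_sim_coeff:
  assumes "k \<ge> 1"
  shows "second_diff k (sim_coeff n) (add_mset k M) = 0"
  using assms
proof (induction n arbitrary: k M)
  case 0
  then show ?case by (simp add: second_diff_def)
next
  case (Suc n)
  let ?c = "sim_coeff n"
  let ?M = "add_mset k M"
  let ?m = "\<lambda>i. ?c (image_mset (close_gap i) ?M)"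
  obtain K where K: "Suc k \<le> K" "set_mset ?M \<subseteq> {..K}"
  proof -
    have "set_mset ?M \<subseteq> {..max (Suc k) (Max (set_mset M))}" by (auto simp: le_max_iff_disj)
    then show ?thesis using that by (metis max.cobounded1)
  qed
  have "second_diff k (sim_coeff (Suc n)) ?M = (\<Sum>j=1..K. second_diff k (split_site j ?c) ?M)"
    unfolding second_diff_def using K Suc.prems
    by (subst (1 2 3) sim_coeff_Suc_eq[where K = K])
       (auto simp: sum_subtractf sum_distrib_left)
  also have "\<dots> = (\<Sum>j=1..K. (if j = k then ?m k + ?m (Suc k) else 0)
      - (if j = Suc k then ?m (Suc k) else 0) - (if j = k - 1 then ?m k else 0))"
  proof (intro sum.cong refl)
    fix j assume j: "j \<in> {1..K}"
    have "split_site j (second_diff k ?c) ?M = 0" if "k < j"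
      using that Suc by (subst split_site_add_less) auto
    moreover have "split_site j (second_diff (k - 1) ?c) ?M = 0" if "j < k"
      using that Suc j by (subst split_site_add_greater) auto
    ultimately show "second_diff k (split_site j ?c) ?M = (if j = k then ?m k + ?m (Suc k) else 0)
      - (if j = Suc k then ?m (Suc k) else 0) - (if j = k - 1 then ?m k else 0)"
      using j Suc.prems by (subst second_diff_split_site) auto
  qed
  also have "\<dots> = ?m k - (if k = 1 then 0 else ?m k)"
    using K Suc.prems by (auto simp: sum_subtractf sum.delta)
  also have "\<dots> = 0"
    by (simp add: close_gap_def sim_coeff_site_0)
  finally show ?case .
qed

text \<open>Geometrically, \<open>\<beta>\<^sub>k\<close> and \<open>\<beta>\<^sub>k\<^sub>+\<^sub>1\<close> enter \<open>\<alpha>\<^sub>1, \<dots>, \<alpha>\<^sub>n\<close> in the same way when \<open>k \<ge> n\<close>.\<close>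

lemma sim_coeff_saturated:
  assumes "n \<le> k"
  shows "sim_coeff n (add_mset (Suc k) M) = sim_coeff n (add_mset k M)"
  using assms
proof (induction n arbitrary: k M)
  case (Suc n)
  let ?c = "sim_coeff n"
  let ?m = "\<lambda>i. ?c (image_mset (close_gap i) M)"
  obtain K where K: "Suc k \<le> K" "set_mset M \<subseteq> {..K}"
  proof -
    have "set_mset M \<subseteq> {..max (Suc k) (Max (set_mset M))}" by (auto simp: le_max_iff_disj)
    then show ?thesis using that by (metis max.cobounded1)
  qed
  have zero: "split_site j (\<lambda>N. ?c (add_mset (Suc i) N)) M = split_site j (\<lambda>N. ?c (add_mset i N)) M"
    if "n \<le> i" for i j
    using Suc.IH[OF that] by simp
  have "sim_coeff (Suc n) (add_mset (Suc k) M) - sim_coeff (Suc n) (add_mset k M) =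
    (\<Sum>j=1..K. split_site j ?c (add_mset (Suc k) M) - split_site j ?c (add_mset k M))"
    using K by (subst (1 2) sim_coeff_Suc_eq[where K = K]) (auto simp: sum_subtractf)
  also have "\<dots> = (\<Sum>j=1..K. (if j = Suc k then ?m (Suc k) else 0) - (if j = k then ?m k else 0))"
  proof (intro sum.cong refl)
    fix j assume j: "j \<in> {1..K}"
    have e: "Suc (k - 1) = k" using Suc.prems by simp
    consider "j > Suc k" | "j = Suc k" | "j = k" | "j < k" by linarith
    then show "split_site j ?c (add_mset (Suc k) M) - split_site j ?c (add_mset k M) =
       (if j = Suc k then ?m (Suc k) else 0) - (if j = k then ?m k else 0)"
    proof cases
      case 1
      then show ?thesis using zero[of k j] Suc.prems by (simp add: split_site_add_less)
    next
      case 2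
      then show ?thesis using zero[of k j] Suc.prems by (simp add: split_site_add_less split_site_add_same)
    next
      case 3
      then show ?thesis by (simp add: split_site_add_same split_site_add_greater)
    next
      case 4
      then show ?thesis using zero[of "k - 1" j] Suc.prems e by (simp add: split_site_add_greater)
    qed
  qed
  also have "\<dots> = ?m (Suc k) - ?m k"
    using K Suc.prems by (simp add: sum_subtractf sum.delta)
  also have "\<dots> = split_site k (\<lambda>N. ?c (add_mset k N) - ?c (add_mset (k - 1) N)) M"
    unfolding split_site_telescope ..
  also have "\<dots> = 0"
    using zero[of "k - 1" k] Suc.prems by (simp add: split_site_diff)
  finally show ?case by simp
qed simp

text \<open>Each step of the recursion removes exactly one particle.\<close>

lemma sim_coeff_size: "size M \<noteq> n \<Longrightarrow> sim_coeff n M = 0"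
proof (induction n arbitrary: M)
  case (Suc n)
  have "split_site j (sim_coeff n) M = 0" for j
    unfolding split_site_def
  proof (intro sum.neutral ballI Suc.IH)
    fix s assume s: "s \<in> {..<count M j}"
    have "size M = size (filter_mset (\<lambda>i. i \<noteq> j) M) + count M j" by (induction M) auto
    then show "size (image_mset (close_gap j) (filter_mset (\<lambda>i. i \<noteq> j) M) + replicate_mset s (j - 1) +
        replicate_mset (count M j - 1 - s) j) \<noteq> n"
      using s Suc.prems by simp
  qed
  then show ?case by simp
qed auto

section \<open>The Laplacian of a path\<close>

text \<open>The operators \<open>D\<^sub>1, \<dots>, D\<^sub>n\<close> in the variables \<open>1, \<dots>, n\<close>: the Laplacian of a path with absorbing end
\<open>0\<close> and reflecting end \<open>n\<close>. The corner entry is \<open>1\<close> since \<open>\<partial>\<^sub>n\<^sub>+\<^sub>1 = \<partial>\<^sub>n\<close> on the volume polynomial.\<close>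

definition boundary_laplacian :: "nat \<Rightarrow> nat \<Rightarrow> nat \<Rightarrow> real" where
  "boundary_laplacian n k i =
     (if i = k then if k = n then 1 else 2 else if i = Suc k \<or> k = Suc i then - 1 else 0)"

lemma boundary_laplacian_apply:
  assumes "k \<in> {1..n}" "g 0 = 0" "g (Suc n) = g n"
  shows "(\<Sum>i=1..n. boundary_laplacian n k i * g i) = 2 * g k - g (k - 1) - g (Suc k)"
proof -
  have "(\<Sum>i=1..n. boundary_laplacian n k i * g i) = (\<Sum>i=1..n.
      (if i = k then (if k = n then 1 else 2) * g k else 0) - (if i = k - 1 then g (k - 1) else 0)
      - (if i = Suc k then g (Suc k) else 0))"
    using assms(1) by (intro sum.cong refl) (auto simp: boundary_laplacian_def)
  also have "\<dots> = (if k = n then 1 else 2) * g k - (if k = 1 then 0 else g (k - 1))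
      - (if k = n then 0 else g (Suc k))"
    using assms(1) by (auto simp: sum_subtractf sum.delta)
  also have "\<dots> = 2 * g k - g (k - 1) - g (Suc k)"
    using assms by auto
  finally show ?thesis .
qed

text \<open>Summation by parts; \<open>g\<close> vanishes at the absorbing end and has no slope at the reflecting one.\<close>

lemma boundary_laplacian_form:
  assumes "g 0 = 0" "g (Suc n) = g n"
  shows "(\<Sum>k=1..n. \<Sum>i=1..n. g k * boundary_laplacian n k i * g i) = (\<Sum>k<n. (g (Suc k) - g k)\<^sup>2)"
proof -
  have "(\<Sum>k=1..n. \<Sum>i=1..n. g k * boundary_laplacian n k i * g i) =
      (\<Sum>k=1..n. g k * (2 * g k - g (k - 1) - g (Suc k)))"
  proof (intro sum.cong refl)
    fix k assume k: "k \<in> {1..n}"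
    have "(\<Sum>i=1..n. g k * boundary_laplacian n k i * g i) = g k * (\<Sum>i=1..n. boundary_laplacian n k i * g i)"
      by (simp add: sum_distrib_left mult.assoc)
    then show "(\<Sum>i=1..n. g k * boundary_laplacian n k i * g i) = g k * (2 * g k - g (k - 1) - g (Suc k))"
      unfolding boundary_laplacian_apply[OF k assms] .
  qed
  also have "\<dots> = (\<Sum>k<n. g (Suc k) * (g (Suc k) - g k)) - (\<Sum>k<n. g (Suc k) * (g (Suc (Suc k)) - g (Suc k)))"
    unfolding One_nat_def sum.atLeast1_atMost_eq
    by (simp add: sum_subtractf[symmetric] algebra_simps)
  also have "(\<Sum>k<n. g (Suc k) * (g (Suc (Suc k)) - g (Suc k))) = (\<Sum>k<n. g k * (g (Suc k) - g k))"
  proof -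
    have "(\<Sum>k<n. g (Suc k) * (g (Suc (Suc k)) - g (Suc k))) + g 0 * (g 1 - g 0) =
        (\<Sum>k<Suc n. g k * (g (Suc k) - g k))"
      by (subst sum.lessThan_Suc_shift) simp
    then show ?thesis using assms by simp
  qed
  also have "(\<Sum>k<n. g (Suc k) * (g (Suc k) - g k)) - (\<Sum>k<n. g k * (g (Suc k) - g k)) =
      (\<Sum>k<n. (g (Suc k) - g k)\<^sup>2)"
    by (simp add: sum_subtractf[symmetric] power2_eq_square algebra_simps)
  finally show ?thesis .
qed

lemma boundary_laplacian_stieltjes: "stieltjes_matrix {1..n} (boundary_laplacian n)"
proof
  fix i and x :: "nat \<Rightarrow> real"
  assume i: "i \<in> {1..n}" "x i \<noteq> 0"
  \<comment> \<open>\<open>x\<close> extended by the two boundary conditions.\<close>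
  define g where "g k = (if k = 0 then 0 else if k \<le> n then x k else x n)" for k
  have g: "g 0 = 0" "g (Suc n) = g n" using i by (auto simp: g_def)
  have "\<exists>k<n. g (Suc k) \<noteq> g k"
  proof (rule ccontr)
    assume "\<not> ?thesis"
    then have "k \<le> n \<Longrightarrow> g k = 0" for k by (induction k) (auto simp: g(1))
    from this[of i] show False using i by (simp add: g_def)
  qed
  then obtain k where "k < n" "g (Suc k) \<noteq> g k" by blast
  then have "0 < (\<Sum>k<n. (g (Suc k) - g k)\<^sup>2)" by (intro sum_pos2[of _ k]) auto
  also have "\<dots> = (\<Sum>k=1..n. \<Sum>i=1..n. x k * boundary_laplacian n k i * x i)"
    unfolding boundary_laplacian_form[OF g, symmetric] by (intro sum.cong refl) (auto simp: g_def)
  finally show "0 < (\<Sum>k=1..n. \<Sum>i=1..n. x k * boundary_laplacian n k i * x i)" .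
qed (auto simp: boundary_laplacian_def)

lemma ddir_boundary_laplacian:
  assumes "k \<in> {1..n}"
  shows "ddir {1..n} (boundary_laplacian n k) (sim_coeff n) M = second_diff k (sim_coeff n) M"
  unfolding ddir_def second_diff_def
  by (rule boundary_laplacian_apply[OF assms]) (simp_all add: sim_coeff_site_0 sim_coeff_saturated)

lemma sim_coeff_face_functional:
  "stieltjes_matrix.face_functional {1..n} (boundary_laplacian n) {1..n} (sim_coeff n)"
proof -
  interpret stieltjes_matrix "{1..n}" "boundary_laplacian n" by (rule boundary_laplacian_stieltjes)
  show ?thesis
    unfolding face_functional_def
  proof (intro conjI ballI allI)
    show "ddir {1..n} (boundary_laplacian n k) (sim_coeff n) (add_mset k M) = 0" if "k \<in> {1..n}" for k M
      using that by (simp only: ddir_boundary_laplacian) (simp add: second_diff_sim_coeff)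
    show "sim_coeff n (mset_set {1..n}) > 0" by (intro sim_coeff_pos) auto
  qed auto
qed

section \<open>The volume of a SIM-body by slicing\<close>

text \<open>Euler's beta integral. The antiderivative \<open>G\<close> comes from integrating by parts repeatedly.\<close>

lemma beta_integral:
  fixes l z :: real
  assumes "z \<ge> 0"
  shows "((\<lambda>c. (c - l) ^ s / fact s * ((l + z - c) ^ t / fact t)) has_integral
    z ^ (s + t + 1) / fact (s + t + 1)) {l..l + z}"
proof -
  define P where "P m c = (c - l) ^ m / fact m" for m and c :: real
  define R where "R m c = (l + z - c) ^ m / fact m" for m and c :: real
  have P: "(P (Suc m) has_real_derivative P m c) (at c within S)" for m c S
  proof -
    have "(P (Suc m) has_real_derivative real (Suc m) * (c - l) ^ m / fact (Suc m)) (at c within S)"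
      unfolding P_def by (auto intro!: derivative_eq_intros simp del: of_nat_Suc fact_Suc power_Suc)
    also have "real (Suc m) * (c - l) ^ m / fact (Suc m) = P m c"
      by (simp add: P_def del: of_nat_Suc)
    finally show ?thesis .
  qed
  have R: "(R (Suc m) has_real_derivative - R m c) (at c within S)" for m c S
  proof -
    have "(R (Suc m) has_real_derivative - (real (Suc m) * (l + z - c) ^ m / fact (Suc m))) (at c within S)"
      unfolding R_def by (auto intro!: derivative_eq_intros simp del: of_nat_Suc fact_Suc power_Suc)
    also have "- (real (Suc m) * (l + z - c) ^ m / fact (Suc m)) = - R m c"
      by (simp add: R_def del: of_nat_Suc)
    finally show ?thesis .
  qed
  define G where "G c = (\<Sum>r\<le>t. P (Suc (s + r)) c * R (t - r) c)" for c
  have "(G has_real_derivative P s c * R t c) (at c within S)" for c S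
  proof -
    have deriv: "((\<lambda>c. P (Suc (s + r)) c * R (t - r) c) has_real_derivative
        P (s + r) c * R (t - r) c - (if r = t then 0 else P (s + Suc r) c * R (t - Suc r) c)) (at c within S)"
      if "r \<le> t" for r
    proof (cases "r = t")
      case True
      then show ?thesis using DERIV_cmult_right[OF P[of "s + r" c S], of 1]
        by (simp add: R_def)
    next
      case False
      define m where "m = t - Suc r"
      have m: "t - r = Suc m" "t - Suc r = m" using False \<open>r \<le> t\<close> by (auto simp: m_def)
      show ?thesis
        using DERIV_mult[OF P[of "s + r" c S] R[of m c S]] False by (simp add: m mult.commute)
    qed
    have "(G has_real_derivative (\<Sum>r\<le>t. P (s + r) c * R (t - r) c -
        (if r = t then 0 else P (s + Suc r) c * R (t - Suc r) c))) (at c within S)"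
      unfolding G_def using deriv by (intro DERIV_sum) auto
    also have "(\<Sum>r\<le>t. P (s + r) c * R (t - r) c - (if r = t then 0 else P (s + Suc r) c * R (t - Suc r) c)) =
       (\<Sum>r\<le>t. P (s + r) c * R (t - r) c) - (\<Sum>r<t. P (s + Suc r) c * R (t - Suc r) c)"
      unfolding sum_subtractf lessThan_Suc_atMost[symmetric] sum.lessThan_Suc
      by (auto intro!: sum.cong)
    also have "\<dots> = P s c * R t c"
      unfolding lessThan_Suc_atMost[symmetric] sum.lessThan_Suc_shift by simp
    finally show ?thesis .
  qed
  then have "((\<lambda>c. P s c * R t c) has_integral G (l + z) - G l) {l..l + z}"
    using assms by (intro fundamental_theorem_of_calculus) (auto simp: has_real_derivative_iff_has_vector_derivative)
  moreover have "G l = 0" by (simp add: G_def P_def)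
  moreover have "G (l + z) = z ^ (s + t + 1) / fact (s + t + 1)"
  proof -
    have "G (l + z) = (\<Sum>r\<le>t. if r = t then z ^ (s + t + 1) / fact (s + t + 1) else 0)"
      unfolding G_def by (intro sum.cong) (auto simp: P_def R_def)
    then show ?thesis by simp
  qed
  ultimately show ?thesis by (simp add: P_def R_def)
qed

text \<open>As long as the number of particles at \<open>j\<close> does not change, a derivative only has to be
renumbered.\<close>

lemma split_site_ddir:
  assumes j: "1 \<le> j" "j \<le> K" and \<beta>: "\<beta> j = 0" "\<beta> (Suc K) = 0"
  shows "ddir {..K} \<beta> (split_site j F) M = split_site j (ddir {..K} (\<lambda>i. \<beta> (if i < j then i else Suc i)) F) M"
proof -
  let ?\<Phi> = "\<lambda>i. split_site j (\<lambda>N. F (add_mset i N)) M"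
  let ?\<rho> = "\<lambda>i. \<beta> (if i < j then i else Suc i)"
  have K: "{..K} = {..<j} \<union> {j..K}" using j by auto
  have "ddir {..K} \<beta> (split_site j F) M = (\<Sum>i<j. \<beta> i * ?\<Phi> i) + (\<Sum>i=j..K. \<beta> i * split_site j F (add_mset i M))"
    unfolding ddir_def K by (subst sum.union_disjoint) (auto simp: split_site_add_less)
  also have "(\<Sum>i=j..K. \<beta> i * split_site j F (add_mset i M)) = (\<Sum>i=Suc j..K. \<beta> i * ?\<Phi> (i - 1))"
  proof -
    have "(\<Sum>i=j..K. \<beta> i * split_site j F (add_mset i M)) = (\<Sum>i=Suc j..K. \<beta> i * split_site j F (add_mset i M))"
      using j \<beta>(1) by (subst sum.atLeast_Suc_atMost) auto
    then show ?thesis by (simp add: split_site_add_greater)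
  qed
  also have "\<dots> = (\<Sum>i=Suc j..Suc K. \<beta> i * ?\<Phi> (i - 1))"
    using j \<beta>(2) by simp
  also have "\<dots> = (\<Sum>i=j..K. \<beta> (Suc i) * ?\<Phi> i)"
    by (subst sum.shift_bounds_cl_Suc_ivl) simp
  also have "(\<Sum>i<j. \<beta> i * ?\<Phi> i) + (\<Sum>i=j..K. \<beta> (Suc i) * ?\<Phi> i) = (\<Sum>i\<le>K. ?\<rho> i * ?\<Phi> i)"
    unfolding K by (subst sum.union_disjoint) auto
  also have "\<dots> = split_site j (ddir {..K} ?\<rho> F) M"
    unfolding ddir_def[abs_def] split_site_sum split_site_mult ..
  finally show ?thesis .
qed

lemma split_site_divided_power:
  assumes j: "1 \<le> j" "j \<le> K" and \<beta>: "\<beta> j = 0" "\<beta> (Suc K) = 0"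
  shows "divided_power {..K} n \<beta> (split_site j F) M =
    split_site j (divided_power {..K} n (\<lambda>i. \<beta> (if i < j then i else Suc i)) F) M"
proof -
  let ?\<rho> = "\<lambda>i. \<beta> (if i < j then i else Suc i)"
  have "(ddir {..K} \<beta> ^^ n) (split_site j F) = split_site j ((ddir {..K} ?\<rho> ^^ n) F)"
  proof (induction n)
    case (Suc n)
    have "ddir {..K} \<beta> (split_site j G) = split_site j (ddir {..K} ?\<rho> G)" for G
      by (rule ext) (rule split_site_ddir[OF j \<beta>])
    then show ?case by (simp add: Suc)
  qed simp
  then show ?thesis
    by (simp add: divided_power_def[abs_def] split_site_def sum_divide_distrib)
qed

text \<open>The differences of consecutive entries of \<open>\<alpha>\<close> for the slice at height \<open>c = \<alpha>\<^sub>j\<^sub>+\<^sub>1 + u\<close>: site \<open>j\<close>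
disappears, its length \<open>\<beta> j\<close> is divided between the neighbours, and what was \<open>j + 1\<close> gets the
number \<open>j\<close>. The entry at \<open>0\<close> has no geometric meaning.\<close>

definition slice_param :: "nat \<Rightarrow> real \<Rightarrow> (nat \<Rightarrow> real) \<Rightarrow> nat \<Rightarrow> real" where
  "slice_param j u \<beta> i = (if i < j then \<beta> i else \<beta> (Suc i))
     + (if i = j - 1 then u else 0) + (if i = j then \<beta> j - u else 0)"

text \<open>The operator \<open>split_site j\<close> on coefficients is integration over the slices with \<open>c\<close> between
\<open>\<alpha>\<^sub>j\<^sub>+\<^sub>1 = l\<close> and \<open>\<alpha>\<^sub>j\<close>: expand in the lengths \<open>c - l\<close> and \<open>\<beta> j - (c - l)\<close> of the two pieces, where
the beta integral turns \<open>s\<close> powers of the one and \<open>t\<close> of the other into the divided power of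
order \<open>s + t + 1\<close> of \<open>\<beta> j\<close>.\<close>

theorem split_site_integral:
  assumes j: "1 \<le> j" "j \<le> K" and \<beta>: "\<beta> j \<ge> 0" "\<beta> (Suc K) = 0"
  shows "((\<lambda>c. divided_power {..K} n (slice_param j (c - l) \<beta>) F {#}) has_integral
           divided_power {..K} (Suc n) \<beta> (split_site j F) {#}) {l..l + \<beta> j}"
proof -
  define z where "z = \<beta> j"
  define \<beta>' where "\<beta>' = \<beta>(j := 0)"
  define \<rho> where "\<rho> = (\<lambda>i. \<beta>' (if i < j then i else Suc i))"
  define H where "H m s t = divided_power {..K} m \<rho> F (replicate_mset s (j - 1) + replicate_mset t j)" for m s t
  have "divided_power {..K} (Suc n) \<beta> (split_site j F) {#} =
      divided_power {..K} (Suc n) (\<lambda>i. \<beta>' i + (if i = j then z else 0)) (split_site j F) {#}"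
    by (rule arg_cong[of _ _ "\<lambda>b. divided_power {..K} (Suc n) b (split_site j F) {#}"])
       (auto simp: \<beta>'_def z_def)
  also have "\<dots> = (\<Sum>q\<le>Suc n. z ^ q / fact q * (\<Sum>s<q. H (Suc n - q) s (q - 1 - s)))"
  proof (subst divided_power_binomial)
    have "divided_power {..K} m \<beta>' (split_site j F) ({#} + replicate_mset q j) = (\<Sum>s<q. H m s (q - 1 - s))" for m q
    proof -
      have 1: "filter_mset (\<lambda>i. i \<noteq> j) (replicate_mset q j) = {#}" by (induction q) auto
      have 2: "\<beta>' j = 0" "\<beta>' (Suc K) = 0" using j \<beta> by (auto simp: \<beta>'_def)
      have "divided_power {..K} m \<beta>' (split_site j F) (replicate_mset q j) =
          split_site j (divided_power {..K} m \<rho> F) (replicate_mset q j)"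
        using split_site_divided_power[OF j 2] by (simp only: \<rho>_def)
      then show ?thesis unfolding split_site_def[of j "divided_power {..K} m \<rho> F"] 1 by (simp add: H_def)
    qed
    then show "(\<Sum>q\<le>Suc n. z ^ q / fact q * divided_power {..K} (Suc n - q) \<beta>' (split_site j F) ({#} + replicate_mset q j)) =
       (\<Sum>q\<le>Suc n. z ^ q / fact q * (\<Sum>s<q. H (Suc n - q) s (q - 1 - s)))" by simp
  qed (use j in auto)
  also have "\<dots> = (\<Sum>q\<le>n. z ^ (q + 1) / fact (q + 1) * (\<Sum>s\<le>q. H (n - q) s (q - s)))"
    by (subst sum.atMost_Suc_shift) (simp add: lessThan_Suc_atMost)
  also have "\<dots> = (\<Sum>q\<le>n. \<Sum>s\<le>q. z ^ (s + (q - s) + 1) / fact (s + (q - s) + 1) * H (n - s - (q - s)) s (q - s))"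
    by (simp add: sum_distrib_left)
  also have "\<dots> = (\<Sum>(s, t)\<in>{(s, t). s + t \<le> n}. z ^ (s + t + 1) / fact (s + t + 1) * H (n - s - t) s t)"
    by (rule sum.triangle_reindex_eq[symmetric])
  finally have rhs: "divided_power {..K} (Suc n) \<beta> (split_site j F) {#} =
      (\<Sum>(s, t)\<in>{(s, t). s + t \<le> n}. z ^ (s + t + 1) / fact (s + t + 1) * H (n - s - t) s t)" .
  have lhs: "divided_power {..K} n (slice_param j (c - l) \<beta>) F {#} =
      (\<Sum>(s, t)\<in>{(s, t). s + t \<le> n}. (c - l) ^ s / fact s * ((l + z - c) ^ t / fact t) * H (n - s - t) s t)" for c
  proof -
    have "slice_param j (c - l) \<beta> = (\<lambda>i. (\<rho> i + (if i = j then l + z - c else 0)) + (if i = j - 1 then c - l else 0))"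
      using j by (auto simp: slice_param_def \<rho>_def \<beta>'_def z_def)
    then have "divided_power {..K} n (slice_param j (c - l) \<beta>) F {#} =
        (\<Sum>s\<le>n. (c - l) ^ s / fact s *
          divided_power {..K} (n - s) (\<lambda>i. \<rho> i + (if i = j then l + z - c else 0)) F ({#} + replicate_mset s (j - 1)))"
      using j by (simp only:) (subst divided_power_binomial, auto)
    also have "\<dots> = (\<Sum>s\<le>n. (c - l) ^ s / fact s *
          (\<Sum>t\<le>n - s. (l + z - c) ^ t / fact t * H (n - s - t) s t))"
      using j by (subst divided_power_binomial) (auto simp: H_def)
    also have "\<dots> = (\<Sum>s\<le>n. \<Sum>t\<le>n - s. (c - l) ^ s / fact s * ((l + z - c) ^ t / fact t) * H (n - s - t) s t)"
      by (simp add: sum_distrib_left mult.assoc)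
    also have "\<dots> = (\<Sum>(s, t)\<in>(SIGMA s:{..n}. {..n - s}). (c - l) ^ s / fact s * ((l + z - c) ^ t / fact t) * H (n - s - t) s t)"
      by (simp add: sum.Sigma)
    also have "(SIGMA s:{..n}. {..n - s}) = {(s, t). s + t \<le> n}" by auto
    finally show ?thesis .
  qed
  have fin: "finite {(s, t). s + t \<le> n}"
    by (rule finite_subset[of _ "{..n} \<times> {..n}"]) auto
  show ?thesis
    unfolding lhs rhs z_def[symmetric]
  proof (intro has_integral_sum[OF fin])
    fix p assume "p \<in> {(s, t). s + t \<le> n}"
    obtain s t where p: "p = (s, t)" by fastforce
    show "((\<lambda>c. case p of (s, t) \<Rightarrow> (c - l) ^ s / fact s * ((l + z - c) ^ t / fact t) * H (n - s - t) s t) has_integral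
         (case p of (s, t) \<Rightarrow> z ^ (s + t + 1) / fact (s + t + 1) * H (n - s - t) s t)) {l..l + z}"
      unfolding p prod.case using \<beta>(1) by (intro has_integral_mult_left beta_integral) (simp add: z_def)
  qed
qed

lemma sim_body_iff:
  "x \<in> sim_body n \<alpha> \<longleftrightarrow> x \<in> extensional {1..n} \<and> (\<forall>i\<in>{1..n}. 0 \<le> x i) \<and>
     (\<forall>I\<in>Pow {1..n} - {{}}. (\<Sum>i\<in>I. x i) \<le> (\<Sum>j=1..card I. \<alpha> j))"
proof -
  have "card I \<ge> 1 \<longleftrightarrow> I \<noteq> {}" if "I \<subseteq> {1..n}" for I
    using finite_subset[OF that] by (auto simp: Suc_le_eq card_gt_0_iff)
  then show ?thesis by (auto simp: sim_body_def PiE_iff)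
qed

lemma sim_body_cong:
  assumes "\<And>k. 1 \<le> k \<Longrightarrow> \<alpha> k = \<alpha>' k"
  shows "sim_body n \<alpha> = sim_body n \<alpha>'"
proof -
  have "(\<Sum>j=1..k. \<alpha> j) = (\<Sum>j=1..k. \<alpha>' j)" for k
    using assms by (intro sum.cong) auto
  then show ?thesis by (simp add: sim_body_def)
qed

lemma sim_body_sets [measurable]: "sim_body n \<alpha> \<in> sets (\<Pi>\<^sub>M i\<in>{1..n}. lborel)"
proof -
  have coord: "(\<lambda>x. x i) \<in> borel_measurable (\<Pi>\<^sub>M i\<in>{1..n}. lborel :: real measure)" if "i \<in> {1..n}" for i
    using measurable_component_singleton[OF that, of "\<lambda>_. lborel :: real measure"] by simp
  have "sim_body n \<alpha> = {x \<in> space (\<Pi>\<^sub>M i\<in>{1..n}. lborel). (\<forall>i\<in>{1..n}. 0 \<le> x i) \<and>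
     (\<forall>I\<in>Pow {1..n} - {{}}. (\<Sum>i\<in>I. x i) \<le> (\<Sum>j=1..card I. \<alpha> j))}"
    by (auto simp: sim_body_iff space_PiM PiE_iff)
  also have "\<dots> \<in> sets (\<Pi>\<^sub>M i\<in>{1..n}. lborel)"
  proof (intro sets.sets_Collect_conj sets.sets_Collect_finite_All)
    show "{x \<in> space (\<Pi>\<^sub>M i\<in>{1..n}. lborel). (0 :: real) \<le> x i} \<in> sets (\<Pi>\<^sub>M i\<in>{1..n}. lborel)"
      if "i \<in> {1..n}" for i by (rule borel_measurable_le[OF borel_measurable_const coord[OF that]])
    show "{x \<in> space (\<Pi>\<^sub>M i\<in>{1..n}. lborel). (\<Sum>i\<in>I. x i) \<le> (\<Sum>j=1..card I. \<alpha> j)}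
        \<in> sets (\<Pi>\<^sub>M i\<in>{1..n}. lborel)"
      if "I \<in> Pow {1..n} - {{}}" for I
    proof -
      have "(\<lambda>x. \<Sum>i\<in>I. x i) \<in> borel_measurable (\<Pi>\<^sub>M i\<in>{1..n}. lborel)"
        using that by (intro borel_measurable_sum coord) auto
      then show ?thesis by measurable
    qed
  qed auto
  finally show ?thesis .
qed

lemma slice_partial_sums:
  fixes \<alpha> :: "nat \<Rightarrow> real"
  assumes "1 \<le> j"
  shows "(\<Sum>i=1..k. if i < j then \<alpha> i else if i = j then \<alpha> j + \<alpha> (Suc j) - c else \<alpha> (Suc i)) =
    (if k < j then \<Sum>i=1..k. \<alpha> i else (\<Sum>i=1..Suc k. \<alpha> i) - c)"
proof (induction k)
  case (Suc k)
  consider "Suc k < j" | "Suc k = j" | "j < Suc k" by linarith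
  then show ?case using Suc by cases auto
qed (use assms in auto)

text \<open>Fixing the last coordinate at \<open>c\<close>, the inequality for \<open>I\<close> is joined by the one for \<open>I\<close> with the
last coordinate, \<open>\<Sum>\<^sub>I y \<le> F\<^sub>k\<^sub>+\<^sub>1 - c\<close> for the partial sums \<open>F\<close> of \<open>\<alpha>\<close>. The former is the stronger
one for \<open>k < j\<close> and the latter for \<open>k \<ge> j\<close>, since \<open>c\<close> lies between \<open>\<alpha>\<^sub>j\<^sub>+\<^sub>1\<close> and \<open>\<alpha>\<^sub>j\<close>.\<close>

lemma sim_body_slice:
  fixes \<alpha> :: "nat \<Rightarrow> real"
  assumes anti: "\<And>i k. 1 \<le> i \<Longrightarrow> i \<le> k \<Longrightarrow> \<alpha> k \<le> \<alpha> i"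
    and j: "1 \<le> j" and c: "0 \<le> c" "\<alpha> (Suc j) \<le> c" "c \<le> \<alpha> j" and y: "y \<in> extensional {1..n}"
  shows "y(Suc n := c) \<in> sim_body (Suc n) \<alpha> \<longleftrightarrow>
    y \<in> sim_body n (\<lambda>i. if i < j then \<alpha> i else if i = j then \<alpha> j + \<alpha> (Suc j) - c else \<alpha> (Suc i))"
    (is "_ \<longleftrightarrow> y \<in> sim_body n ?\<alpha>'")
proof -
  define F where "F k = (\<Sum>i=1..k. \<alpha> i)" for k
  define F' where "F' k = (\<Sum>i=1..k. ?\<alpha>' i)" for k
  have F': "F' k = (if k < j then F k else F (Suc k) - c)" for k
    unfolding F'_def F_def by (rule slice_partial_sums[OF j])
  have F_Suc: "F (Suc k) = F k + \<alpha> (Suc k)" for k by (simp add: F_def)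
  have F'_le: "F' k \<le> F k" for k
    using anti[of "Suc j" "Suc k"] c by (auto simp: F' F_Suc)
  have F'_le2: "F' k + c \<le> F (Suc k)" for k
    using anti[of "Suc k" j] c by (auto simp: F' F_Suc)
  have sum_y: "sum (y(Suc n := c)) I = sum y I" if "I \<subseteq> {1..n}" for I
    using that by (intro sum.cong) auto
  have sum_ins: "sum (y(Suc n := c)) (insert (Suc n) I) = sum y I + c" if "I \<subseteq> {1..n}" for I
  proof -
    have "finite I" "Suc n \<notin> I" using that finite_subset by auto
    then show ?thesis using sum_y[OF that] by simp
  qed
  have card_ins: "card (insert (Suc n) I) = Suc (card I)" if "I \<subseteq> {1..n}" for I
  proof -
    have "finite I" "Suc n \<notin> I" using that finite_subset by auto
    then show ?thesis by simp
  qed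
  have ext: "y(Suc n := c) \<in> extensional {1..Suc n}" using y by (auto simp: extensional_def)
  show ?thesis
  proof
    assume L: "y(Suc n := c) \<in> sim_body (Suc n) \<alpha>"
    have "sum y I \<le> F' (card I)" if I: "I \<in> Pow {1..n} - {{}}" for I
    proof (cases "card I < j")
      case True
      have "I \<in> Pow {1..Suc n} - {{}}" using I by auto
      then have "sum (y(Suc n := c)) I \<le> F (card I)" using L unfolding sim_body_iff F_def by blast
      then show ?thesis using True I by (simp only: F' sum_y Pow_iff Diff_iff if_True)
    next
      case False
      have "insert (Suc n) I \<in> Pow {1..Suc n} - {{}}" using I by auto
      then have "sum (y(Suc n := c)) (insert (Suc n) I) \<le> F (card (insert (Suc n) I))"
        using L unfolding sim_body_iff F_def by blast
      then have "sum y I + c \<le> F (Suc (card I))" using I by (simp only: sum_ins card_ins Pow_iff Diff_iff)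
      then show ?thesis using False by (simp add: F')
    qed
    moreover have "0 \<le> y i" if "i \<in> {1..n}" for i
    proof -
      have "i \<in> {1..Suc n}" using that by simp
      then have "0 \<le> (y(Suc n := c)) i" using L unfolding sim_body_iff by blast
      then show ?thesis using that by simp
    qed
    ultimately show "y \<in> sim_body n ?\<alpha>'" using y unfolding sim_body_iff F'_def by blast
  next
    assume R: "y \<in> sim_body n ?\<alpha>'"
    have R': "sum y I \<le> F' (card I)" if "I \<subseteq> {1..n}" "I \<noteq> {}" for I
      using R that unfolding sim_body_iff F'_def by blast
    have "sum (y(Suc n := c)) I \<le> F (card I)" if I: "I \<in> Pow {1..Suc n} - {{}}" for I
    proof (cases "Suc n \<in> I")
      case False
      then have In: "I \<subseteq> {1..n}" using I by (auto simp: le_Suc_eq)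
      then show ?thesis using R'[OF In] I F'_le[of "card I"] sum_y[OF In] by auto
    next
      case True
      define J where "J = I - {Suc n}"
      have J: "J \<subseteq> {1..n}" "I = insert (Suc n) J" using I True by (auto simp: J_def le_Suc_eq)
      have "sum y J + c \<le> F (Suc (card J))"
      proof (cases "J = {}")
        case True
        then show ?thesis using c anti[of 1 j] j by (simp add: F_def)
      next
        case False
        then show ?thesis using R'[OF J(1) False] F'_le2[of "card J"] by simp
      qed
      then show ?thesis unfolding J(2) sum_ins[OF J(1)] card_ins[OF J(1)] .
    qed
    moreover have "0 \<le> (y(Suc n := c)) i" if "i \<in> {1..Suc n}" for i
    proof (cases "i = Suc n")
      case False
      then have "i \<in> {1..n}" using that by simp
      then have "0 \<le> y i" using R unfolding sim_body_iff by blast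
      then show ?thesis using False by simp
    qed (use c in simp)
    ultimately show "y(Suc n := c) \<in> sim_body (Suc n) \<alpha>" using ext unfolding sim_body_iff F_def by blast
  qed
qed

text \<open>Connects the descriptions of a slice by \<open>\<alpha>\<close> in \<open>sim_body_slice\<close> and by \<open>\<beta>\<close> in \<open>slice_param\<close>, for
\<open>u = c - \<alpha>\<^sub>j\<^sub>+\<^sub>1\<close>.\<close>

lemma slice_param_tail:
  assumes j: "1 \<le> j" "j \<le> K" and \<beta>: "\<beta> (Suc K) = 0" and k: "1 \<le> k"
  defines "\<alpha> \<equiv> \<lambda>k. \<Sum>i=k..K. \<beta> i"
  shows "(\<Sum>i=k..K. slice_param j u \<beta> i) =
    (if k < j then \<alpha> k else if k = j then \<alpha> j + \<alpha> (Suc j) - (u + \<alpha> (Suc j)) else \<alpha> (Suc k))"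
proof -
  have tail: "\<alpha> m = \<beta> m + \<alpha> (Suc m)" if "m \<le> K" for m
    unfolding \<alpha>_def using that by (rule sum.atLeast_Suc_atMost)
  have beyond: "\<alpha> m = 0" if "m > K" for m
    using that by (simp add: \<alpha>_def)
  have sp: "(\<Sum>i=m..K. slice_param j u \<beta> i) = slice_param j u \<beta> m + (\<Sum>i=Suc m..K. slice_param j u \<beta> i)" if "m \<le> K" for m
    using that by (rule sum.atLeast_Suc_atMost)
  have ?thesis if "k \<le> Suc K" using that k
  proof (induction k rule: inc_induct)
    case base
    then show ?case using j \<beta> by (simp add: \<alpha>_def)
  next
    case (step m)
    have m: "m \<le> K" "1 \<le> Suc m" using step by auto
    have IH: "(\<Sum>i=Suc m..K. slice_param j u \<beta> i) =
      (if Suc m < j then \<alpha> (Suc m) else if Suc m = j then \<alpha> j + \<alpha> (Suc j) - (u + \<alpha> (Suc j)) else \<alpha> (Suc (Suc m)))"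
      using step by simp
    have a1: "\<alpha> m = \<beta> m + \<alpha> (Suc m)" using tail m by simp
    have a2: "\<alpha> (Suc m) = \<beta> (Suc m) + \<alpha> (Suc (Suc m))"
      using tail[of "Suc m"] m beyond \<beta>
      by (cases "Suc m \<le> K") (auto simp: not_le less_Suc_eq_le)
    consider "Suc m < j" | "Suc m = j" | "m = j" | "j < m" by linarith
    then show ?case
    proof cases
      case 1
      then show ?thesis unfolding sp[OF m(1)] IH using a1 by (auto simp: slice_param_def)
    next
      case 2
      then show ?thesis unfolding sp[OF m(1)] IH using a1 a2 by (auto simp: slice_param_def)
    next
      case 3
      then show ?thesis unfolding sp[OF m(1)] IH using a1 a2 j by (auto simp: slice_param_def)
    next
      case 4
      then show ?thesis unfolding sp[OF m(1)] IH using a2 by (auto simp: slice_param_def)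
    qed
  qed
  moreover have ?thesis if "k > Suc K"
    using that j beyond by auto
  ultimately show ?thesis by linarith
qed

text \<open>Fubini's theorem for the last coordinate \<open>c\<close>, which runs through \<open>[0, \<alpha>\<^sub>1]\<close>. The interval is cut
at the points \<open>\<alpha>\<^sub>j\<close>; the piece \<open>[\<alpha>\<^sub>j\<^sub>+\<^sub>1, \<alpha>\<^sub>j]\<close> contributes the splitting of site \<open>j\<close>.\<close>

theorem sim_body_emeasure:
  assumes K: "1 \<le> K" and \<beta>: "\<And>i. \<beta> i \<ge> 0" "\<And>i. i > K \<Longrightarrow> \<beta> i = 0"
  shows "emeasure (\<Pi>\<^sub>M i\<in>{1..n}. lborel) (sim_body n (\<lambda>k. \<Sum>i=k..K. \<beta> i)) =
    ennreal (divided_power {..K} n \<beta> (sim_coeff n) {#})"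
  using \<beta>
proof (induction n arbitrary: \<beta>)
  case 0
  interpret product_sigma_finite "\<lambda>_ :: nat. lborel :: real measure" ..
  have "sim_body 0 (\<lambda>k. \<Sum>i=k..K. \<beta> i) = {\<lambda>_. undefined}"
    by (auto simp: sim_body_def)
  then show ?case by (simp add: emeasure_PiM_empty)
next
  case (Suc n)
  interpret product_sigma_finite "\<lambda>_ :: nat. lborel :: real measure" ..
  define \<alpha> where "\<alpha> = (\<lambda>k. \<Sum>i=k..K. \<beta> i)"
  have anti: "\<alpha> k \<le> \<alpha> i" if "i \<le> k" for i k
    unfolding \<alpha>_def using that Suc.prems(1) by (intro sum_mono2) auto
  have last: "\<alpha> (Suc K) = 0" by (simp add: \<alpha>_def)
  have nonneg: "\<alpha> k \<ge> 0" for k unfolding \<alpha>_def using Suc.prems(1) by (intro sum_nonneg) auto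
  define S where "S = sim_body (Suc n) \<alpha>"
  have S [measurable]: "S \<in> sets (\<Pi>\<^sub>M i\<in>{1..Suc n}. lborel)" unfolding S_def by (rule sim_body_sets)
  define E where "E c = (\<integral>\<^sup>+ y. indicator S (y(Suc n := c)) \<partial>(\<Pi>\<^sub>M i\<in>{1..n}. lborel))" for c
  have fubini: "emeasure (\<Pi>\<^sub>M i\<in>{1..Suc n}. lborel) S = (\<integral>\<^sup>+ c. E c \<partial>lborel)"
  proof -
    have ins: "{1..Suc n} = insert (Suc n) {1..n}" by auto
    have "emeasure (\<Pi>\<^sub>M i\<in>{1..Suc n}. lborel) S = (\<integral>\<^sup>+ x. indicator S x \<partial>(\<Pi>\<^sub>M i\<in>{1..Suc n}. lborel))"
      using S by simp
    also have "\<dots> = (\<integral>\<^sup>+ c. E c \<partial>lborel)"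
      using S unfolding E_def ins
      by (intro product_nn_integral_insert_rev borel_measurable_indicator) auto
    finally show ?thesis .
  qed
  have E_slice: "E c = ennreal (divided_power {..K} n (slice_param j (c - \<alpha> (Suc j)) \<beta>) (sim_coeff n) {#})"
    and slice_nonneg: "divided_power {..K} n (slice_param j (c - \<alpha> (Suc j)) \<beta>) (sim_coeff n) {#} \<ge> 0"
    if j: "1 \<le> j" "j \<le> K" and c: "\<alpha> (Suc j) \<le> c" "c \<le> \<alpha> j" for j c
  proof -
    define \<gamma> where "\<gamma> = slice_param j (c - \<alpha> (Suc j)) \<beta>"
    have "\<alpha> j = \<beta> j + \<alpha> (Suc j)" unfolding \<alpha>_def using j(2) by (rule sum.atLeast_Suc_atMost)
    then have \<gamma>: "\<gamma> i \<ge> 0" for i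
      using Suc.prems(1) c by (auto simp: \<gamma>_def slice_param_def)
    have \<gamma>': "\<gamma> i = 0" if "i > K" for i
      using Suc.prems(2) that j by (auto simp: \<gamma>_def slice_param_def)
    have "sim_body n (\<lambda>k. \<Sum>i=k..K. \<gamma> i) =
        sim_body n (\<lambda>i. if i < j then \<alpha> i else if i = j then \<alpha> j + \<alpha> (Suc j) - c else \<alpha> (Suc i))"
      using slice_param_tail[OF j, of \<beta> _ "c - \<alpha> (Suc j)"] Suc.prems(2)
      by (intro sim_body_cong) (auto simp: \<gamma>_def \<alpha>_def)
    then have "y(Suc n := c) \<in> S \<longleftrightarrow> y \<in> sim_body n (\<lambda>k. \<Sum>i=k..K. \<gamma> i)"
      if "y \<in> extensional {1..n}" for y
      unfolding S_def using sim_body_slice[of \<alpha> j c y n] anti j c that nonneg[of "Suc j"] by auto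
    then have "E c = (\<integral>\<^sup>+ y. indicator (sim_body n (\<lambda>k. \<Sum>i=k..K. \<gamma> i)) y \<partial>(\<Pi>\<^sub>M i\<in>{1..n}. lborel))"
      unfolding E_def by (intro nn_integral_cong) (auto simp: indicator_def space_PiM PiE_iff)
    also have "\<dots> = emeasure (\<Pi>\<^sub>M i\<in>{1..n}. lborel) (sim_body n (\<lambda>k. \<Sum>i=k..K. \<gamma> i))"
      by (rule nn_integral_indicator) (rule sim_body_sets)
    also have "\<dots> = ennreal (divided_power {..K} n \<gamma> (sim_coeff n) {#})"
      by (rule Suc.IH) (use \<gamma> \<gamma>' in auto)
    finally show "E c = ennreal (divided_power {..K} n (slice_param j (c - \<alpha> (Suc j)) \<beta>) (sim_coeff n) {#})"
      unfolding \<gamma>_def .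
    show "divided_power {..K} n (slice_param j (c - \<alpha> (Suc j)) \<beta>) (sim_coeff n) {#} \<ge> 0"
      using \<gamma> by (intro divided_power_nonneg sim_coeff_nonneg) (simp add: \<gamma>_def)
  qed
  have cover: "\<exists>j. 1 \<le> j \<and> j \<le> K \<and> \<alpha> (Suc j) \<le> c \<and> c \<le> \<alpha> j" if "0 \<le> c" "c \<le> \<alpha> 1" for c
  proof (rule ccontr)
    assume no: "\<not> ?thesis"
    have "c < \<alpha> (Suc m)" if "m \<le> K" "1 \<le> m" for m
      using that(2,1)
    proof (induction m rule: nat_induct_at_least)
      case base
      then show ?case using no \<open>c \<le> \<alpha> 1\<close> K by (metis One_nat_def le_refl not_le)
    next
      case (Suc m)
      then show ?case using no by (metis Suc_leD le_SucI less_imp_le not_le)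
    qed
    then show False using last K \<open>0 \<le> c\<close> by (metis le_refl not_le)
  qed
  \<comment> \<open>The slices have finite volume, so \<open>g\<close> loses nothing and can be integrated over adjacent intervals.\<close>
  define g where "g c = enn2real (E c)" for c
  define I where "I j = divided_power {..K} (Suc n) \<beta> (split_site j (sim_coeff n)) {#}" for j
  have g_int: "(g has_integral I j) {\<alpha> (Suc j)..\<alpha> j}" if j: "1 \<le> j" "j \<le> K" for j
  proof -
    have "\<alpha> j = \<alpha> (Suc j) + \<beta> j" unfolding \<alpha>_def using j(2) by (simp add: sum.atLeast_Suc_atMost)
    then have "((\<lambda>c. divided_power {..K} n (slice_param j (c - \<alpha> (Suc j)) \<beta>) (sim_coeff n) {#}) has_integral I j)
        {\<alpha> (Suc j)..\<alpha> j}"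
      using split_site_integral[OF j, of \<beta> n "\<alpha> (Suc j)" "sim_coeff n"] Suc.prems by (simp add: I_def)
    then show ?thesis
      by (rule has_integral_eq[rotated]) (use E_slice[OF j] slice_nonneg[OF j] in \<open>auto simp: g_def\<close>)
  qed
  have "(g has_integral (\<Sum>j=1..m. I j)) {\<alpha> (Suc m)..\<alpha> 1}" if "m \<le> K" for m
    using that
  proof (induction m)
    case 0
    then show ?case by (simp add: has_integral_refl)
  next
    case (Suc m)
    then have "(g has_integral (I (Suc m) + (\<Sum>j=1..m. I j))) {\<alpha> (Suc (Suc m))..\<alpha> 1}"
      by (intro has_integral_combine[OF _ _ g_int[of "Suc m"]] anti) auto
    then show ?case by (simp add: add.commute)
  qed
  from this[of K] have g_all: "(g has_integral (\<Sum>j=1..K. I j)) {0..\<alpha> 1}"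
    by (simp add: last)
  have E_g: "E c = ennreal (g c) * indicator {0..\<alpha> 1} c" for c
  proof (cases "c \<in> {0..\<alpha> 1}")
    case True
    then obtain j where j: "1 \<le> j" "j \<le> K" "\<alpha> (Suc j) \<le> c" "c \<le> \<alpha> j" using cover[of c] by auto
    then show ?thesis using True E_slice[OF j] slice_nonneg[OF j] by (simp add: g_def)
  next
    case False
    have "y(Suc n := c) \<notin> S" for y
    proof
      assume y: "y(Suc n := c) \<in> S"
      have "Suc n \<in> {1..Suc n}" "{Suc n} \<in> Pow {1..Suc n} - {{}}" by auto
      then have "0 \<le> (y(Suc n := c)) (Suc n)"
        and "(\<Sum>i\<in>{Suc n}. (y(Suc n := c)) i) \<le> (\<Sum>j=1..card {Suc n}. \<alpha> j)"
        using y unfolding S_def sim_body_iff by blast+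
      then show False using False by simp
    qed
    then show ?thesis using False by (simp add: E_def)
  qed
  have "(\<integral>\<^sup>+ c. E c \<partial>lborel) = ennreal (\<Sum>j=1..K. I j)"
    unfolding E_g by (rule nn_integral_has_integral_lebesgue'[OF _ g_all]) (simp add: g_def)
  also have "(\<Sum>j=1..K. I j) = divided_power {..K} (Suc n) \<beta> (\<lambda>M. \<Sum>j=1..K. split_site j (sim_coeff n) M) {#}"
    unfolding I_def by (rule divided_power_sum[symmetric])
  also have "\<dots> = divided_power {..K} (Suc n) \<beta> (sim_coeff (Suc n)) {#}"
    by (rule divided_power_cong) (auto simp: sim_coeff_Suc_eq[of _ K] simp del: sim_coeff.simps)
  finally show ?case using fubini unfolding S_def \<alpha>_def by (simp del: sim_coeff.simps)
qed

section \<open>Signature of hyperbolic matrices\<close>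

text \<open>The reversed Cauchy-Schwarz inequality in this form does not refer to a basis, so it is
invariant under congruence.\<close>

definition hyperbolic_mat :: "nat \<Rightarrow> real mat \<Rightarrow> bool" where
  "hyperbolic_mat n A \<longleftrightarrow> (\<forall>x\<in>carrier_vec n. \<forall>y\<in>carrier_vec n.
     y \<bullet> (A *\<^sub>v y) > 0 \<longrightarrow> (x \<bullet> (A *\<^sub>v x)) * (y \<bullet> (A *\<^sub>v y)) \<le> (x \<bullet> (A *\<^sub>v y))\<^sup>2)"

lemma congruent_carrier:
  assumes "A \<in> carrier_mat n n" "P \<in> carrier_mat n n"
  shows "transpose_mat P * A * P \<in> carrier_mat n n"
  using assms by (intro mult_carrier_mat[of _ n n] transpose_carrier_mat[THEN iffD2])

lemma hyperbolic_congruent: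
  assumes "A \<in> carrier_mat n n" "P \<in> carrier_mat n n" "hyperbolic_mat n A"
  shows "hyperbolic_mat n (transpose_mat P * A * P)"
proof -
  have "x \<bullet> ((transpose_mat P * A * P) *\<^sub>v y) = (P *\<^sub>v x) \<bullet> (A *\<^sub>v (P *\<^sub>v y))"
    if "x \<in> carrier_vec n" "y \<in> carrier_vec n" for x y
  proof -
    have "(transpose_mat P * A * P) *\<^sub>v y = transpose_mat P *\<^sub>v (A *\<^sub>v (P *\<^sub>v y))"
      using assms that by (simp add: assoc_mult_mat_vec[of _ n n _ n])
    moreover have "A *\<^sub>v (P *\<^sub>v y) \<in> carrier_vec n" using assms that by simp
    ultimately show ?thesis
      using transpose_vec_mult_scalar[of P n n x "A *\<^sub>v (P *\<^sub>v y)"] assms(2) that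
        comm_scalar_prod[of x n "transpose_mat P *\<^sub>v (A *\<^sub>v (P *\<^sub>v y))"]
        comm_scalar_prod[of "P *\<^sub>v x" n "A *\<^sub>v (P *\<^sub>v y)"]
      by simp
  qed
  then show ?thesis
    using assms unfolding hyperbolic_mat_def by (auto intro!: mult_mat_vec_carrier)
qed

lemma symmetric_congruent:
  assumes "A \<in> carrier_mat n n" "P \<in> carrier_mat n n" "transpose_mat A = (A :: real mat)"
  shows "transpose_mat (transpose_mat P * A * P) = transpose_mat P * A * P"
proof -
  have "transpose_mat (transpose_mat P * A * P) = transpose_mat P * (transpose_mat A * P)"
    using assms by (subst transpose_mult[of _ n n _ n] | simp)+
  then show ?thesis using assms by (simp add: assoc_mult_mat[of _ n n _ n _ n])
qed

lemma congruent_index: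
  assumes "A \<in> carrier_mat n n" "P \<in> carrier_mat n n" "i < n" "j < n"
  shows "index_mat (transpose_mat P * A * P :: real mat) (i, j) =
    (\<Sum>k<n. \<Sum>l<n. index_mat P (k, i) * index_mat A (k, l) * index_mat P (l, j))"
proof -
  have "index_mat (transpose_mat P * A * P) (i, j) =
     (\<Sum>k<n. index_mat P (k, i) * (\<Sum>l<n. index_mat A (k, l) * index_mat P (l, j)))"
    using assms by (simp add: scalar_prod_def atLeast0LessThan)
  then show ?thesis by (simp add: sum_distrib_left mult.assoc)
qed

lemma unit_form_index:
  assumes "A \<in> carrier_mat n n" "i < n" "j < n"
  shows "unit_vec n i \<bullet> (A *\<^sub>v (unit_vec n j :: real vec)) = index_mat A (i, j)"
  using assms by (simp add: scalar_prod_left_unit mult_mat_vec_def)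

lemma symmetric_index:
  assumes "A \<in> carrier_mat n n" "transpose_mat A = A" "i < n" "j < n"
  shows "index_mat A (i, j) = index_mat A (j, i)"
  using assms by (metis carrier_matD index_transpose_mat(1))

lemma invertible_matI:
  assumes "A \<in> carrier_mat n n" "B \<in> carrier_mat n n" "A * B = 1\<^sub>m n" "B * A = 1\<^sub>m n"
  shows "invertible_mat (A :: real mat)"
  using assms unfolding invertible_mat_def inverts_mat_def by (auto intro!: exI[of _ B])

lemma invertible_matE:
  assumes "A \<in> carrier_mat n n" "invertible_mat (A :: real mat)"
  obtains B where "B \<in> carrier_mat n n" "A * B = 1\<^sub>m n" "B * A = 1\<^sub>m n"
proof -
  obtain B where B: "A * B = 1\<^sub>m (dim_row A)" "B * A = 1\<^sub>m (dim_row B)"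
    using assms(2) unfolding invertible_mat_def inverts_mat_def by blast
  have "dim_col B = n" using arg_cong[OF B(1), of dim_col] assms(1) by simp
  moreover have "dim_row B = n" using arg_cong[OF B(2), of dim_col] assms(1) by simp
  ultimately show thesis using that[of B] B assms(1) by auto
qed

lemma invertible_mult:
  assumes "A \<in> carrier_mat n n" "B \<in> carrier_mat n n" "invertible_mat (A :: real mat)" "invertible_mat B"
  shows "invertible_mat (A * B)"
proof -
  obtain A' where A': "A' \<in> carrier_mat n n" "A * A' = 1\<^sub>m n" "A' * A = 1\<^sub>m n"
    using invertible_matE assms by blast
  obtain B' where B': "B' \<in> carrier_mat n n" "B * B' = 1\<^sub>m n" "B' * B = 1\<^sub>m n"
    using invertible_matE assms by blast
  have "A * B * (B' * A') = A * ((B * B') * A')"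
    using assms A'(1) B'(1) by (simp add: assoc_mult_mat[of _ n n _ n _ n])
  moreover have "B' * A' * (A * B) = B' * ((A' * A) * B)"
    using assms A'(1) B'(1) by (simp add: assoc_mult_mat[of _ n n _ n _ n])
  ultimately show ?thesis
    using assms A' B' by (intro invertible_matI[of _ n "B' * A'"]) auto
qed

text \<open>One step of symmetric Gaussian elimination, which also rescales the pivot to \<open>\<plusminus>1\<close>.\<close>

lemma pivot_congruence:
  assumes A: "A \<in> carrier_mat n n" "transpose_mat A = (A :: real mat)" and r: "r < n"
    and piv: "index_mat A (r, r) \<noteq> 0"
  obtains E where "E \<in> carrier_mat n n" "invertible_mat E"
    "\<And>i j. i < n \<Longrightarrow> j < n \<Longrightarrow> index_mat (transpose_mat E * A * E) (i, j) =
       (if i = r then (if j = r then sgn (index_mat A (r, r)) else 0) else if j = r then 0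
        else index_mat A (i, j) - index_mat A (r, i) * index_mat A (r, j) / index_mat A (r, r))"
proof -
  define d where "d = index_mat A (r, r)"
  \<comment> \<open>\<open>E\<close> is the diagonal matrix \<open>a\<close> plus the row vector \<open>b\<close> in row \<open>r\<close>, and \<open>F\<close> is its inverse.\<close>
  define a where "a j = (if j = r then 1 / sqrt \<bar>d\<bar> else 1)" for j
  define b where "b j = (if j = r then 0 else - index_mat A (r, j) / d)" for j
  define E where "E = mat n n (\<lambda>(k, j). (if k = j then a j else 0) + (if k = r then b j else 0))"
  define F where "F = mat n n (\<lambda>(k, j). (if k = j then 1 / a j else 0) + (if k = r then - b j / (a j * a r) else 0))"
  have "d \<noteq> 0" using piv by (simp add: d_def)
  then have a_nz: "a j \<noteq> 0" for j by (simp add: a_def)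
  have br: "b r = 0" by (simp add: b_def)
  have EF: "E \<in> carrier_mat n n" "F \<in> carrier_mat n n" by (auto simp: E_def F_def)
  have sumE: "(\<Sum>k<n. ((if k = j then u else 0) + (if k = r then v else 0)) * f k) = u * f j + v * f r"
    if "j < n" for j u v and f :: "nat \<Rightarrow> real"
    using that r by (simp add: distrib_right sum.distrib if_distrib[of "\<lambda>c. c * d" for d] sum.delta cong: if_cong)
  have row: "(\<Sum>k<n. ((if i = k then u k else 0) + (if i = r then v k else 0)) *
      ((if k = j then p else 0) + (if k = r then q else 0))) =
      (if i = j then u j * p else 0) + (if i = r then u i * q else 0) + (if i = r then v j * p + v r * q else 0)"
    if "i < n" "j < n" for i j p q and u v :: "nat \<Rightarrow> real"
  proof -
    have "(\<Sum>k<n. ((if i = k then u k else 0) + (if i = r then v k else 0)) *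
      ((if k = j then p else 0) + (if k = r then q else 0))) =
      (\<Sum>k<n. ((if k = j then p else 0) + (if k = r then q else 0)) *
        ((if i = k then u k else 0) + (if i = r then v k else 0)))"
      by (simp add: mult.commute)
    also have "\<dots> = p * ((if i = j then u j else 0) + (if i = r then v j else 0)) +
        q * ((if i = r then u r else 0) + (if i = r then v r else 0))"
      by (subst sumE[OF that(2)]) auto
    finally show ?thesis by (auto simp: algebra_simps)
  qed
  have "E * F = 1\<^sub>m n"
    by (rule eq_matI; use EF r a_nz in \<open>simp add: E_def F_def scalar_prod_def atLeast0LessThan row br\<close>;
        use a_nz in \<open>auto simp: field_simps br\<close>)
  moreover have "F * E = 1\<^sub>m n"
    by (rule eq_matI; use EF r a_nz in \<open>simp add: E_def F_def scalar_prod_def atLeast0LessThan row br\<close>;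
        use a_nz in \<open>auto simp: field_simps br\<close>)
  ultimately have "invertible_mat E" using EF by (intro invertible_matI)
  moreover have "index_mat (transpose_mat E * A * E) (i, j) =
       (if i = r then (if j = r then sgn d else 0) else if j = r then 0
        else index_mat A (i, j) - index_mat A (r, i) * index_mat A (r, j) / d)"
    if ij: "i < n" "j < n" for i j
  proof -
    have "index_mat (transpose_mat E * A * E) (i, j) =
       (\<Sum>k<n. ((if k = i then a i else 0) + (if k = r then b i else 0)) *
         (\<Sum>l<n. ((if l = j then a j else 0) + (if l = r then b j else 0)) * index_mat A (k, l)))"
      using A(1) EF ij by (subst congruent_index[OF A(1) EF(1)])
        (auto simp: E_def sum_distrib_left mult_ac intro!: sum.cong)
    also have "\<dots> = a i * (a j * index_mat A (i, j) + b j * index_mat A (i, r)) +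
        b i * (a j * index_mat A (r, j) + b j * index_mat A (r, r))"
      by (simp only: sumE[OF ij(1)] sumE[OF ij(2)])
    also have "index_mat A (i, r) = index_mat A (r, i)" using symmetric_index[OF A ij(1) r] .
    finally have *: "index_mat (transpose_mat E * A * E) (i, j) =
        a i * (a j * index_mat A (i, j) + b j * index_mat A (r, i)) + b i * (a j * index_mat A (r, j) + b j * d)"
      by (simp add: d_def)
    show ?thesis
    proof (cases "i = r \<and> j = r")
      case True
      have "a r * (a r * d) = d / \<bar>d\<bar>" by (simp add: a_def)
      also have "\<dots> = sgn d" using \<open>d \<noteq> 0\<close> by (simp add: sgn_if)
      finally show ?thesis unfolding * using True by (simp add: br d_def)
    next
      case False
      then show ?thesis unfolding *
        using \<open>d \<noteq> 0\<close> symmetric_index[OF A ij(1) r] by (auto simp: a_def b_def d_def[symmetric] field_simps)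
    qed
  qed
  ultimately show thesis using EF that unfolding d_def by blast
qed

lemma swap_congruence:
  assumes A: "A \<in> carrier_mat n n" and r: "r < n" "s < n"
  obtains E where "E \<in> carrier_mat n n" "invertible_mat E"
    "\<And>i j. i < n \<Longrightarrow> j < n \<Longrightarrow> index_mat (transpose_mat E * (A :: real mat) * E) (i, j) =
       index_mat A (Transposition.transpose r s i, Transposition.transpose r s j)"
proof -
  define \<sigma> where "\<sigma> = Transposition.transpose r s"
  define E :: "real mat" where "E = mat n n (\<lambda>(k, j). if k = \<sigma> j then 1 else 0)"
  have \<sigma>: "\<sigma> i < n" if "i < n" for i using that r by (auto simp: \<sigma>_def Transposition.transpose_def)
  have inv: "\<sigma> (\<sigma> i) = i" for i by (simp add: \<sigma>_def)
  have E: "E \<in> carrier_mat n n" by (simp add: E_def)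
  have sumE: "(\<Sum>k<n. (if k = \<sigma> j then 1 else 0) * f k) = f (\<sigma> j)" if "j < n" for j and f :: "nat \<Rightarrow> real"
    using \<sigma>[OF that] by (simp add: if_distrib[of "\<lambda>c. c * d" for d] sum.delta cong: if_cong)
  have "E * E = 1\<^sub>m n"
  proof (rule eq_matI)
    fix i j assume ij: "i < dim_row (1\<^sub>m n :: real mat)" "j < dim_col (1\<^sub>m n :: real mat)"
    then have ij: "i < n" "j < n" by simp_all
    then have "index_mat (E * E) (i, j) = (\<Sum>k<n. (if k = \<sigma> j then 1 else 0) * (if i = \<sigma> k then 1 else 0))"
      by (auto simp: E_def scalar_prod_def atLeast0LessThan intro!: sum.cong)
    also have "\<dots> = (if i = \<sigma> (\<sigma> j) then 1 else 0)" by (rule sumE[OF ij(2)])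
    finally show "index_mat (E * E) (i, j) = index_mat (1\<^sub>m n) (i, j)"
      using ij by (simp add: inv)
  qed (auto simp: E_def)
  then have "invertible_mat E" using E by (intro invertible_matI)
  moreover have "index_mat (transpose_mat E * A * E) (i, j) = index_mat A (\<sigma> i, \<sigma> j)" if ij: "i < n" "j < n" for i j
  proof -
    have "index_mat (transpose_mat E * A * E) (i, j) =
       (\<Sum>k<n. (if k = \<sigma> i then 1 else 0) * (\<Sum>l<n. (if l = \<sigma> j then 1 else 0) * index_mat A (k, l)))"
      using ij by (subst congruent_index[OF A E])
        (auto simp: E_def sum_distrib_left intro!: sum.cong)
    then show ?thesis by (simp only: sumE ij)
  qed
  ultimately show thesis using E that unfolding \<sigma>_def by blast
qed

text \<open>Once a positive pivot has been split off, the remaining block is negative semidefinite. As long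
as it has a non-zero diagonal entry, that entry is negative, and it is moved to the front and
used as the next pivot; when there is none left, semidefiniteness forces the whole block to
vanish.\<close>

lemma diagonal_pivots_extend:
  assumes "A \<in> carrier_mat n n" "transpose_mat A = (A :: real mat)" "hyperbolic_mat n A"
    and "1 \<le> r" "r \<le> n"
    and "\<And>i j. i < r \<Longrightarrow> j < n \<Longrightarrow> index_mat A (i, j) = (if i \<noteq> j then 0 else if i = 0 then 1 else - 1)"
  shows "\<exists>P m. P \<in> carrier_mat n n \<and> invertible_mat P \<and> m \<le> n \<and> 1 \<le> m \<and> transpose_mat P * A * P =
    mat n n (\<lambda>(i, j). if i \<noteq> j then 0 else if i < 1 then 1 else if i < m then - 1 else 0)"
  using assms
proof (induction "n - r" arbitrary: r A)
  case (0 r A)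
  then have "transpose_mat (1\<^sub>m n) * A * 1\<^sub>m n =
    mat n n (\<lambda>(i, j). if i \<noteq> j then 0 else if i < 1 then 1 else if i < r then - 1 else 0)"
    by (intro eq_matI) auto
  moreover have "invertible_mat (1\<^sub>m n :: real mat)" by (rule invertible_matI[of _ n "1\<^sub>m n"]) auto
  ultimately show ?case using 0 by (intro exI[of _ "1\<^sub>m n"] exI[of _ r]) auto
next
  case (Suc d r A)
  note A = Suc.prems(1,2)
  have neg: "index_mat A (i, i) + 2 * t * index_mat A (i, j) + t\<^sup>2 * index_mat A (j, j) \<le> 0"
    if "i < n" "j < n" "i \<ge> r" "j \<ge> r" for i j t
  proof -
    \<comment> \<open>Orthogonal to the first basis vector, whose norm is \<open>1\<close>.\<close>
    define x where "x = unit_vec n i + t \<cdot>\<^sub>v (unit_vec n j :: real vec)"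
    have xc: "x \<in> carrier_vec n" by (simp add: x_def)
    have lin: "z \<bullet> (A *\<^sub>v x) = z \<bullet> (A *\<^sub>v unit_vec n i) + t * (z \<bullet> (A *\<^sub>v unit_vec n j))"
      if "z \<in> carrier_vec n" for z
      using that A unfolding x_def
      by (simp add: mult_add_distrib_mat_vec[of A n n] mult_mat_vec[of A n n] scalar_prod_add_distrib[of _ n])
    have lin2: "x \<bullet> w = unit_vec n i \<bullet> w + t * (unit_vec n j \<bullet> w)" if "w \<in> carrier_vec n" for w
      using that unfolding x_def by (simp add: add_scalar_prod_distrib[of _ n])
    have xx: "x \<bullet> (A *\<^sub>v x) = index_mat A (i, i) + 2 * t * index_mat A (i, j) + t\<^sup>2 * index_mat A (j, j)"
      unfolding lin[OF xc] using A that symmetric_index[OF A that(1,2)]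
      by (simp add: lin2 unit_form_index[OF A(1)] power2_eq_square algebra_simps)
    let ?e = "unit_vec n 0 :: real vec"
    have "0 < n" using that by simp
    have "?e \<bullet> (A *\<^sub>v ?e) = 1"
      using unit_form_index[OF A(1), of 0 0] Suc.prems(4,6) \<open>0 < n\<close> by simp
    moreover have "x \<bullet> (A *\<^sub>v ?e) = 0"
      using that A \<open>0 < n\<close> Suc.prems(4,6) symmetric_index[OF A, of i 0] symmetric_index[OF A, of j 0]
      by (simp add: lin2 unit_form_index[OF A(1)])
    moreover have "0 < ?e \<bullet> (A *\<^sub>v ?e) \<Longrightarrow>
        (x \<bullet> (A *\<^sub>v x)) * (?e \<bullet> (A *\<^sub>v ?e)) \<le> (x \<bullet> (A *\<^sub>v ?e))\<^sup>2"
      using Suc.prems(3) xc unfolding hyperbolic_mat_def by (metis unit_vec_carrier)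
    ultimately show ?thesis unfolding xx[symmetric] by simp
  qed
  show ?case
  proof (cases "\<exists>s. r \<le> s \<and> s < n \<and> index_mat A (s, s) \<noteq> 0")
    case False
    have "index_mat A (i, j) = 0" if "i < n" "j < n" "i \<ge> r" "j \<ge> r" for i j
    proof (rule psd_form_kernel)
      fix t
      show "0 \<le> - index_mat A (i, i) + 2 * t * index_mat A (i, j) + t\<^sup>2 * (- index_mat A (j, j))"
        using neg[OF that, of "- t"] by simp
    qed (use False that in auto)
    then have "transpose_mat (1\<^sub>m n) * A * 1\<^sub>m n =
      mat n n (\<lambda>(i, j). if i \<noteq> j then 0 else if i < 1 then 1 else if i < r then - 1 else 0)"
    proof (intro eq_matI)
      fix i j
      assume "i < dim_row (mat n n (\<lambda>(i, j). if i \<noteq> j then 0 else if i < 1 then 1 else if i < r then - 1 else 0) :: real mat)"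
        "j < dim_col (mat n n (\<lambda>(i, j). if i \<noteq> j then 0 else if i < 1 then 1 else if i < r then - 1 else 0) :: real mat)"
      then have ij: "i < n" "j < n" by simp_all
      consider "i < r" | "j < r" "r \<le> i" | "r \<le> i" "r \<le> j" by linarith
      then have "index_mat A (i, j) = (if i \<noteq> j then 0 else if i < 1 then 1 else if i < r then - 1 else 0)"
      proof cases
        case 1
        then show ?thesis using Suc.prems(6)[OF 1 ij(2)] by simp
      next
        case 2
        then show ?thesis using Suc.prems(6)[OF 2(1) ij(1)] symmetric_index[OF A ij] by simp
      next
        case 3
        then show ?thesis using \<open>1 \<le> r\<close> ij \<open>\<And>i j. i < n \<Longrightarrow> j < n \<Longrightarrow> i \<ge> r \<Longrightarrow> j \<ge> r \<Longrightarrow> index_mat A (i, j) = 0\<close> by simp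
      qed
      then show "index_mat (transpose_mat (1\<^sub>m n) * A * 1\<^sub>m n) (i, j) =
          index_mat (mat n n (\<lambda>(i, j). if i \<noteq> j then 0 else if i < 1 then 1 else if i < r then - 1 else 0)) (i, j)"
        using ij A by simp
    qed (use A in auto)
    moreover have "invertible_mat (1\<^sub>m n :: real mat)" by (rule invertible_matI[of _ n "1\<^sub>m n"]) auto
    ultimately show ?thesis using Suc.prems(4,5) by (intro exI[of _ "1\<^sub>m n"] exI[of _ r]) auto
  next
    case True
    then obtain s where s: "r \<le> s" "s < n" "index_mat A (s, s) \<noteq> 0" by blast
    have rn: "r < n" using s by simp
    obtain E where E: "E \<in> carrier_mat n n" "invertible_mat E"
      "\<And>i j. i < n \<Longrightarrow> j < n \<Longrightarrow> index_mat (transpose_mat E * A * E) (i, j) =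
         index_mat A (Transposition.transpose r s i, Transposition.transpose r s j)"
      using swap_congruence[OF A(1) rn s(2)] by blast
    define B where "B = transpose_mat E * A * E"
    have B: "B \<in> carrier_mat n n" "transpose_mat B = B" "hyperbolic_mat n B"
      unfolding B_def using congruent_carrier[OF A(1) E(1)]
        hyperbolic_congruent[OF A(1) E(1) Suc.prems(3)] symmetric_congruent[OF A(1) E(1) A(2)] by blast+
    have B_head: "index_mat B (i, j) = (if i \<noteq> j then 0 else if i = 0 then 1 else - 1)"
      if "i < r" "j < n" for i j
    proof -
      have "Transposition.transpose r s i = i" using that s by (auto simp: Transposition.transpose_def)
      moreover have "Transposition.transpose r s j < n" using that s by (auto simp: Transposition.transpose_def)
      moreover have "(i = Transposition.transpose r s j) = (i = j)"
        using that s by (auto simp: Transposition.transpose_def)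
      ultimately show ?thesis using that rn Suc.prems(6) by (simp add: B_def E(3))
    qed
    have "index_mat B (r, r) = index_mat A (s, s)" using rn by (simp add: B_def E(3))
    moreover have "index_mat A (s, s) \<le> 0" using neg[OF s(2) s(2) s(1) s(1), of 0] by simp
    ultimately have B_rr: "index_mat B (r, r) < 0" using s(3) by simp
    obtain F where F: "F \<in> carrier_mat n n" "invertible_mat F"
      "\<And>i j. i < n \<Longrightarrow> j < n \<Longrightarrow> index_mat (transpose_mat F * B * F) (i, j) =
       (if i = r then (if j = r then sgn (index_mat B (r, r)) else 0) else if j = r then 0
        else index_mat B (i, j) - index_mat B (r, i) * index_mat B (r, j) / index_mat B (r, r))"
      using pivot_congruence[OF B(1,2) rn] B_rr by (metis less_irrefl)
    define D where "D = transpose_mat F * B * F"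
    have D: "D \<in> carrier_mat n n" "transpose_mat D = D" "hyperbolic_mat n D"
      unfolding D_def using congruent_carrier[OF B(1) F(1)]
        hyperbolic_congruent[OF B(1) F(1) B(3)] symmetric_congruent[OF B(1) F(1) B(2)] by blast+
    have D_head: "index_mat D (i, j) = (if i \<noteq> j then 0 else if i = 0 then 1 else - 1)"
      if "i < Suc r" "j < n" for i j
    proof -
      have "index_mat B (r, i) = 0" if "i < r"
        using B_head[OF that rn] symmetric_index[OF B(1,2), of r i] that rn by simp
      then show ?thesis
        using that rn B_rr B_head[of i j] Suc.prems(4) by (auto simp: D_def F(3) less_Suc_eq)
    qed
    have "d = n - Suc r" "1 \<le> Suc r" "Suc r \<le> n" using Suc.hyps(2) rn by simp_all
    then obtain P m where P: "P \<in> carrier_mat n n" "invertible_mat P" "m \<le> n" "1 \<le> m"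
      "transpose_mat P * D * P =
        mat n n (\<lambda>(i, j). if i \<noteq> j then 0 else if i < 1 then 1 else if i < m then - 1 else 0)"
      using Suc.hyps(1)[OF _ D _ _ D_head] by blast
    have "transpose_mat (E * F * P) * A * (E * F * P) = transpose_mat P * D * P"
      unfolding D_def B_def using E(1) F(1) P(1) A(1)
      by (simp add: transpose_mult[of _ n n _ n] assoc_mult_mat[of _ n n _ n _ n])
    then show ?thesis
      using E(1,2) F(1,2) P by (intro exI[of _ "E * F * P"] exI[of _ m]) (auto intro!: invertible_mult)
  qed
qed

theorem lorentzian_signatureI:
  assumes A: "A \<in> carrier_mat n n" "transpose_mat A = A" and "hyperbolic_mat n A"
    and "n \<ge> 1" "index_mat A (0, 0) > 0"
  shows "lorentzian_signature n A"
proof -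
  have n: "0 < n" using assms by simp
  obtain F where F: "F \<in> carrier_mat n n" "invertible_mat F"
      "\<And>i j. i < n \<Longrightarrow> j < n \<Longrightarrow> index_mat (transpose_mat F * A * F) (i, j) =
       (if i = 0 then (if j = 0 then sgn (index_mat A (0, 0)) else 0) else if j = 0 then 0
        else index_mat A (i, j) - index_mat A (0, i) * index_mat A (0, j) / index_mat A (0, 0))"
    using pivot_congruence[OF A n] assms(5) by (metis less_irrefl)
  define D where "D = transpose_mat F * A * F"
  have D: "D \<in> carrier_mat n n" "transpose_mat D = D" "hyperbolic_mat n D"
    unfolding D_def using congruent_carrier[OF A(1) F(1)]
        hyperbolic_congruent[OF A(1) F(1) assms(3)] symmetric_congruent[OF A(1) F(1) A(2)] by blast+
  have "index_mat D (i, j) = (if i \<noteq> j then 0 else if i = 0 then 1 else - 1)" if "i < 1" "j < n" for i j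
    using that n assms(5) by (auto simp: D_def F(3))
  then obtain P m where P: "P \<in> carrier_mat n n" "invertible_mat P" "m \<le> n" "1 \<le> m"
      "transpose_mat P * D * P =
        mat n n (\<lambda>(i, j). if i \<noteq> j then 0 else if i < 1 then 1 else if i < m then - 1 else 0)"
    using diagonal_pivots_extend[OF D, of 1] \<open>n \<ge> 1\<close> by auto
  have "1 + (m - 1) = m" using P(4) by simp
  have "transpose_mat (F * P) * A * (F * P) = transpose_mat P * D * P"
    unfolding D_def using F(1) P(1) A(1)
    by (simp add: transpose_mult[of _ n n _ n] assoc_mult_mat[of _ n n _ n _ n])
  moreover have "invertible_mat (F * P)" "F * P \<in> carrier_mat n n"
    using F(1,2) P(1,2) by (auto intro: invertible_mult)
  ultimately have "has_signature n A 1 (m - 1)"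
    unfolding has_signature_def \<open>1 + (m - 1) = m\<close> using P(3,5)
    by (intro conjI bexI[of _ "F * P"]) (simp_all del: assoc_mult_mat)
  then show ?thesis unfolding lorentzian_signature_def by blast
qed

section \<open>The volume polynomial\<close>

text \<open>Translates between exponent vectors and multisets.\<close>

definition monomial_mset :: "monomial \<Rightarrow> nat multiset" where
  "monomial_mset m = (\<Sum>i\<in>Poly_Mapping.keys m. replicate_mset (Poly_Mapping.lookup m i) i)"

lemma count_monomial_mset [simp]: "count (monomial_mset m) i = Poly_Mapping.lookup m i"
  by (auto simp: monomial_mset_def count_sum if_distrib sum.delta in_keys_iff cong: if_cong)

lemma set_monomial_mset [simp]: "set_mset (monomial_mset m) = Poly_Mapping.keys m"
  by (auto simp: set_mset_def in_keys_iff)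

lemma size_monomial_mset: "size (monomial_mset m) = monomial_degree m"
  by (simp add: size_multiset_overloaded_eq monomial_degree_def)

lemma monomial_mset_0 [simp]: "monomial_mset 0 = {#}"
  by (simp add: monomial_mset_def)

lemma monomial_mset_add_single:
  "monomial_mset (m + Poly_Mapping.single i q) = monomial_mset m + replicate_mset q i"
  by (rule multiset_eqI) (simp add: lookup_add lookup_single when_def)

definition monomials :: "nat set \<Rightarrow> nat \<Rightarrow> monomial set" where
  "monomials B n = {m. Poly_Mapping.keys m \<subseteq> B \<and> monomial_degree m = n}"

lemma monomials_empty: "monomials {} n = (if n = 0 then {0} else {})"
  by (auto simp: monomials_def monomial_degree_def)

lemma monomial_degree_add_single:
  "monomial_degree (m + Poly_Mapping.single i q) = monomial_degree m + q"
  unfolding size_monomial_mset[symmetric] monomial_mset_add_single by simp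

text \<open>Splitting off the exponent of one variable, in the form needed to reindex sums.\<close>

lemma monomials_insert:
  assumes "j \<notin> B"
  shows "monomials (insert j B) n = (\<lambda>(q, m). m + Poly_Mapping.single j q) ` (SIGMA q:{..n}. monomials B (n - q))"
    and "inj_on (\<lambda>(q, m). m + Poly_Mapping.single j q) (SIGMA q:{..n}. monomials B (n - q))"
proof -
  have lookup: "Poly_Mapping.lookup m j = 0" if "m \<in> monomials B k" for m k
    using that assms by (auto simp: monomials_def in_keys_iff)
  show "inj_on (\<lambda>(q, m). m + Poly_Mapping.single j q) (SIGMA q:{..n}. monomials B (n - q))"
  proof (rule inj_onI, clarify)
    fix q m q' m'
    assume m: "m \<in> monomials B (n - q)" "m' \<in> monomials B (n - q')"
      and eq: "m + Poly_Mapping.single j q = m' + Poly_Mapping.single j q'"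
    have "Poly_Mapping.lookup (m + Poly_Mapping.single j q) j = Poly_Mapping.lookup (m' + Poly_Mapping.single j q') j"
      by (simp only: eq)
    then have "q = q'" by (simp add: lookup_add lookup[OF m(1)] lookup[OF m(2)])
    then show "q = q' \<and> m = m'" using eq by simp
  qed
  show "monomials (insert j B) n = (\<lambda>(q, m). m + Poly_Mapping.single j q) ` (SIGMA q:{..n}. monomials B (n - q))"
  proof (intro equalityI subsetI)
    fix m assume m: "m \<in> monomials (insert j B) n"
    define q where "q = Poly_Mapping.lookup m j"
    define m' where "m' = m - Poly_Mapping.single j q"
    have m_eq: "m = m' + Poly_Mapping.single j q"
      by (rule poly_mapping_eqI) (auto simp: m'_def q_def lookup_add lookup_minus lookup_single when_def)
    have "Poly_Mapping.keys m' \<subseteq> B"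
    proof
      fix i assume i: "i \<in> Poly_Mapping.keys m'"
      then have "i \<noteq> j" "i \<in> Poly_Mapping.keys m"
        by (auto simp: in_keys_iff m'_def q_def lookup_minus lookup_single when_def)
      then show "i \<in> B" using m by (auto simp: monomials_def)
    qed
    moreover have "monomial_degree m' + q = n"
      using m monomial_degree_add_single[of m' j q] m_eq by (simp add: monomials_def)
    ultimately have "q \<le> n" "m' \<in> monomials B (n - q)" by (auto simp: monomials_def)
    then show "m \<in> (\<lambda>(q, m). m + Poly_Mapping.single j q) ` (SIGMA q:{..n}. monomials B (n - q))"
      using m_eq by (intro image_eqI[of _ _ "(q, m')"]) auto
  next
    fix m assume "m \<in> (\<lambda>(q, m). m + Poly_Mapping.single j q) ` (SIGMA q:{..n}. monomials B (n - q))"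
    then obtain q m' where m: "m = m' + Poly_Mapping.single j q" "q \<le> n" "m' \<in> monomials B (n - q)"
      by auto
    have "Poly_Mapping.keys m \<subseteq> insert j B"
    proof
      fix i assume "i \<in> Poly_Mapping.keys m"
      then have "i = j \<or> i \<in> Poly_Mapping.keys m'"
        by (auto simp: in_keys_iff m(1) lookup_add lookup_single when_def split: if_splits)
      then show "i \<in> insert j B" using m(3) by (auto simp: monomials_def)
    qed
    then show "m \<in> monomials (insert j B) n"
      using m by (auto simp: monomials_def monomial_degree_add_single)
  qed
qed

lemma finite_monomials: "finite B \<Longrightarrow> finite (monomials B n)"
  by (induction B arbitrary: n rule: finite_induct) (auto simp: monomials_empty monomials_insert(1))

text \<open>The multinomial theorem, by splitting off the variables one at a time.\<close>

lemma divided_power_monomials: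
  assumes "finite A" "B \<subseteq> A" "\<And>i. i \<in> A - B \<Longrightarrow> x i = 0"
  shows "divided_power A n x F N = (\<Sum>m\<in>monomials B n. F (N + monomial_mset m) *
    (\<Prod>i\<in>B. x i ^ Poly_Mapping.lookup m i / fact (Poly_Mapping.lookup m i)))"
proof -
  have "finite B" using assms by (auto intro: finite_subset)
  then show ?thesis using assms(2,3)
  proof (induction B arbitrary: n x N rule: finite_induct)
    case empty
    have "ddir A x G M = 0" for G M using empty by (simp add: ddir_def)
    then have "divided_power A (Suc k) x F N = 0" for k by (simp add: divided_power_def)
    then show ?case by (cases n) (auto simp: monomials_empty)
  next
    case (insert j B)
    define y where "y = x(j := 0)"
    have j: "j \<in> A" using insert.prems by simp
    have y: "\<And>i. i \<in> A - B \<Longrightarrow> y i = 0" using insert.prems(2) by (auto simp: y_def)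
    let ?W = "\<lambda>m. \<Prod>i\<in>B. x i ^ Poly_Mapping.lookup m i / fact (Poly_Mapping.lookup m i)"
    have "x = (\<lambda>i. y i + (if i = j then x j else 0))" by (auto simp: y_def)
    then have "divided_power A n x F N = divided_power A n (\<lambda>i. y i + (if i = j then x j else 0)) F N"
      by (rule arg_cong)
    also have "\<dots> = (\<Sum>q\<le>n. x j ^ q / fact q * divided_power A (n - q) y F (N + replicate_mset q j))"
      by (rule divided_power_binomial[OF assms(1) j])
    also have "\<dots> = (\<Sum>q\<le>n. x j ^ q / fact q * (\<Sum>m\<in>monomials B (n - q).
        F (N + replicate_mset q j + monomial_mset m) *
        (\<Prod>i\<in>B. y i ^ Poly_Mapping.lookup m i / fact (Poly_Mapping.lookup m i))))"
      using insert.IH[OF _ y] insert.prems(1) by simp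
    also have "\<dots> = (\<Sum>q\<le>n. \<Sum>m\<in>monomials B (n - q). F (N + monomial_mset (m + Poly_Mapping.single j q)) *
        (x j ^ q / fact q * ?W m))"
      unfolding sum_distrib_left
    proof (intro sum.cong refl)
      fix q m
      have "(\<Prod>i\<in>B. y i ^ Poly_Mapping.lookup m i / fact (Poly_Mapping.lookup m i)) = ?W m"
        using insert.hyps by (intro prod.cong) (auto simp: y_def)
      then show "x j ^ q / fact q * (F (N + replicate_mset q j + monomial_mset m) *
          (\<Prod>i\<in>B. y i ^ Poly_Mapping.lookup m i / fact (Poly_Mapping.lookup m i))) =
          F (N + monomial_mset (m + Poly_Mapping.single j q)) * (x j ^ q / fact q * ?W m)"
        by (simp add: monomial_mset_add_single add_ac)
    qed
    also have "\<dots> = (\<Sum>(q, m)\<in>(SIGMA q:{..n}. monomials B (n - q)).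
        F (N + monomial_mset (m + Poly_Mapping.single j q)) * (x j ^ q / fact q * ?W m))"
      using finite_monomials[OF insert.hyps(1)] by (intro sum.Sigma) auto
    also have "\<dots> = (\<Sum>m\<in>monomials (insert j B) n. F (N + monomial_mset m) *
        (\<Prod>i\<in>insert j B. x i ^ Poly_Mapping.lookup m i / fact (Poly_Mapping.lookup m i)))"
      unfolding monomials_insert(1)[OF insert.hyps(2)] sum.reindex[OF monomials_insert(2)[OF insert.hyps(2)]]
    proof (intro sum.cong refl)
      fix p assume p: "p \<in> (SIGMA q:{..n}. monomials B (n - q))"
      obtain q m where qm: "p = (q, m)" "m \<in> monomials B (n - q)" using p by auto
      have mj: "Poly_Mapping.lookup m j = 0"
        using qm(2) insert.hyps(2) by (auto simp: monomials_def in_keys_iff)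
      have "?W (m + Poly_Mapping.single j q) = ?W m"
        using insert.hyps by (intro prod.cong) (auto simp: lookup_add lookup_single when_def)
      then show "(case p of (q, m) \<Rightarrow> F (N + monomial_mset (m + Poly_Mapping.single j q)) * (x j ^ q / fact q * ?W m)) =
          ((\<lambda>m. F (N + monomial_mset m) *
            (\<Prod>i\<in>insert j B. x i ^ Poly_Mapping.lookup m i / fact (Poly_Mapping.lookup m i))) \<circ>
           (\<lambda>(q, m). m + Poly_Mapping.single j q)) p"
        using insert.hyps by (simp add: qm(1) lookup_add mj)
    qed
    finally show ?case .
  qed
qed

definition sim_poly :: "nat \<Rightarrow> rpoly" where
  "sim_poly n = (\<Sum>m\<in>monomials {1..n} n. Poly_Mapping.single m
     (sim_coeff n (monomial_mset m) / (\<Prod>i=1..n. fact (Poly_Mapping.lookup m i))))"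

lemma lookup_sim_poly:
  "Poly_Mapping.lookup (sim_poly n) m = (if m \<in> monomials {1..n} n
     then sim_coeff n (monomial_mset m) / (\<Prod>i=1..n. fact (Poly_Mapping.lookup m i)) else 0)"
  unfolding sim_poly_def lookup_sum
  by (simp add: lookup_single when_def sum.delta finite_monomials)

lemma sim_coeff_pos_monomial:
  assumes "m \<in> monomials {1..n} n"
  shows "sim_coeff n (monomial_mset m) > 0"
  using assms by (intro sim_coeff_pos) (auto simp: monomials_def size_monomial_mset)

lemma lookup_sim_poly_pos:
  "m \<in> monomials {1..n} n \<Longrightarrow> Poly_Mapping.lookup (sim_poly n) m > 0"
  by (auto simp: lookup_sim_poly sim_coeff_pos_monomial intro!: divide_pos_pos prod_pos)

lemma keys_sim_poly: "Poly_Mapping.keys (sim_poly n) = monomials {1..n} n"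
proof (intro equalityI subsetI)
  show "m \<in> monomials {1..n} n" if "m \<in> Poly_Mapping.keys (sim_poly n)" for m
    using that by (auto simp: in_keys_iff lookup_sim_poly split: if_splits)
  show "m \<in> Poly_Mapping.keys (sim_poly n)" if "m \<in> monomials {1..n} n" for m
    using lookup_sim_poly_pos[OF that] by (simp add: in_keys_iff)
qed

theorem sim_poly_volume:
  assumes n: "1 \<le> n" and \<beta>: "\<And>k. k \<in> {1..n} \<Longrightarrow> \<beta> k \<ge> 0"
  shows "rpoly_eval \<beta> (sim_poly n) = vol n (sim_body n (\<lambda>k. \<Sum>j=k..n. \<beta> j))"
proof -
  \<comment> \<open>Only \<open>\<beta>\<^sub>1, \<dots>, \<beta>\<^sub>n\<close> are constrained by the hypothesis, so the other entries are replaced by \<open>0\<close>.\<close>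
  define b where "b i = (if i \<in> {1..n} then \<beta> i else 0)" for i
  have "sim_body n (\<lambda>k. \<Sum>j=k..n. \<beta> j) = sim_body n (\<lambda>k. \<Sum>j=k..n. b j)"
    by (intro sim_body_cong sum.cong) (auto simp: b_def)
  then have "vol n (sim_body n (\<lambda>k. \<Sum>j=k..n. \<beta> j)) =
      enn2real (ennreal (divided_power {..n} n b (sim_coeff n) {#}))"
    using sim_body_emeasure[OF n, of b n] \<beta> by (simp add: vol_def measure_def b_def)
  also have "\<dots> = divided_power {..n} n b (sim_coeff n) {#}"
    using \<beta> by (intro enn2real_ennreal divided_power_nonneg sim_coeff_nonneg) (simp add: b_def)
  also have "\<dots> = (\<Sum>m\<in>monomials {1..n} n. sim_coeff n ({#} + monomial_mset m) *
      (\<Prod>i=1..n. b i ^ Poly_Mapping.lookup m i / fact (Poly_Mapping.lookup m i)))"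
    by (rule divided_power_monomials) (auto simp: b_def)
  also have "\<dots> = rpoly_eval \<beta> (sim_poly n)"
    unfolding rpoly_eval_def keys_sim_poly
  proof (intro sum.cong refl)
    fix m assume m: "m \<in> monomials {1..n} n"
    have "(\<Prod>i\<in>Poly_Mapping.keys m. \<beta> i ^ Poly_Mapping.lookup m i) = (\<Prod>i=1..n. b i ^ Poly_Mapping.lookup m i)"
    proof (rule prod.mono_neutral_cong_left)
      show keys: "Poly_Mapping.keys m \<subseteq> {1..n}" using m by (simp add: monomials_def)
      show "\<beta> i ^ Poly_Mapping.lookup m i = b i ^ Poly_Mapping.lookup m i" if "i \<in> Poly_Mapping.keys m" for i
        using subsetD[OF keys that] by (simp only: b_def if_True)
    qed (auto simp: in_keys_iff)
    then show "sim_coeff n ({#} + monomial_mset m) *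
        (\<Prod>i=1..n. b i ^ Poly_Mapping.lookup m i / fact (Poly_Mapping.lookup m i)) =
      Poly_Mapping.lookup (sim_poly n) m * (\<Prod>i\<in>Poly_Mapping.keys m. \<beta> i ^ Poly_Mapping.lookup m i)"
      using m by (simp add: lookup_sim_poly prod_dividef)
  qed
  finally show ?thesis by simp
qed

text \<open>Multiplying with the factorials turns coefficients into exponential coefficients, for which a
derivative just adds a site.\<close>

lemma iterated_derivative_sim_poly:
  assumes "set is \<subseteq> {1..n}" "Poly_Mapping.keys m \<subseteq> {1..n}"
  shows "Poly_Mapping.lookup (foldr partial_deriv is (sim_poly n)) m *
    (\<Prod>i=1..n. fact (Poly_Mapping.lookup m i)) = sim_coeff n (monomial_mset m + mset is)"
  using assms
proof (induction "is" arbitrary: m)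
  case Nil
  have "(\<Prod>i=1..n. fact (Poly_Mapping.lookup m i) :: real) > 0" by (intro prod_pos) auto
  then show ?case
    using Nil sim_coeff_size[of "monomial_mset m" n]
    by (auto simp: lookup_sim_poly monomials_def size_monomial_mset)
next
  case (Cons k "is")
  let ?m = "m + Poly_Mapping.single k 1"
  have k: "k \<in> {1..n}" using Cons.prems by simp
  have "(\<Prod>i=1..n. fact (Poly_Mapping.lookup ?m i) :: real) =
      (\<Prod>i=1..n. fact (Poly_Mapping.lookup m i) * (if i = k then real (Poly_Mapping.lookup m k + 1) else 1))"
    by (intro prod.cong refl) (auto simp: lookup_add lookup_single when_def)
  also have "\<dots> = (\<Prod>i=1..n. fact (Poly_Mapping.lookup m i)) * real (Poly_Mapping.lookup m k + 1)"
    using k by (simp add: prod.distrib prod.delta)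
  finally have "Poly_Mapping.lookup (foldr partial_deriv (k # is) (sim_poly n)) m *
      (\<Prod>i=1..n. fact (Poly_Mapping.lookup m i)) =
      Poly_Mapping.lookup (foldr partial_deriv is (sim_poly n)) ?m * (\<Prod>i=1..n. fact (Poly_Mapping.lookup ?m i))"
    by (simp add: lookup_partial_deriv)
  also have "\<dots> = sim_coeff n (monomial_mset ?m + mset is)"
    using Cons.prems by (intro Cons.IH)
      (auto simp: in_keys_iff lookup_add lookup_single when_def subset_iff split: if_splits)
  finally show ?case by (simp add: monomial_mset_add_single)
qed

lemma gram_mat_sim_poly:
  assumes "set is \<subseteq> {1..n}" "i < n" "j < n"
  shows "index_mat (gram_mat n (foldr partial_deriv is (sim_poly n))) (i, j) =
    sim_coeff n (add_mset (Suc i) (add_mset (Suc j) (mset is))) / 2"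
proof -
  have "Poly_Mapping.lookup (foldr partial_deriv (Suc i # Suc j # is) (sim_poly n)) 0 =
      sim_coeff n (add_mset (Suc i) (add_mset (Suc j) (mset is)))"
    using iterated_derivative_sim_poly[of "Suc i # Suc j # is" n 0] assms by simp
  then show ?thesis using assms by (simp add: gram_mat_def)
qed

text \<open>The quadratic form of the Gram matrix is half the polarisation of the volume polynomial, with
the directions other than the two free ones taken from the coordinate vectors in \<open>is\<close>. The
vector of ones is the vector of positive norm that \<open>polar_hyperbolic_all\<close> asks for.\<close>

theorem gram_mat_lorentzian:
  assumes idx: "set is \<subseteq> {1..n}" "length is + 2 = n"
  shows "lorentzian_signature n (gram_mat n (foldr partial_deriv is (sim_poly n)))"
proof (rule lorentzian_signatureI)
  interpret stieltjes_matrix "{1..n}" "boundary_laplacian n" by (rule boundary_laplacian_stieltjes)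
  let ?A = "gram_mat n (foldr partial_deriv is (sim_poly n))"
  define c where "c i j = sim_coeff n (add_mset i (add_mset j (mset is)))" for i j
  define vs :: "(nat \<Rightarrow> real) list" where "vs = map (\<lambda>i k. if k = i then 1 else 0) is"
  show A: "?A \<in> carrier_mat n n" by (simp add: gram_mat_def)
  have index: "index_mat ?A (i, j) = c (Suc i) (Suc j) / 2" if "i < n" "j < n" for i j
    unfolding c_def by (rule gram_mat_sim_poly[OF idx(1) that])
  show "transpose_mat ?A = ?A"
    using A by (intro eq_matI) (simp_all add: index c_def add_mset_commute)
  show "n \<ge> 1" using idx by simp
  show "index_mat ?A (0, 0) > 0"
  proof -
    have "c 1 1 > 0" unfolding c_def using idx by (intro sim_coeff_pos) auto
    then show ?thesis using idx index[of 0 0] by simp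
  qed
  define ext :: "real vec \<Rightarrow> nat \<Rightarrow> real" where "ext x i = vec_index x (i - 1)" for x i
  have polar: "polar (x # y # vs) (sim_coeff n) = (\<Sum>i=1..n. \<Sum>j=1..n. x i * c i j * y j)" for x y
  proof -
    have "polar (x # y # vs) (sim_coeff n) = ddir {1..n} y (ddir {1..n} x (sim_coeff n)) (mset is)"
      unfolding polar.simps vs_def by (rule polar_indicator[OF idx(1)])
    also have "\<dots> = (\<Sum>j=1..n. \<Sum>i=1..n. x i * c i j * y j)"
      by (simp add: ddir_def c_def sum_distrib_left mult_ac)
    finally show ?thesis by (subst sum.swap) simp
  qed
  have form: "x \<bullet> (?A *\<^sub>v y) = polar (ext x # ext y # vs) (sim_coeff n) / 2"
    if "x \<in> carrier_vec n" "y \<in> carrier_vec n" for x y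
  proof -
    have "x \<bullet> (?A *\<^sub>v y) = (\<Sum>i<n. \<Sum>j<n. vec_index x i * (c (Suc i) (Suc j) / 2) * vec_index y j)"
      using that A
      by (simp add: scalar_prod_def mult_mat_vec_def row_def index atLeast0LessThan sum_distrib_left mult.assoc)
    also have "\<dots> = (\<Sum>i=1..n. \<Sum>j=1..n. ext x i * c i j * ext y j) / 2"
      by (simp add: sum.atLeast1_atMost_eq ext_def sum_divide_distrib)
    finally show ?thesis unfolding polar .
  qed
  have "polar ((\<lambda>_. 1) # (\<lambda>_. 1) # vs) (sim_coeff n) > 0"
  proof (rule polar_pos_coeffs[where n = n])
    show "sim_coeff n M > 0" if "size M = n" "set_mset M \<subseteq> {1..n}" for M
      using that by (intro sim_coeff_pos) auto
  qed (use idx in \<open>auto simp: vs_def\<close>)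
  then have "polar (x # x # vs) (sim_coeff n) * polar (y # y # vs) (sim_coeff n)
      \<le> (polar (x # y # vs) (sim_coeff n))\<^sup>2" if "polar (y # y # vs) (sim_coeff n) > 0" for x y
    using that idx
    by (intro polar_hyperbolic_all[OF sim_coeff_face_functional]) (auto simp: vs_def)
  then show "hyperbolic_mat n ?A"
    unfolding hyperbolic_mat_def by (auto simp: form power_divide simp del: polar.simps)
qed

theorem theorem36:
  fixes n :: nat
  assumes "n \<ge> 1"
  shows "\<exists>p :: rpoly.
           (\<forall>\<beta> :: nat \<Rightarrow> real. (\<forall>k\<in>{1..n}. \<beta> k \<ge> 0) \<longrightarrow>
              rpoly_eval \<beta> p = vol n (sim_body n (\<lambda>k. \<Sum>j=k..n. \<beta> j))) \<and>
           lorentzian n n p"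
proof (intro exI[of _ "sim_poly n"] conjI allI impI)
  show "rpoly_eval \<beta> (sim_poly n) = vol n (sim_body n (\<lambda>k. \<Sum>j=k..n. \<beta> j))"
    if "\<forall>k\<in>{1..n}. \<beta> k \<ge> 0" for \<beta>
    using sim_poly_volume[OF assms] that by blast
  show "lorentzian n n (sim_poly n)"
    unfolding lorentzian_def keys_sim_poly
    using lookup_sim_poly_pos gram_mat_lorentzian by (auto simp: monomials_def)
qed

end
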